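(* For $n=1,\ldots,N$ consider the series $$\mathcal{L}_{(n)}^{\pm}(z)=\mathrm{tr}_{1,\ldots,n}\,\mathcal{E}_{(n)}^{\pm}\,\mathcal{L}_1(z)\,\mathcal{L}_2(z\pm h)\cdots\mathcal{L}_n(z\pm(n-1)h)\in\widetilde{\mathrm{Y}}(\widehat{R})[[z^{\pm1}]].$$ The coefficients of all $\mathcal{L}_{(n)}^{\pm}(z)$ (for all $n=1,\ldots,N$ and both signs) mutually commute.
   Context: Fix an integer $N\geq2$ and a formal parameter $h$. Let $\widehat{R}(u)=uI-hP\in\mathrm{End}\,\mathbb{C}^N\otimes\mathrm{End}\,\mathbb{C}^N[u,h]$, where $I$ is the identity and $P$ the permutation operator on $\mathbb{C}^N\otimes\mathbb{C}^N$. $\mathrm{Y}(\widehat{R})$ is the associative algebra over $\mathbb{C}[[h]]$ generated by $\lambda_{ij}^{(r)}$, $r\in\mathbb{Z}$, $i,j=1,\ldots,N$, subject to $$\widehat{R}(u-v)\mathcal{L}_1(u)\mathcal{L}_2(v)=\mathcal{L}_2(v)\mathcal{L}_1(u)\widehat{R}(u-v),$$ where $\mathcal{L}(u)=\sum_{i,j=1}^Ne_{ij}\otimes\lambda_{ij}(u)$, $\lambda_{ij}(u)=\sum_{r\in\mathbb{Z}}\lambda_{ij}^{(-r)}u^r$, $e_{ij}$ are matrix units, and $\mathcal{L}_k(u)$ is the copy of $\mathcal{L}(u)$ whose matrix part acts on the $k$-th tensor factor. For $p\geq0$ let $I_p$ be the two-sided ideal of $\mathrm{Y}(\widehat{R})$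 generated by $h^{p+1}$ and all $\lambda_{ij}^{(-r)}$ with $r>p$; the completed algebra is $\widetilde{\mathrm{Y}}(\widehat{R})=\varprojlim\mathrm{Y}(\widehat{R})/I_p$. Expressions $(z+ch)^r$, $r\in\mathbb{Z}$, $c\in\mathbb{C}$, are expanded in nonnegative powers of $h$. The symmetric group $\mathfrak{S}_n$ acts on $(\mathbb{C}^N)^{\otimes n}$ by permuting the tensor factors; $\mathcal{E}^+_{(n)}$ and $\mathcal{E}^-_{(n)}$ are the operators on $(\mathbb{C}^N)^{\otimes n}$ given by the action of the normalized symmetrizer $\frac{1}{n!}\sum_{p\in\mathfrak{S}_n}p$ and of the normalized anti-symmetrizer $\frac{1}{n!}\sum_{p\in\mathfrak{S}_n}\mathrm{sgn}(p)\,p$, respectively. $\mathrm{tr}_{1,\ldots,n}$ is the trace over the $n$ tensor factors $\mathrm{End}\,\mathbb{C}^N$. *)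

theory Defs
  imports
    "HOL-Analysis.Infinite_Sum"
    "HOL-Library.Poly_Mapping"
    "HOL-Library.FuncSet"
    "HOL-Library.Cardinality"
    "HOL-Computational_Algebra.Polynomial"
    "HOL-Combinatorics.Permutations"
begin

section \<open>Two-sided ideals\<close>

inductive_set ideal_gen :: "'a::ring_1 set \<Rightarrow> 'a set" for S where
  ideal_gen_base: "x \<in> S \<Longrightarrow> x \<in> ideal_gen S"
| ideal_gen_zero: "0 \<in> ideal_gen S"
| ideal_gen_add: "x \<in> ideal_gen S \<Longrightarrow> y \<in> ideal_gen S \<Longrightarrow> x + y \<in> ideal_gen S"
| ideal_gen_mult: "x \<in> ideal_gen S \<Longrightarrow> a * x * b \<in> ideal_gen S"

lemma ideal_gen_multl: "x \<in> ideal_gen S \<Longrightarrow> a * x \<in> ideal_gen S"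
  using ideal_gen_mult[of x S a 1] by simp

lemma ideal_gen_multr: "x \<in> ideal_gen S \<Longrightarrow> x * a \<in> ideal_gen S"
  using ideal_gen_mult[of x S 1 a] by simp

lemma ideal_gen_uminus: "x \<in> ideal_gen S \<Longrightarrow> - x \<in> ideal_gen S"
  using ideal_gen_mult[of x S "-1" 1] by simp

lemma ideal_gen_diff: "x \<in> ideal_gen S \<Longrightarrow> y \<in> ideal_gen S \<Longrightarrow> x - y \<in> ideal_gen S"
  using ideal_gen_add[OF _ ideal_gen_uminus] by fastforce

lemma ideal_gen_subset:
  assumes "S \<subseteq> ideal_gen T" shows "ideal_gen S \<subseteq> ideal_gen T"
proof
  fix x assume "x \<in> ideal_gen S"
  then show "x \<in> ideal_gen T"
    by induction (use assms in \<open>auto intro: ideal_gen.intros\<close>)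
qed

lemma ideal_gen_congs:
  "x - x \<in> ideal_gen S"
  "x - y \<in> ideal_gen S \<Longrightarrow> y - x \<in> ideal_gen S"
  "x - y \<in> ideal_gen S \<Longrightarrow> y - z \<in> ideal_gen S \<Longrightarrow> x - z \<in> ideal_gen S"
  "x - x' \<in> ideal_gen S \<Longrightarrow> y - y' \<in> ideal_gen S \<Longrightarrow> (x + y) - (x' + y') \<in> ideal_gen S"
  "x - x' \<in> ideal_gen S \<Longrightarrow> y - y' \<in> ideal_gen S \<Longrightarrow> (x - y) - (x' - y') \<in> ideal_gen S"
  "x - x' \<in> ideal_gen S \<Longrightarrow> - x - (- x') \<in> ideal_gen S"
  "x - x' \<in> ideal_gen S \<Longrightarrow> y - y' \<in> ideal_gen S \<Longrightarrow> x * y - x' * y' \<in> ideal_gen S"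
proof -
  show "x - x \<in> ideal_gen S" by (simp add: ideal_gen_zero)
  show "x - y \<in> ideal_gen S \<Longrightarrow> y - x \<in> ideal_gen S"
    using ideal_gen_uminus[of "x - y" S] by simp
  show "x - y \<in> ideal_gen S \<Longrightarrow> y - z \<in> ideal_gen S \<Longrightarrow> x - z \<in> ideal_gen S"
    using ideal_gen_add[of "x - y" S "y - z"] by simp
  show "x - x' \<in> ideal_gen S \<Longrightarrow> y - y' \<in> ideal_gen S \<Longrightarrow> (x + y) - (x' + y') \<in> ideal_gen S"
    using ideal_gen_add[of "x - x'" S "y - y'"] by (simp add: algebra_simps)
  show "x - x' \<in> ideal_gen S \<Longrightarrow> y - y' \<in> ideal_gen S \<Longrightarrow> (x - y) - (x' - y') \<in> ideal_gen S"
    using ideal_gen_diff[of "x - x'" S "y - y'"] by (simp add: algebra_simps)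
  show "x - x' \<in> ideal_gen S \<Longrightarrow> - x - (- x') \<in> ideal_gen S"
    using ideal_gen_uminus[of "x - x'" S] by simp
  show "x - x' \<in> ideal_gen S \<Longrightarrow> y - y' \<in> ideal_gen S \<Longrightarrow> x * y - x' * y' \<in> ideal_gen S"
    using ideal_gen_add[OF ideal_gen_multr[of "x - x'" S y] ideal_gen_multl[of "y - y'" S x']]
    by (simp add: algebra_simps)
qed

lemma ideal_gen_eqI: "x = y \<Longrightarrow> x - y \<in> ideal_gen S"
  by (simp add: ideal_gen_zero)


section \<open>The free associative algebra on the generators\<close>

text \<open>The free monoid, written additively so that \<open>\<Rightarrow>\<^sub>0\<close> yields its monoid algebra.\<close>

datatype 'a fmon = FMon (letters: "'a list")

instantiation fmon :: (type) monoid_add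
begin
definition zero_fmon :: "'a fmon" where "zero_fmon = FMon []"
definition plus_fmon :: "'a fmon \<Rightarrow> 'a fmon \<Rightarrow> 'a fmon" where
  "plus_fmon v w = FMon (letters v @ letters w)"
instance
  by standard (auto simp: zero_fmon_def plus_fmon_def)
end

lemma fmon_add_eq_0_iff: "0 = v + w \<longleftrightarrow> v = 0 \<and> w = (0 :: 'a fmon)"
  by (cases v; cases w) (auto simp: zero_fmon_def plus_fmon_def)

text \<open>
  The letter \<open>(i, j, r)\<close> stands for \<open>\<lambda>\<^sub>i\<^sub>j\<close> with upper index \<open>(r)\<close>. Matrix indices range over a
  finite type \<open>'n\<close> in place of \<open>{1..N}\<close>, so that \<open>N = CARD('n)\<close>; the base ring of formal power
  series in \<open>h\<close> is \<open>complex fps\<close>, with \<open>h = fps_X\<close>.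
\<close>

type_synonym 'n falg = "('n \<times> 'n \<times> int) fmon \<Rightarrow>\<^sub>0 complex fps"

definition fscal :: "complex fps \<Rightarrow> 'n falg" where
  "fscal c = Poly_Mapping.single 0 c"

definition fgen :: "'n \<Rightarrow> 'n \<Rightarrow> int \<Rightarrow> 'n falg" where
  "fgen i j r = Poly_Mapping.single (FMon [(i, j, r)]) 1"


section \<open>The defining relations\<close>

definition perm_mat :: "'n \<times> 'n \<Rightarrow> 'n \<times> 'n \<Rightarrow> 'a::comm_ring_1" where
  "perm_mat x y = of_bool (fst x = snd y \<and> snd x = fst y)"

definition Rmat :: "'a::comm_ring_1 \<Rightarrow> 'a \<Rightarrow> 'n \<times> 'n \<Rightarrow> 'n \<times> 'n \<Rightarrow> 'a" where
  "Rmat h u x y = u * of_bool (x = y) - h * perm_mat x y"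

text \<open>
  Polynomials in \<open>u\<close>, \<open>v\<close> are elements of \<open>complex fps poly poly\<close>, with \<open>u\<close> the inner and \<open>v\<close>
  the outer variable. \<open>Ruv s t\<close> is the matrix coefficient of \<open>u^s v^t\<close> in \<open>R(u - v)\<close>; it
  vanishes unless \<open>s, t \<le> 1\<close>.
\<close>

definition Ruv :: "nat \<Rightarrow> nat \<Rightarrow> 'n \<times> 'n \<Rightarrow> 'n \<times> 'n \<Rightarrow> complex fps" where
  "Ruv s t x y =
     poly.coeff (poly.coeff (Rmat [:[:fps_X:]:] ([:[:0, 1:]:] - [:0, 1:]) x y) t) s"

text \<open>
  Coefficients of \<open>u^r\<close> in the two copies of \<open>\<L>(u)\<close>; note that \<open>u^r\<close> comes with the generator
  of upper index \<open>-r\<close>.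
\<close>

definition FL1 :: "int \<Rightarrow> 'n \<times> 'n \<Rightarrow> 'n \<times> 'n \<Rightarrow> 'n falg" where
  "FL1 r x y = (if snd x = snd y then fgen (fst x) (fst y) (- r) else 0)"

definition FL2 :: "int \<Rightarrow> 'n \<times> 'n \<Rightarrow> 'n \<times> 'n \<Rightarrow> 'n falg" where
  "FL2 r x y = (if fst x = fst y then fgen (snd x) (snd y) (- r) else 0)"

text \<open>
  The entry \<open>(x, y)\<close> of the coefficient of \<open>u^a v^b\<close> in
  \<open>R(u - v) \<L>\<^sub>1(u) \<L>\<^sub>2(v) - \<L>\<^sub>2(v) \<L>\<^sub>1(u) R(u - v)\<close>.
\<close>

definition rll :: "int \<Rightarrow> int \<Rightarrow> 'n::finite \<times> 'n \<Rightarrow> 'n \<times> 'n \<Rightarrow> 'n falg" where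
  "rll a b x y =
     (\<Sum>s\<le>1. \<Sum>t\<le>1. \<Sum>p\<in>UNIV. \<Sum>q\<in>UNIV.
        fscal (Ruv s t x p) * FL1 (a - int s) p q * FL2 (b - int t) q y)
   - (\<Sum>s\<le>1. \<Sum>t\<le>1. \<Sum>p\<in>UNIV. \<Sum>q\<in>UNIV.
        FL2 (b - int t) x p * FL1 (a - int s) p q * fscal (Ruv s t q y))"

definition relators :: "'n::finite falg set" where
  "relators = {rll a b x y |a b x y. True}"


section \<open>The algebra \<open>Y(R)\<close>\<close>

quotient_type 'n yangian = "'n::finite falg" / "\<lambda>f g. f - g \<in> ideal_gen relators"
  by (intro equivpI reflpI sympI transpI) (blast intro: ideal_gen_congs)+

text \<open>
  The augmentation killing all generators and \<open>h\<close>; it is used only to see that the algebras below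
  are nonzero.
\<close>

definition faug :: "'n falg \<Rightarrow> complex" where
  "faug f = fps_nth (Poly_Mapping.lookup f 0) 0"

lemma lookup_mult_0: "Poly_Mapping.lookup (f * g) 0 = Poly_Mapping.lookup f 0 * Poly_Mapping.lookup (g :: 'n falg) 0"
proof -
  have *: "Sum_any (\<lambda>q. Poly_Mapping.lookup g q when 0 = l + q) = (Poly_Mapping.lookup g 0 when l = 0)" for l
    by (cases "l = 0") (simp_all add: fmon_add_eq_0_iff)
  show ?thesis
    unfolding lookup_mult * mult_when by simp
qed

lemma faug_simps [simp]:
  "faug (f + g) = faug f + faug g" "faug (f - g) = faug f - faug g"
  "faug (f * g) = faug f * faug g" "faug 0 = 0" "faug 1 = 1"
  "faug (fgen i j r) = 0" "faug (fscal c) = fps_nth c 0"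
proof -
  show "faug (f * g) = faug f * faug g"
    by (simp add: faug_def lookup_mult_0)
qed (simp_all add: faug_def fgen_def fscal_def lookup_add lookup_minus lookup_single
       zero_fmon_def lookup_one when_def)

lemma faug_sum: "faug (sum f A) = (\<Sum>x\<in>A. faug (f x))"
  by (induction A rule: infinite_finite_induct) auto

lemma faug_FL [simp]: "faug (FL1 r x y) = 0" "faug (FL2 r x y) = 0"
  by (simp_all add: FL1_def FL2_def)

lemma faug_rll: "faug (rll a b x y) = 0"
  unfolding rll_def
  by (simp only: faug_sum faug_simps faug_FL mult_zero_left mult_zero_right sum.neutral_const
      diff_zero)

lemma faug_relators: "f \<in> ideal_gen relators \<Longrightarrow> faug f = 0"
proof (induction rule: ideal_gen.induct)
  case (ideal_gen_base x)
  then show ?case unfolding relators_def using faug_rll by blast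
qed simp_all

instantiation yangian :: (finite) ring_1
begin

lift_definition zero_yangian :: "'a yangian" is 0 .
lift_definition one_yangian :: "'a yangian" is 1 .
lift_definition plus_yangian :: "'a yangian \<Rightarrow> 'a yangian \<Rightarrow> 'a yangian" is "(+)"
  by (rule ideal_gen_congs)
lift_definition minus_yangian :: "'a yangian \<Rightarrow> 'a yangian \<Rightarrow> 'a yangian" is "(-)"
  by (rule ideal_gen_congs)
lift_definition uminus_yangian :: "'a yangian \<Rightarrow> 'a yangian" is uminus
  by (rule ideal_gen_congs)
lift_definition times_yangian :: "'a yangian \<Rightarrow> 'a yangian \<Rightarrow> 'a yangian" is "(*)"
  by (rule ideal_gen_congs)

instance
proof
  show "(0 :: 'a yangian) \<noteq> 1"
  proof transfer
    have "faug ((0 :: 'a falg) - 1) \<noteq> 0"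
      by (simp only: faug_simps) simp
    then show "(0 :: 'a falg) - 1 \<notin> ideal_gen relators"
      using faug_relators by blast
  qed
qed (transfer, rule ideal_gen_eqI, simp add: distrib_left distrib_right mult.assoc add.assoc add.commute)+

end

lift_definition yscal :: "complex fps \<Rightarrow> 'n::finite yangian" is fscal .

lift_definition ygen :: "'n::finite \<Rightarrow> 'n \<Rightarrow> int \<Rightarrow> 'n yangian" is fgen .

lift_definition yaug :: "'n::finite yangian \<Rightarrow> complex" is faug
  by (drule faug_relators) (simp only: faug_simps right_minus_eq)

lemma yaug_simps:
  "yaug (x + y) = yaug x + yaug y" "yaug (x - y) = yaug x - yaug y"
  "yaug (x * y) = yaug x * yaug y" "yaug 0 = 0" "yaug 1 = 1"
  "yaug (ygen i j r) = 0" "yaug (yscal c) = fps_nth c 0"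
  by (transfer, simp only: faug_simps)+

definition I_ideal :: "nat \<Rightarrow> 'n::finite yangian set" where
  "I_ideal p = ideal_gen ({yscal (fps_X ^ (p + 1))} \<union> {ygen i j (- r) |i j r. r > int p})"

lemmas I_ideal_congs =
  ideal_gen_congs[where S = "{yscal (fps_X ^ (p + 1))} \<union> {ygen i j (- r) |i j r. r > int p}" for p,
    folded I_ideal_def]

lemma yaug_I_ideal: "x \<in> I_ideal p \<Longrightarrow> yaug x = 0"
  unfolding I_ideal_def
proof (induction rule: ideal_gen.induct)
  case (ideal_gen_base x)
  then show ?case by (auto simp: yaug_simps)
qed (simp_all add: yaug_simps)

lemma fscal_mult: "fscal (c * d) = fscal c * (fscal d :: 'n falg)"
  by (simp add: fscal_def mult_single)

lemma yscal_mult: "yscal (c * d) = yscal c * (yscal d :: 'n::finite yangian)"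
  by transfer (simp add: fscal_mult ideal_gen_zero)

lemma I_ideal_antimono:
  assumes "p \<le> q" shows "I_ideal q \<subseteq> (I_ideal p :: 'n::finite yangian set)"
  unfolding I_ideal_def
proof (rule ideal_gen_subset, safe)
  let ?S = "{yscal (fps_X ^ (p + 1)) :: 'n yangian} \<union> {ygen i j (- r) |i j r. r > int p}"
  have "fps_X ^ (q + 1) = (fps_X ^ (q - p) * fps_X ^ (p + 1) :: complex fps)"
    using assms by (simp flip: power_add)
  then have "yscal (fps_X ^ (q + 1)) = (yscal (fps_X ^ (q - p)) * yscal (fps_X ^ (p + 1)) :: 'n yangian)"
    by (simp only: yscal_mult)
  then show "(yscal (fps_X ^ (q + 1)) :: 'n yangian) \<in> ideal_gen ?S"
    by (auto intro: ideal_gen_multl ideal_gen_base)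
next
  fix i j :: 'n and r :: int assume "r > int q"
  with assms show "ygen i j (- r) \<in> ideal_gen
      ({yscal (fps_X ^ (p + 1)) :: 'n yangian} \<union> {ygen i j (- r) |i j r. r > int p})"
    by (intro ideal_gen_base) force
qed


section \<open>The completed algebra\<close>

text \<open>
  An element of the inverse limit of the \<open>Y / I_ideal p\<close> is a compatible family of residue classes. It is
  represented by a sequence of representatives \<open>a p\<close> of these classes, two sequences being
  identified when all their classes agree.
\<close>

definition compatible :: "(nat \<Rightarrow> 'n::finite yangian) \<Rightarrow> bool" where
  "compatible a \<longleftrightarrow> (\<forall>p q. p \<le> q \<longrightarrow> a q - a p \<in> I_ideal p)"

lemma compatible_ops:
  "compatible a \<Longrightarrow> compatible b \<Longrightarrow> compatible (\<lambda>p. a p + b p)"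
  "compatible a \<Longrightarrow> compatible b \<Longrightarrow> compatible (\<lambda>p. a p - b p)"
  "compatible a \<Longrightarrow> compatible (\<lambda>p. - a p)"
  "compatible a \<Longrightarrow> compatible b \<Longrightarrow> compatible (\<lambda>p. a p * b p)"
  unfolding compatible_def by (blast intro: I_ideal_congs(4-7))+

lemma compatible_const [simp]: "compatible (\<lambda>_. x)"
  by (simp add: compatible_def I_ideal_congs(1)[simplified])

quotient_type 'n cyangian = "nat \<Rightarrow> 'n::finite yangian" /
  partial: "\<lambda>a b. compatible a \<and> compatible b \<and> (\<forall>p. a p - b p \<in> I_ideal p)"
proof (rule part_equivpI)
  show "\<exists>a :: nat \<Rightarrow> 'n yangian. compatible a \<and> compatible a \<and> (\<forall>p. a p - a p \<in> I_ideal p)"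
    by (rule exI[of _ "\<lambda>_. 0"]) (auto simp: compatible_def I_ideal_def ideal_gen_zero)
next
  show "symp (\<lambda>a b :: nat \<Rightarrow> 'n yangian.
      compatible a \<and> compatible b \<and> (\<forall>p. a p - b p \<in> I_ideal p))"
    unfolding I_ideal_def by (rule sympI) (blast intro: ideal_gen_congs(2))
  show "transp (\<lambda>a b :: nat \<Rightarrow> 'n yangian.
      compatible a \<and> compatible b \<and> (\<forall>p. a p - b p \<in> I_ideal p))"
    unfolding I_ideal_def by (rule transpI) (blast intro: ideal_gen_congs(3))
qed

instantiation cyangian :: (finite) ring_1
begin

lift_definition zero_cyangian :: "'a cyangian" is "\<lambda>_. 0"
  by (simp add: I_ideal_congs(1)[of 0, simplified])
lift_definition one_cyangian :: "'a cyangian" is "\<lambda>_. 1"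
  by (simp add: I_ideal_congs(1)[of 0, simplified])
lift_definition plus_cyangian :: "'a cyangian \<Rightarrow> 'a cyangian \<Rightarrow> 'a cyangian" is
  "\<lambda>a b p. a p + b p"
  by (simp only: compatible_ops I_ideal_congs(4) simp_thms)
lift_definition minus_cyangian :: "'a cyangian \<Rightarrow> 'a cyangian \<Rightarrow> 'a cyangian" is
  "\<lambda>a b p. a p - b p"
  by (simp only: compatible_ops I_ideal_congs(5) simp_thms)
lift_definition uminus_cyangian :: "'a cyangian \<Rightarrow> 'a cyangian" is
  "\<lambda>a p. - a p"
  by (simp only: compatible_ops I_ideal_congs(6) simp_thms)
lift_definition times_cyangian :: "'a cyangian \<Rightarrow> 'a cyangian \<Rightarrow> 'a cyangian" is
  "\<lambda>a b p. a p * b p"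
  by (simp only: compatible_ops I_ideal_congs(7) simp_thms)

instance
proof
  show "(0 :: 'a cyangian) \<noteq> 1"
  proof transfer
    have "yaug ((0 :: 'a yangian) - 1) \<noteq> 0"
      by (simp add: yaug_simps del: diff_0)
    then have "(0 :: 'a yangian) - 1 \<notin> I_ideal p" for p
      using yaug_I_ideal by blast
    then show "\<not> (compatible (\<lambda>_. 0 :: 'a yangian) \<and> compatible (\<lambda>_. 1 :: 'a yangian) \<and>
        (\<forall>p. (0 :: 'a yangian) - 1 \<in> I_ideal p))" by blast
  qed
next
  fix a b c :: "'a cyangian"
  have eqI: "compatible a \<and> compatible b \<and> (\<forall>p. a p - b p \<in> I_ideal p)"
    if "compatible a" "a = b" for a b :: "nat \<Rightarrow> 'a yangian"
    using that by (simp add: I_ideal_def ideal_gen_zero)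
  show "a + b + c = a + (b + c)" by (transfer, rule eqI) (auto intro: compatible_ops simp: algebra_simps)
  show "a + b = b + a" by (transfer, rule eqI) (auto intro: compatible_ops simp: algebra_simps)
  show "0 + a = a" by (transfer, rule eqI) (auto intro: compatible_ops simp: algebra_simps)
  show "a * b * c = a * (b * c)" by (transfer, rule eqI) (auto intro: compatible_ops simp: algebra_simps)
  show "1 * a = a" by (transfer, rule eqI) (auto intro: compatible_ops simp: algebra_simps)
  show "a * 1 = a" by (transfer, rule eqI) (auto intro: compatible_ops simp: algebra_simps)
  show "- a + a = 0" by (transfer, rule eqI) (auto intro: compatible_ops simp: algebra_simps)
  show "a - b = a + - b" by (transfer, rule eqI) (auto intro: compatible_ops simp: algebra_simps)
  show "(a + b) * c = a * c + b * c" by (transfer, rule eqI) (auto intro: compatible_ops simp: algebra_simps)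
  show "a * (b + c) = a * b + a * c" by (transfer, rule eqI) (auto intro: compatible_ops simp: algebra_simps)
qed

end

definition completion :: "'n::finite yangian \<Rightarrow> 'n cyangian" where
  "completion x = abs_cyangian (\<lambda>_. x)"

definition cscal :: "complex fps \<Rightarrow> 'n::finite cyangian" where
  "cscal c = completion (yscal c)"

definition cgen :: "'n::finite \<Rightarrow> 'n \<Rightarrow> int \<Rightarrow> 'n cyangian" where
  "cgen i j r = completion (ygen i j r)"

text \<open>Equality of the images in \<open>Y / I_ideal p\<close>.\<close>

lift_definition ceq :: "nat \<Rightarrow> 'n::finite cyangian \<Rightarrow> 'n cyangian \<Rightarrow> bool" is
  "\<lambda>p a b. a p - b p \<in> I_ideal p"
  unfolding I_ideal_def by (blast intro: ideal_gen_congs(2,3))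

lemma ceq_refl [simp]: "ceq p x x"
  by transfer (simp add: I_ideal_def ideal_gen_zero)

lemma ceq_sym: "ceq p x y \<Longrightarrow> ceq p y x"
  by transfer (auto simp: I_ideal_def intro: ideal_gen_congs)

lemma ceq_trans: "ceq p x y \<Longrightarrow> ceq p y z \<Longrightarrow> ceq p x z"
  by transfer (auto simp: I_ideal_def intro: ideal_gen_congs)

lemma ceq_antimono: "ceq q x y \<Longrightarrow> p \<le> q \<Longrightarrow> ceq p x y"
proof (transfer, elim conjE)
  fix q p and x y :: "nat \<Rightarrow> 'a yangian"
  assume *: "x q - y q \<in> I_ideal q" "p \<le> q" "compatible x" "compatible y"
  have "x q - y q \<in> I_ideal p" using * I_ideal_antimono by blast
  moreover have "x q - x p \<in> I_ideal p" "y q - y p \<in> I_ideal p"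
    using * by (auto simp: compatible_def)
  ultimately show "x p - y p \<in> I_ideal p"
    unfolding I_ideal_def by (meson ideal_gen_congs(2,3))
qed

lemma cyangian_eqI: "(\<And>p. ceq p x y) \<Longrightarrow> x = y"
  by transfer auto

text \<open>
  The inverse limit topology, with every \<open>Y / I_ideal p\<close> discrete. It gives a meaning to the infinite
  sums over the completed algebra.
\<close>

instantiation cyangian :: (finite) t2_space
begin

definition open_cyangian :: "'a cyangian set \<Rightarrow> bool" where
  "open_cyangian U \<longleftrightarrow> (\<forall>x\<in>U. \<exists>p. \<forall>y. ceq p x y \<longrightarrow> y \<in> U)"

instance
proof
  show "open (UNIV :: 'a cyangian set)"
    by (simp add: open_cyangian_def)
next
  fix S T :: "'a cyangian set" assume "open S" "open T"
  show "open (S \<inter> T)"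
    unfolding open_cyangian_def
  proof
    fix x assume "x \<in> S \<inter> T"
    then obtain p q where "\<And>y. ceq p x y \<Longrightarrow> y \<in> S" "\<And>y. ceq q x y \<Longrightarrow> y \<in> T"
      using \<open>open S\<close> \<open>open T\<close> unfolding open_cyangian_def by blast
    then have "\<forall>y. ceq (max p q) x y \<longrightarrow> y \<in> S \<inter> T"
      by (meson IntI ceq_antimono max.cobounded1 max.cobounded2)
    then show "\<exists>p. \<forall>y. ceq p x y \<longrightarrow> y \<in> S \<inter> T" ..
  qed
next
  fix K :: "'a cyangian set set" assume "\<forall>S\<in>K. open S"
  then show "open (\<Union>K)"
    unfolding open_cyangian_def by (meson UnionE UnionI)
next
  fix x y :: "'a cyangian" assume "x \<noteq> y"
  then obtain p where p: "\<not> ceq p x y" using cyangian_eqI by blast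
  have op: "open {z. ceq p w z}" for w :: "'a cyangian"
    unfolding open_cyangian_def by (auto intro: ceq_trans)
  show "\<exists>U V. open U \<and> open V \<and> x \<in> U \<and> y \<in> V \<and> U \<inter> V = {}"
    by (rule exI[of _ "{z. ceq p x z}"], rule exI[of _ "{z. ceq p y z}"])
       (use p op in \<open>auto dest: ceq_sym ceq_trans\<close>)
qed

end


text \<open>
  The infinite sums in the definitions below converge: modulo every \<open>I_ideal p\<close> only finitely many
  terms are nonzero.
\<close>

lemma ceq_add: "ceq p x x' \<Longrightarrow> ceq p y y' \<Longrightarrow> ceq p (x + y) (x' + y')"
  by transfer (simp only: I_ideal_congs(4-7) simp_thms)

lemma ceq_mult: "ceq p x x' \<Longrightarrow> ceq p y y' \<Longrightarrow> ceq p (x * y) (x' * y')"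
  by transfer (simp only: I_ideal_congs(4-7) simp_thms)

lemma ceq_sum_0: "(\<And>i. i \<in> A \<Longrightarrow> ceq p (f i) 0) \<Longrightarrow> ceq p (sum f A) 0"
proof (induction A rule: infinite_finite_induct)
  case (insert x F)
  then show ?case using ceq_add[of p "f x" 0 "sum f F" 0] by simp
qed simp_all

lemma cyangian_complete:
  fixes x :: "nat \<Rightarrow> 'n::finite cyangian"
  assumes "\<And>p q. p \<le> q \<Longrightarrow> ceq p (x q) (x p)"
  obtains s where "\<And>p. ceq p s (x p)"
proof -
  define a where "a p = rep_cyangian (x p) p" for p
  have rep: "compatible (rep_cyangian y)" for y :: "'n cyangian"
    using Quotient3_rep_reflp[OF Quotient3_cyangian, of y] by blast
  have "compatible a"
    unfolding compatible_def
  proof (intro allI impI)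
    fix p q :: nat assume "p \<le> q"
    then have "rep_cyangian (x q) q - rep_cyangian (x q) p \<in> I_ideal p"
      using rep by (auto simp: compatible_def)
    moreover have "rep_cyangian (x q) p - rep_cyangian (x p) p \<in> I_ideal p"
      using assms[OF \<open>p \<le> q\<close>] by (simp add: ceq.rep_eq)
    ultimately show "a q - a p \<in> I_ideal p"
      unfolding a_def I_ideal_def by (rule ideal_gen_congs(3))
  qed
  then have "a p - rep_cyangian (abs_cyangian a) p \<in> I_ideal p" for p
    using Quotient3_rep_abs[OF Quotient3_cyangian, of a]
    by (auto simp: I_ideal_def ideal_gen_zero intro: ideal_gen_congs(2))
  then have "ceq p (abs_cyangian a) (x p)" for p
    unfolding ceq.rep_eq a_def[symmetric] I_ideal_def by (rule ideal_gen_congs(2))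
  then show ?thesis by (rule that)
qed

lemma summable_on_cyangian:
  fixes f :: "'i \<Rightarrow> 'n::finite cyangian"
  assumes fin: "\<And>p. finite {i \<in> A. \<not> ceq p (f i) 0}"
  obtains s where "(f has_sum s) A" "\<And>p. ceq p s (sum f {i \<in> A. \<not> ceq p (f i) 0})"
proof -
  define F where "F p = {i \<in> A. \<not> ceq p (f i) 0}" for p
  have *: "ceq p (sum f G) (sum f (F p))" if "finite G" "F p \<subseteq> G" "G \<subseteq> A" for p G
  proof -
    have "ceq p (sum f (G - F p)) 0"
      using that by (intro ceq_sum_0) (auto simp: F_def)
    from ceq_add[OF this ceq_refl[of p "sum f (F p)"]] show ?thesis
      using sum.subset_diff[OF that(2,1), of f] by simp
  qed
  have "ceq p (sum f (F q)) (sum f (F p))" if "p \<le> q" for p q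
    using fin that by (intro *) (auto simp: F_def dest: ceq_antimono)
  then obtain s where s: "\<And>p. ceq p s (sum f (F p))"
    using cyangian_complete[of "\<lambda>p. sum f (F p)"] by blast
  have "(f has_sum s) A"
    unfolding has_sum_def
  proof (rule topological_tendstoI)
    fix S assume "open S" "s \<in> S"
    then obtain p where p: "\<And>y. ceq p s y \<Longrightarrow> y \<in> S"
      unfolding open_cyangian_def by blast
    show "\<forall>\<^sub>F G in finite_subsets_at_top A. sum f G \<in> S"
      unfolding eventually_finite_subsets_at_top
    proof (intro exI[of _ "F p"] conjI allI impI)
      fix G assume "finite G \<and> F p \<subseteq> G \<and> G \<subseteq> A"
      then have "ceq p (sum f (F p)) (sum f G)" by (intro ceq_sym[OF *]) auto
      then show "sum f G \<in> S" by (intro p ceq_trans[OF s])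
    qed (use fin[of p] in \<open>auto simp: F_def\<close>)
  qed
  from this s show ?thesis unfolding F_def by (rule that)
qed

lemma summable_on_cyangianI:
  fixes f :: "'i \<Rightarrow> 'n::finite cyangian"
  assumes "\<And>p. finite {i \<in> A. \<not> ceq p (f i) 0}"
  shows "f summable_on A"
proof -
  obtain s where "(f has_sum s) A" using summable_on_cyangian[of A f, OF assms] by blast
  then show ?thesis unfolding summable_on_def by blast
qed

lemma ceq_infsum_0:
  fixes f :: "'i \<Rightarrow> 'n::finite cyangian"
  assumes "\<And>q. finite {i \<in> A. \<not> ceq q (f i) 0}" "\<And>i. i \<in> A \<Longrightarrow> ceq p (f i) 0"
  shows "ceq p (infsum f A) 0"
proof -
  obtain s where s: "(f has_sum s) A" "\<And>q. ceq q s (sum f {i \<in> A. \<not> ceq q (f i) 0})"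
    using summable_on_cyangian[of A f, OF assms(1)] by blast
  have "{i \<in> A. \<not> ceq p (f i) 0} = {}" using assms(2) by blast
  with s(2)[of p] show ?thesis by (simp add: infsumI[OF s(1)])
qed


section \<open>Two-sided formal series over the completed algebra\<close>

text \<open>A series \<open>\<Sum> f\<^sub>m z^m\<close> over all integers \<open>m\<close> is given by its coefficient function \<open>f\<close>.\<close>

type_synonym 'n series = "int \<Rightarrow> 'n cyangian"

definition ser_mult :: "'n::finite series \<Rightarrow> 'n series \<Rightarrow> 'n series" where
  "ser_mult f g m = (\<Sum>\<^sub>\<infinity>a. f a * g (m - a))"

definition bounded_series :: "'n::finite series \<Rightarrow> bool" where
  "bounded_series f \<longleftrightarrow> (\<forall>p. \<exists>B. \<forall>m>B. ceq p (f m) 0)"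

lemma ser_mult_finite:
  assumes "bounded_series f" "bounded_series g"
  shows "finite {a \<in> UNIV. \<not> ceq p (f a * g (m - a)) 0}"
proof -
  obtain B C where B: "\<And>a. a > B \<Longrightarrow> ceq p (f a) 0" and C: "\<And>a. a > C \<Longrightarrow> ceq p (g a) 0"
    using assms unfolding bounded_series_def by metis
  have "ceq p (f a * g (m - a)) 0" if "a \<notin> {m - C..B}" for a
  proof (cases "a > B")
    case True
    from ceq_mult[OF B[OF this] ceq_refl] show ?thesis by simp
  next
    case False
    with that have "m - a > C" by auto
    from ceq_mult[OF ceq_refl C[OF this]] show ?thesis by simp
  qed
  then have "{a \<in> UNIV. \<not> ceq p (f a * g (m - a)) 0} \<subseteq> {m - C..B}" by blast
  then show ?thesis by (rule finite_subset) simp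
qed

lemma ser_mult_summable:
  "bounded_series f \<Longrightarrow> bounded_series g \<Longrightarrow> (\<lambda>a. f a * g (m - a)) summable_on UNIV"
  by (rule summable_on_cyangianI) (rule ser_mult_finite)

lemma bounded_series_ser_mult:
  assumes "bounded_series f" "bounded_series g"
  shows "bounded_series (ser_mult f g)"
  unfolding bounded_series_def
proof
  fix p
  obtain B C where B: "\<And>a. a > B \<Longrightarrow> ceq p (f a) 0" and C: "\<And>a. a > C \<Longrightarrow> ceq p (g a) 0"
    using assms unfolding bounded_series_def by metis
  have "ceq p (ser_mult f g m) 0" if "m > B + C" for m
    unfolding ser_mult_def
  proof (rule ceq_infsum_0[OF ser_mult_finite[OF assms]])
    fix a
    show "ceq p (f a * g (m - a)) 0"
    proof (cases "a > B")
      case True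
      from ceq_mult[OF B[OF this] ceq_refl] show ?thesis by simp
    next
      case False
      with that have "m - a > C" by auto
      from ceq_mult[OF ceq_refl C[OF this]] show ?thesis by simp
    qed
  qed
  then show "\<exists>B. \<forall>m>B. ceq p (ser_mult f g m) 0" by blast
qed

text \<open>
  The coefficient of \<open>z^m\<close> in \<open>(z + c h)^r\<close>, expanded in nonnegative powers of \<open>h\<close>.
\<close>

definition shifted_power :: "complex \<Rightarrow> int \<Rightarrow> int \<Rightarrow> complex fps" where
  "shifted_power c r m =
     (if m \<le> r then fps_const ((of_int r gchoose nat (r - m)) * c ^ nat (r - m)) * fps_X ^ nat (r - m)
      else 0)"

text \<open>The series \<open>\<lambda>\<^sub>i\<^sub>j(z + c h)\<close>.\<close>

definition lam :: "complex \<Rightarrow> 'n::finite \<Rightarrow> 'n \<Rightarrow> 'n series" where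
  "lam c i j m = (\<Sum>\<^sub>\<infinity>r. cscal (shifted_power c r m) * cgen i j (- r))"

lemma ceq_cgen: "r > int p \<Longrightarrow> ceq p (cgen i j (- r)) 0"
proof -
  assume "r > int p"
  then have "ygen i j (- r) \<in> I_ideal p"
    unfolding I_ideal_def by (intro ideal_gen_base) blast
  moreover have "compatible (\<lambda>_. y :: 'a yangian)" for y
    by (simp add: compatible_def I_ideal_def ideal_gen_zero)
  ultimately show ?thesis
    unfolding cgen_def completion_def zero_cyangian_def
    by (subst ceq.abs_eq) (auto simp: I_ideal_def ideal_gen_zero eq_onp_def)
qed

lemma lam_term:
  assumes "r \<notin> {m..int p}"
  shows "ceq p (cscal (shifted_power c r m) * cgen i j (- r)) (0 :: 'n::finite cyangian)"
proof -
  have "cscal 0 = (0 :: 'n cyangian)"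
  proof -
    have "yscal 0 = (0 :: 'n yangian)" by transfer (simp add: fscal_def ideal_gen_zero)
    then show ?thesis by (simp add: cscal_def completion_def zero_cyangian_def)
  qed
  then show ?thesis
    using assms ceq_mult[OF ceq_refl ceq_cgen[of p r i j]]
    by (cases "r > int p") (auto simp: shifted_power_def)
qed

lemma lam_finite:
  "finite {r \<in> UNIV. \<not> ceq p (cscal (shifted_power c r m) * cgen i j (- r)) (0 :: 'n::finite cyangian)}"
  by (rule finite_subset[of _ "{m..int p}"]) (use lam_term in blast, simp)

lemma lam_summable:
  "(\<lambda>r. cscal (shifted_power c r m) * cgen i j (- r) :: 'n::finite cyangian) summable_on UNIV"
  by (rule summable_on_cyangianI) (rule lam_finite)

lemma bounded_series_lam: "bounded_series (lam c i j)"
  unfolding bounded_series_def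
proof
  fix p
  have "ceq p (lam c i j m) 0" if "m > int p" for m
    unfolding lam_def
    by (rule ceq_infsum_0[OF lam_finite], rule lam_term) (use that in auto)
  then show "\<exists>B. \<forall>m>B. ceq p (lam c i j m) 0" by blast
qed


section \<open>Operators on tensor powers\<close>

text \<open>
  The basis of the \<open>n\<close>-fold tensor power is indexed by the functions from \<open>{1..n}\<close> to the index
  type. Operators with scalar or series coefficients are given by their matrix entries.
\<close>

definition tidx :: "nat \<Rightarrow> (nat \<Rightarrow> 'n) set" where
  "tidx n = {1..n} \<rightarrow>\<^sub>E UNIV"

text \<open>A permutation \<open>\<sigma>\<close> moves the \<open>k\<close>-th tensor factor to position \<open>\<sigma> k\<close>.\<close>

definition perm_op :: "nat \<Rightarrow> (nat \<Rightarrow> nat) \<Rightarrow> (nat \<Rightarrow> 'n) \<Rightarrow> (nat \<Rightarrow> 'n) \<Rightarrow> complex" where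
  "perm_op n \<sigma> x y = of_bool (\<forall>k\<in>{1..n}. x (\<sigma> k) = y k)"

definition symmetrizer :: "nat \<Rightarrow> (nat \<Rightarrow> 'n) \<Rightarrow> (nat \<Rightarrow> 'n) \<Rightarrow> complex" where
  "symmetrizer n x y = (1 / fact n) * (\<Sum>\<sigma> | \<sigma> permutes {1..n}. perm_op n \<sigma> x y)"

definition antisymmetrizer :: "nat \<Rightarrow> (nat \<Rightarrow> 'n) \<Rightarrow> (nat \<Rightarrow> 'n) \<Rightarrow> complex" where
  "antisymmetrizer n x y =
     (1 / fact n) * (\<Sum>\<sigma> | \<sigma> permutes {1..n}. of_int (sign \<sigma>) * perm_op n \<sigma> x y)"

type_synonym 'n tmat = "(nat \<Rightarrow> 'n) \<Rightarrow> (nat \<Rightarrow> 'n) \<Rightarrow> 'n series"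

definition tmat_one :: "'n::finite tmat" where
  "tmat_one x y m = of_bool (x = y \<and> m = 0)"

definition tmat_mult :: "nat \<Rightarrow> 'n::finite tmat \<Rightarrow> 'n tmat \<Rightarrow> 'n tmat" where
  "tmat_mult n A B x y m = (\<Sum>w\<in>tidx n. ser_mult (A x w) (B w y) m)"

definition tmat_scal_mult ::
  "nat \<Rightarrow> ((nat \<Rightarrow> 'n) \<Rightarrow> (nat \<Rightarrow> 'n) \<Rightarrow> complex) \<Rightarrow> 'n::finite tmat \<Rightarrow> 'n tmat" where
  "tmat_scal_mult n E B x y m = (\<Sum>w\<in>tidx n. cscal (fps_const (E x w)) * B w y m)"

definition tmat_trace :: "nat \<Rightarrow> 'n::finite tmat \<Rightarrow> 'n series" where
  "tmat_trace n A m = (\<Sum>x\<in>tidx n. A x x m)"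

text \<open>\<open>\<L>\<^sub>k(z + c h)\<close>, acting on the \<open>k\<close>-th of \<open>n\<close> tensor factors.\<close>

definition Lcopy :: "nat \<Rightarrow> nat \<Rightarrow> complex \<Rightarrow> 'n::finite tmat" where
  "Lcopy n k c x y = (if \<forall>l\<in>{1..n} - {k}. x l = y l then lam c (x k) (y k) else (\<lambda>_. 0))"

text \<open>\<open>\<L>\<^sub>1(z) \<L>\<^sub>2(z + c h) \<dots> \<L>\<^sub>k(z + (k - 1) c h)\<close>.\<close>

primrec Lprod :: "nat \<Rightarrow> complex \<Rightarrow> nat \<Rightarrow> 'n::finite tmat" where
  "Lprod n c 0 = tmat_one"
| "Lprod n c (Suc k) = tmat_mult n (Lprod n c k) (Lcopy n (Suc k) (of_nat k * c))"

definition L_plus :: "nat \<Rightarrow> 'n::finite series" where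
  "L_plus n = tmat_trace n (tmat_scal_mult n (symmetrizer n) (Lprod n 1 n))"

definition L_minus :: "nat \<Rightarrow> 'n::finite series" where
  "L_minus n = tmat_trace n (tmat_scal_mult n (antisymmetrizer n) (Lprod n (-1) n))"

end

theory Submission
  imports Defs "HOL-Computational_Algebra.Formal_Laurent_Series"
begin

text \<open>
Write \<open>A = \<L>\<^sub>1(u\<^sub>1) \<dots> \<L>\<^sub>n(u\<^sub>n)\<close> and \<open>B = \<L>\<^sub>n\<^sub>+\<^sub>1(v\<^sub>1) \<dots> \<L>\<^sub>n\<^sub>+\<^sub>m(v\<^sub>m)\<close>, where both
sequences of arguments are arithmetic progressions with difference \<open>h\<close> or \<open>-h\<close>. The product of
two of the series is the trace of \<open>E A B\<close> with \<open>E\<close> a product of two (anti)symmetrizers, and the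
product in the other order is the trace of \<open>E B A\<close>. An ordered product \<open>R\<close> of the \<open>n m\<close>
matrices \<open>(u\<^sub>i - v\<^sub>j) - h P\<close> satisfies \<open>R A B = B A R\<close> (\<open>R_exchange\<close>), and it has an inverse
\<open>R'\<close> up to the scalar \<open>D\<close>, the product of all \<open>(u\<^sub>i - v\<^sub>j)\<^sup>2 - h\<^sup>2\<close>. The entries of \<open>R\<close> are scalars,
so \<open>R\<close> may be moved around the trace. If \<open>E Z = E Z E\<close> for each of \<open>Z = R\<close>, \<open>R'\<close>, \<open>B A\<close>, then
\<open>D tr (E A B) = tr (E R' R A B) = tr (R E R' B A) = tr (E R E R' E B A E) = D tr (E B A)\<close>; this
is \<open>traces_agree\<close>.

The identities \<open>E Z = E Z E\<close> are the fusion procedure. They follow from one relation for each pair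
of neighbouring factors, \<open>(1 + e P) X Y = Y X (1 + e P)\<close> with \<open>e\<close> the sign of the progression
(\<open>fusion_step\<close>). For \<open>R\<close> and \<open>R'\<close> this is a case of the Yang--Baxter equation
(\<open>fused_Yang_Baxter\<close>). For the factors of \<open>A\<close> and \<open>B\<close> it is what the RLL relation becomes at
\<open>v = u + e h\<close> after division by \<open>h\<close>, and \<open>h\<close> may be a zero divisor. The division is avoided as
follows. In \<open>(u - v) [\<lambda>\<^sub>i\<^sub>j(u), \<lambda>\<^sub>k\<^sub>m(v)] = h G(u, v)\<close> the series
\<open>G(u, v) = \<lambda>\<^sub>k\<^sub>j(u) \<lambda>\<^sub>i\<^sub>m(v) - \<lambda>\<^sub>k\<^sub>j(v) \<lambda>\<^sub>i\<^sub>m(u)\<close> is visibly divisible by \<open>u - v\<close>, say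
\<open>G = (u - v) G'\<close>, and cancelling \<open>u - v\<close> gives \<open>[\<lambda>\<^sub>i\<^sub>j(u), \<lambda>\<^sub>k\<^sub>m(v)] = h G'(u, v)\<close>
(\<open>commutator_Gquot\<close>). At \<open>v = u + e h\<close> the commutator is \<open>h G'\<close> and \<open>G\<close> is \<open>-e h G'\<close>, so that
the commutator plus \<open>e G\<close> vanishes, which is the fused relation (\<open>t_fusion\<close>).

It remains to cancel \<open>D\<close>. This is impossible for two-sided series in general: \<open>u - v\<close> kills the
formal delta function. But modulo every ideal \<open>I_ideal p\<close> the series \<open>\<lambda>\<^sub>i\<^sub>j(u)\<close> has only finitely
many positive powers of \<open>u\<close>, so all computations take place in iterated Laurent series in \<open>u\<close> and
\<open>v\<close> inverse, where \<open>u - v + c h\<close> is not a zero divisor (\<open>fls_linear_cancel\<close>). For this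
the residue ring modulo \<open>I_ideal p\<close> has to be a type. Types cannot depend on \<open>p\<close>, so \<open>p\<close> is fixed
once and for all as a level at which some commutator is nonzero, if there is such a level
(\<open>obstruction_level\<close>). Commutativity at that level shows that there is none.
\<close>


section \<open>Ordered products in a noncommutative ring\<close>

definition central :: "'a::ring_1 \<Rightarrow> bool" where
  "central z \<longleftrightarrow> (\<forall>x. z * x = x * z)"

lemma centralD: "central z \<Longrightarrow> z * x = x * z"
  by (simp add: central_def)

lemma central_left_commute: "central z \<Longrightarrow> x * (z * y) = z * (x * y)"
  using centralD[of z x] by (simp flip: mult.assoc)

lemma central_of_int [simp]: "central (of_int k)"
  by (simp add: central_def mult_of_int_commute)

lemma central_of_nat [simp]: "central (of_nat k)"
  by (simp add: central_def mult_of_nat_commute)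

lemma central_ops:
  "central z \<Longrightarrow> central w \<Longrightarrow> central (z + w)"
  "central z \<Longrightarrow> central w \<Longrightarrow> central (z - w)"
  "central z \<Longrightarrow> central w \<Longrightarrow> central (z * w)"
  "central z \<Longrightarrow> central (- z)"
  "central 0" "central 1"
proof -
  show "central (z * w)" if "central z" "central w"
    unfolding central_def
  proof
    fix x
    show "z * w * x = x * (z * w)"
      using central_left_commute[OF that(1), of x w] centralD[OF that(2), of x] by (simp add: mult.assoc)
  qed
qed (simp_all add: central_def algebra_simps)

lemma prod_list_commute:
  fixes g :: "'b \<Rightarrow> 'a::monoid_mult"
  assumes "\<And>k. k \<in> set ks \<Longrightarrow> p * g k = g k * p"
  shows "p * prod_list (map g ks) = prod_list (map g ks) * p"
  using assms
proof (induction ks)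
  case (Cons k ks)
  have "p * (g k * prod_list (map g ks)) = g k * (p * prod_list (map g ks))"
    using Cons.prems[of k] by (simp flip: mult.assoc)
  also have "\<dots> = g k * (prod_list (map g ks) * p)" using Cons by simp
  finally show ?case by (simp add: mult.assoc)
qed simp

lemma prod_list_mult_distrib:
  fixes f g :: "'b \<Rightarrow> 'a::monoid_mult"
  assumes "distinct ks"
    and "\<And>k l. k \<in> set ks \<Longrightarrow> l \<in> set ks \<Longrightarrow> k \<noteq> l \<Longrightarrow> f l * g k = g k * f l"
  shows "prod_list (map f ks) * prod_list (map g ks) = prod_list (map (\<lambda>k. f k * g k) ks)"
  using assms
proof (induction ks)
  case (Cons k ks)
  have "g k * prod_list (map f ks) = prod_list (map f ks) * g k"
    by (rule prod_list_commute) (use Cons.prems in force)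
  then have "prod_list (map f (k # ks)) * prod_list (map g (k # ks))
    = f k * g k * (prod_list (map f ks) * prod_list (map g ks))"
    by (simp add: mult.assoc) (simp flip: mult.assoc)
  with Cons show ?case by simp
qed simp

text \<open>
Interchanging rows and columns of a rectangular array of factors. The order inside the rows and
inside the columns is preserved, so only factors in different rows and different columns have to
commute.
\<close>

lemma prod_list_swap:
  fixes r :: "'b \<Rightarrow> 'c \<Rightarrow> 'a::monoid_mult"
  assumes "distinct is" "distinct js"
    and "\<And>i i' j j'. i \<noteq> i' \<Longrightarrow> j \<noteq> j' \<Longrightarrow> r i j * r i' j' = r i' j' * r i j"
  shows "prod_list (map (\<lambda>i. prod_list (map (r i) js)) is)
       = prod_list (map (\<lambda>j. prod_list (map (\<lambda>i. r i j) is)) js)"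
  using assms(1)
proof (induction "is")
  case Nil
  show ?case by (induction js) auto
next
  case (Cons i "is")
  have "prod_list (map (r i) js) * prod_list (map (\<lambda>j. prod_list (map (\<lambda>i. r i j) is)) js)
     = prod_list (map (\<lambda>j. r i j * prod_list (map (\<lambda>i. r i j) is)) js)"
    using Cons.prems assms(3)
    by (intro prod_list_mult_distrib[OF assms(2)] prod_list_commute) (auto, metis)
  with Cons show ?case by simp
qed

lemma prod_list_intertwine:
  fixes f g :: "'b \<Rightarrow> 'a::monoid_mult"
  assumes "\<And>k. k \<in> set ks \<Longrightarrow> f k * c = c * g k"
  shows "prod_list (map f ks) * c = c * prod_list (map g ks)"
  using assms
proof (induction ks)
  case (Cons k ks)
  have "f k * prod_list (map f ks) * c = f k * (c * prod_list (map g ks))"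
    using Cons.IH Cons.prems by (simp add: mult.assoc)
  also have "\<dots> = c * (g k * prod_list (map g ks))"
    using Cons.prems[of k] by (simp flip: mult.assoc)
  finally show ?case by simp
qed simp

lemma prod_list_rev_inverse:
  fixes f g :: "'b \<Rightarrow> 'a::ring_1"
  assumes "\<And>k. k \<in> set ks \<Longrightarrow> f k * g k = c k" "\<And>k. k \<in> set ks \<Longrightarrow> central (c k)"
  shows "prod_list (map f ks) * prod_list (map g (rev ks)) = prod_list (map c ks)"
  using assms
proof (induction ks)
  case (Cons k ks)
  have "central (prod_list (map c ks))"
    using Cons.prems(2) by (induction ks) (auto intro: central_ops)
  have "prod_list (map f (k # ks)) * prod_list (map g (rev (k # ks)))
     = f k * (prod_list (map f ks) * prod_list (map g (rev ks))) * g k"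
    by (simp add: mult.assoc)
  also have "\<dots> = f k * (prod_list (map c ks) * g k)" using Cons by (simp add: mult.assoc)
  also have "\<dots> = f k * g k * prod_list (map c ks)"
    using \<open>central (prod_list (map c ks))\<close> by (simp add: central_def mult.assoc)
  finally show ?case using Cons.prems by simp
qed simp


section \<open>Fusion\<close>

text \<open>
If \<open>W\<close> absorbs \<open>p\<close>, then \<open>2 W = W (1 + e p)\<close>, and the factor \<open>1 + e p\<close> can be pushed to the right
through the product, reversing \<open>x\<close> and \<open>y\<close> on its way. On the right it absorbs \<open>p\<close>, and pushing it
back restores the product.
\<close>

lemma fusion_step:
  fixes W p l x y r :: "'a::ring_1" and e :: int
  assumes two: "\<And>z::'a. 2 * z = 0 \<Longrightarrow> z = 0"
    and e: "e * e = 1" and pp: "p * p = 1" and W: "W * p = of_int e * W"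
    and comm: "p * l = l * p" "p * r = r * p"
    and xy: "(1 + of_int e * p) * (x * y) = (y * x) * (1 + of_int e * p)"
  shows "W * (l * (x * y) * r) * p = of_int e * (W * (l * (x * y) * r))"
proof -
  define s where "s = 1 + of_int e * p"
  have ee: "of_int e * (of_int e * z) = z" for z :: 'a
    using arg_cong[OF e, of "\<lambda>k. of_int k * z"] by (simp add: mult.assoc)
  have eC: "z * of_int e = of_int e * z" for z :: 'a by (rule mult_of_int_commute[symmetric])
  have eL: "z * (of_int e * w) = of_int e * (z * w)" for z w :: 'a
    by (simp add: eC flip: mult.assoc)
  have sp: "s * p = of_int e * s"
    by (simp add: s_def distrib_left distrib_right mult.assoc pp ee)
  have "W * s = W + of_int e * (W * p)"
    by (simp add: s_def distrib_left eL)
  then have Ws: "W * s = 2 * W" by (simp add: W ee mult_2)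
  have sl: "s * l = l * s"
    by (simp add: s_def distrib_left distrib_right mult.assoc comm eL)
  have sr: "s * r = r * s"
    by (simp add: s_def distrib_left distrib_right mult.assoc comm eL)
  have "s * (l * (x * y) * r) = l * (s * (x * y)) * r"
    by (simp add: sl flip: mult.assoc)
  also have "\<dots> = l * (y * x) * (s * r)" using xy by (simp add: s_def mult.assoc)
  finally have sX: "s * (l * (x * y) * r) = l * (y * x) * r * s"
    by (simp add: sr mult.assoc)
  have "2 * (W * (l * (x * y) * r) * p) = W * (s * (l * (x * y) * r)) * p"
    by (simp only: Ws mult.assoc[symmetric])
  also have "\<dots> = W * (l * (y * x) * r) * (s * p)" by (simp only: sX) (simp only: mult.assoc)
  also have "\<dots> = of_int e * (W * (l * (y * x) * r * s))" by (simp only: sp eL mult.assoc)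
  also have "\<dots> = of_int e * (W * s * (l * (x * y) * r))" by (simp only: mult.assoc[of W s] sX)
  also have "\<dots> = 2 * (of_int e * (W * (l * (x * y) * r)))"
    unfolding Ws by (simp only: mult_2 distrib_left distrib_right)
  finally have "2 * (W * (l * (x * y) * r) * p - of_int e * (W * (l * (x * y) * r))) = 0"
    by (simp only: right_diff_distrib diff_self)
  from two[OF this] show ?thesis by simp
qed

text \<open>
Both orders of the factors occur: an ordered product of matrices and its inverse run in opposite
directions.
\<close>

lemma fusion_prod_list:
  fixes W p :: "'a::ring_1" and g :: "nat \<Rightarrow> 'a" and e :: int
  assumes two: "\<And>z::'a. 2 * z = 0 \<Longrightarrow> z = 0"
    and e: "e * e = 1" and pp: "p * p = 1" and W: "W * p = of_int e * W"
    and comm: "\<And>j. j < n \<Longrightarrow> j \<noteq> k \<Longrightarrow> j \<noteq> Suc k \<Longrightarrow> p * g j = g j * p" and k: "Suc k < n"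
  shows "(1 + of_int e * p) * (g k * g (Suc k)) = (g (Suc k) * g k) * (1 + of_int e * p) \<Longrightarrow>
      W * prod_list (map g [0..<n]) * p = of_int e * (W * prod_list (map g [0..<n]))"
    and "(1 + of_int e * p) * (g (Suc k) * g k) = (g k * g (Suc k)) * (1 + of_int e * p) \<Longrightarrow>
      W * prod_list (map g (rev [0..<n])) * p = of_int e * (W * prod_list (map g (rev [0..<n])))"
proof -
  have *: "[0..<n] = [0..<k] @ [k, Suc k] @ [Suc (Suc k)..<n]"
    using k upt_add_eq_append[of 0 k "n - k"] by (simp add: upt_conv_Cons)
  have 1: "p * prod_list (map g ks) = prod_list (map g ks) * p"
    if "ks \<in> {[0..<k], [Suc (Suc k)..<n], rev [0..<k], rev [Suc (Suc k)..<n]}" for ks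
    by (rule prod_list_commute, rule comm) (use that k in auto)
  show "W * prod_list (map g [0..<n]) * p = of_int e * (W * prod_list (map g [0..<n]))"
    if "(1 + of_int e * p) * (g k * g (Suc k)) = (g (Suc k) * g k) * (1 + of_int e * p)"
    using fusion_step[OF two e pp W _ _ that, of "prod_list (map g [0..<k])"
        "prod_list (map g [Suc (Suc k)..<n])"] 1
    unfolding * by (simp add: mult.assoc)
  show "W * prod_list (map g (rev [0..<n])) * p = of_int e * (W * prod_list (map g (rev [0..<n])))"
    if "(1 + of_int e * p) * (g (Suc k) * g k) = (g k * g (Suc k)) * (1 + of_int e * p)"
    using fusion_step[OF two e pp W _ _ that, of "prod_list (map g (rev [Suc (Suc k)..<n]))"
        "prod_list (map g (rev [0..<k]))"] 1
    unfolding * by (simp add: mult.assoc)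
qed


section \<open>Symmetrizers and antisymmetrizers\<close>

text \<open>
For \<open>e = 1\<close> and \<open>e = -1\<close> these are the two one-dimensional characters of the symmetric group, so
that symmetrizers and antisymmetrizers are treated at once.
\<close>

definition perm_char :: "int \<Rightarrow> (nat \<Rightarrow> nat) \<Rightarrow> int" where
  "perm_char e \<sigma> = (if e = 1 then 1 else sign \<sigma>)"

lemma perm_char_compose:
  "\<sigma> permutes {1..n} \<Longrightarrow> \<tau> permutes {1..n} \<Longrightarrow> perm_char e (\<sigma> \<circ> \<tau>) = perm_char e \<sigma> * perm_char e \<tau>"
  unfolding perm_char_def by (auto intro!: sign_compose permutes_imp_permutation[of "{1..n}"])

lemma perm_char_square: "perm_char e \<sigma> * perm_char e \<sigma> = 1"
  by (simp add: perm_char_def)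

text \<open>
Neighbouring transpositions generate the symmetric group on \<open>{1..n}\<close>.
\<close>

lemma permutes_adjacent_induct [consumes 1, case_names id adjacent]:
  assumes "\<sigma> permutes {1..n::nat}"
    and "P id"
    and step: "\<And>\<tau> k. \<tau> permutes {1..n} \<Longrightarrow> Suc 0 \<le> k \<Longrightarrow> k < n \<Longrightarrow> P \<tau> \<Longrightarrow> P (\<tau> \<circ> transpose k (Suc k))"
  shows "P \<sigma>"
proof -
  have adj: "transpose k (Suc k) permutes {1..n}" if "Suc 0 \<le> k" "k < n" for k
    using that by (intro permutes_swap_id) auto
  have tr: "P (\<tau> \<circ> transpose a b)"
    if "\<tau> permutes {1..n}" "P \<tau>" "Suc 0 \<le> a" "a < b" "b \<le> n" for \<tau> a b
    using that(4,1-3,5)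
  proof (induction arbitrary: \<tau> rule: less_Suc_induct)
    case (1 i)
    show ?case by (rule step) (use 1 in auto)
  next
    case (2 i j k)
    have ij: "transpose i j permutes {1..n}" "transpose j k permutes {1..n}"
      using 2 by (intro permutes_swap_id; simp)+
    have "transpose i k = transpose i j \<circ> transpose j k \<circ> transpose i j"
      using 2 by (auto simp: fun_eq_iff transpose_def)
    moreover have "P (\<tau> \<circ> transpose i j \<circ> transpose j k \<circ> transpose i j)"
    proof (rule "2.IH"(1))
      have 1: "\<tau> \<circ> transpose i j permutes {1..n}"
        by (rule permutes_compose[OF ij(1) 2(5)])
      show 2: "\<tau> \<circ> transpose i j \<circ> transpose j k permutes {1..n}"
        by (rule permutes_compose[OF ij(2) 1])
      show "P (\<tau> \<circ> transpose i j \<circ> transpose j k)"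
        by (rule "2.IH"(2)[OF 1]) (use 2 "2.IH"(1) "2.prems" "2.hyps" in auto)
    qed (use "2.prems" "2.hyps" in auto)
    ultimately show ?case by (simp only: comp_assoc)
  qed
  show ?thesis
    using finite_atLeastAtMost assms(1)
  proof (induction rule: permutes_rev_induct)
    case id
    show ?case by fact
  next
    case (swap a b \<tau>)
    then consider "a < b" | "b < a" by linarith
    then show ?case
    proof cases
      case 1
      then show ?thesis using swap by (intro tr) auto
    next
      case 2
      then show ?thesis using swap unfolding transpose_commute[of a b] by (intro tr) auto
    qed
  qed
qed

text \<open>
A homomorphism from the symmetric group to the units of a ring. Two copies are used below, acting
on two disjoint groups of tensor factors.
\<close>

locale perm_representation =
  fixes \<theta> :: "(nat \<Rightarrow> nat) \<Rightarrow> 'a::ring_1" and n :: nat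
  assumes \<theta>_id: "\<theta> id = 1"
    and \<theta>_comp: "\<sigma> permutes {1..n} \<Longrightarrow> \<tau> permutes {1..n} \<Longrightarrow> \<theta> (\<sigma> \<circ> \<tau>) = \<theta> \<sigma> * \<theta> \<tau>"
begin

text \<open>
This is \<open>n!\<close> times the (anti)symmetrizer. Leaving out the normalization keeps the coefficients
integral, and they are then central in every ring.
\<close>

definition total :: "int \<Rightarrow> 'a" where
  "total e = (\<Sum>\<sigma> | \<sigma> permutes {1..n}. of_int (perm_char e \<sigma>) * \<theta> \<sigma>)"

lemma total_absorb:
  assumes "\<rho> permutes {1..n}"
  shows "total e * \<theta> \<rho> = of_int (perm_char e \<rho>) * total e"
proof -
  have "of_int (perm_char e \<rho>) * total e
     = (\<Sum>\<sigma> | \<sigma> permutes {1..n}. of_int (perm_char e \<rho>) * (of_int (perm_char e (\<sigma> \<circ> \<rho>)) * \<theta> (\<sigma> \<circ> \<rho>)))"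
    unfolding total_def sum_distrib_left by (rule sum_permutations_compose_right[OF assms])
  also have "\<dots> = (\<Sum>\<sigma> | \<sigma> permutes {1..n}. of_int (perm_char e \<sigma>) * \<theta> \<sigma> * \<theta> \<rho>)"
  proof (rule sum.cong[OF refl])
    fix \<sigma> assume "\<sigma> \<in> {\<sigma>. \<sigma> permutes {1..n}}"
    then have "\<sigma> permutes {1..n}" by simp
    have "perm_char e \<rho> * perm_char e (\<sigma> \<circ> \<rho>) = perm_char e \<sigma>"
      using perm_char_square[of e \<rho>] unfolding perm_char_compose[OF \<open>\<sigma> permutes {1..n}\<close> assms] by algebra
    then show "of_int (perm_char e \<rho>) * (of_int (perm_char e (\<sigma> \<circ> \<rho>)) * \<theta> (\<sigma> \<circ> \<rho>))
        = of_int (perm_char e \<sigma>) * \<theta> \<sigma> * \<theta> \<rho>"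
      unfolding \<theta>_comp[OF \<open>\<sigma> permutes {1..n}\<close> assms] by (simp flip: mult.assoc of_int_mult)
  qed
  finally show ?thesis by (simp add: total_def sum_distrib_right)
qed

text \<open>
An element that absorbs the neighbouring transpositions absorbs all permutations, each with its
character value, and so multiplies the sum over the group by its order.
\<close>

lemma absorb_total:
  assumes W: "\<And>k. Suc 0 \<le> k \<Longrightarrow> k < n \<Longrightarrow> W * \<theta> (transpose k (Suc k)) = of_int e * W"
    and e: "e = 1 \<or> e = - 1"
  shows "W * total e = of_nat (fact n) * W"
proof -
  have *: "W * \<theta> \<sigma> = of_int (perm_char e \<sigma>) * W" if "\<sigma> permutes {1..n}" for \<sigma>
    using that
  proof (induction rule: permutes_adjacent_induct)
    case id
    show ?case unfolding \<theta>_id by (simp add: perm_char_def)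
  next
    case (adjacent \<tau> k)
    have t: "transpose k (Suc k) permutes {1..n}"
      using adjacent by (intro permutes_swap_id) auto
    have "perm_char e (transpose k (Suc k)) = e"
      using e by (auto simp: perm_char_def sign_swap_id)
    moreover have "W * \<theta> (\<tau> \<circ> transpose k (Suc k)) = of_int (perm_char e \<tau>) * (W * \<theta> (transpose k (Suc k)))"
      using adjacent \<theta>_comp[OF adjacent(1) t] by (simp flip: mult.assoc)
    ultimately show ?case
      unfolding perm_char_compose[OF adjacent(1) t] using adjacent(2,3) W[of k]
          by (simp only: of_int_mult mult.assoc)
  qed
  have "W * total e = (\<Sum>\<sigma> | \<sigma> permutes {1..n}. of_int (perm_char e \<sigma>) * (W * \<theta> \<sigma>))"
    unfolding total_def sum_distrib_left
    by (intro sum.cong refl) (rule central_left_commute[OF central_of_int])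
  also have "\<dots> = (\<Sum>\<sigma> | \<sigma> permutes {1..n}. W)"
  proof (rule sum.cong[OF refl])
    fix \<sigma> assume "\<sigma> \<in> {\<sigma>. \<sigma> permutes {1..n}}"
    then have "W * \<theta> \<sigma> = of_int (perm_char e \<sigma>) * W" using * by simp
    then show "of_int (perm_char e \<sigma>) * (W * \<theta> \<sigma>) = W"
      using arg_cong[OF perm_char_square[of e \<sigma>], of "\<lambda>k. of_int k * W"] by (simp add: mult.assoc)
  qed
  also have "\<dots> = of_nat (fact n) * W"
    using card_permutations[of "{1..n}" n] by simp
  finally show ?thesis .
qed

end

section \<open>Operators on a tensor power over a noncommutative ring\<close>

text \<open>
Matrices with entries in the ring \<open>'r\<close>, acting on the tensor power with one factor for each site
in \<open>'s\<close>, are represented by the right linear maps on functions from basis configurations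
\<open>'s \<Rightarrow> 'n\<close> to \<open>'r\<close>. Composition of maps is the product of matrices, so associativity is immediate
and the number of factors never enters the type. Left multiplication by a ring element is a scalar
matrix.
\<close>

typedef (overloaded) ('s, 'n, 'r) tensor_op =
  "{A :: (('s \<Rightarrow> 'n) \<Rightarrow> 'r) \<Rightarrow> (('s \<Rightarrow> 'n) \<Rightarrow> 'r::ring_1).
      (\<forall>f g. A (\<lambda>x. f x + g x) = (\<lambda>x. A f x + A g x)) \<and> (\<forall>f c. A (\<lambda>x. f x * c) = (\<lambda>x. A f x * c))}"
  morphisms apply_op Abs_op
  by (rule exI[of _ "\<lambda>f. f"]) simp

setup_lifting type_definition_tensor_op

lemma apply_op_add: "apply_op A (\<lambda>x. f x + g x) = (\<lambda>x. apply_op A f x + apply_op A g x)"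
  using apply_op[of A] by simp

lemma apply_op_scale: "apply_op A (\<lambda>x. f x * c) = (\<lambda>x. apply_op A f x * c)"
  using apply_op[of A] by simp

lemma tensor_op_eqI: "(\<And>f x. apply_op A f x = apply_op B f x) \<Longrightarrow> A = B"
  by (metis apply_op_inject ext)

instantiation tensor_op :: (type, type, ring_1) ring_1
begin

lift_definition zero_tensor_op :: "('a, 'b, 'c) tensor_op" is "\<lambda>f x. 0" by simp
lift_definition one_tensor_op :: "('a, 'b, 'c) tensor_op" is "\<lambda>f. f" by simp
lift_definition plus_tensor_op :: "('a, 'b, 'c) tensor_op \<Rightarrow> ('a, 'b, 'c) tensor_op \<Rightarrow> ('a, 'b, 'c) tensor_op"
  is "\<lambda>A B f x. A f x + B f x" by (auto simp: algebra_simps)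
lift_definition minus_tensor_op :: "('a, 'b, 'c) tensor_op \<Rightarrow> ('a, 'b, 'c) tensor_op \<Rightarrow>
    ('a, 'b, 'c) tensor_op"
  is "\<lambda>A B f x. A f x - B f x" by (auto simp: algebra_simps)
lift_definition uminus_tensor_op :: "('a, 'b, 'c) tensor_op \<Rightarrow> ('a, 'b, 'c) tensor_op"
  is "\<lambda>A f x. - A f x" by (auto simp: algebra_simps)
lift_definition times_tensor_op :: "('a, 'b, 'c) tensor_op \<Rightarrow> ('a, 'b, 'c) tensor_op \<Rightarrow>
    ('a, 'b, 'c) tensor_op"
  is "\<lambda>A B f. A (B f)" by auto

lemmas apply_op_simps [simp] = zero_tensor_op.rep_eq one_tensor_op.rep_eq plus_tensor_op.rep_eq
  minus_tensor_op.rep_eq uminus_tensor_op.rep_eq times_tensor_op.rep_eq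

instance
proof
  fix A B C :: "('a, 'b, 'c) tensor_op"
  show "(0 :: ('a, 'b, 'c) tensor_op) \<noteq> 1"
  proof
    assume "(0 :: ('a, 'b, 'c) tensor_op) = 1"
    then have "apply_op (0 :: ('a, 'b, 'c) tensor_op) (\<lambda>_. 1) undefined
        = apply_op (1 :: ('a, 'b, 'c) tensor_op) (\<lambda>_. 1) undefined"
      by simp
    then show False by simp
  qed
  show "A * (B + C) = A * B + A * C"
  proof (rule tensor_op_eqI)
    fix f x
    show "apply_op (A * (B + C)) f x = apply_op (A * B + A * C) f x"
      using apply_op_add[of A "apply_op B f" "apply_op C f"] by simp
  qed
qed (auto intro!: tensor_op_eqI simp: algebra_simps)

end

lift_definition scal :: "'r::ring_1 \<Rightarrow> ('s, 'n, 'r) tensor_op" is "\<lambda>z f x. z * f x"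
  by (auto simp: algebra_simps)

text \<open>
The factor at site \<open>s\<close> moves to site \<open>\<sigma> s\<close>, as for \<open>perm_op\<close>. With this convention
permutations act as a homomorphism.
\<close>

lift_definition perm :: "('s \<Rightarrow> 's) \<Rightarrow> ('s, 'n, 'r::ring_1) tensor_op" is "\<lambda>\<sigma> f x. f (x \<circ> \<sigma>)"
  by auto

text \<open>
The matrix \<open>a\<close> acting on the factor at site \<open>s\<close>.
\<close>

lift_definition site_op :: "'s \<Rightarrow> ('n::finite \<Rightarrow> 'n \<Rightarrow> 'r) \<Rightarrow> ('s, 'n, 'r::ring_1) tensor_op"
  is "\<lambda>s a f x. \<Sum>j\<in>UNIV. a (x s) j * f (x(s := j))"
  by (auto simp: distrib_left sum.distrib sum_distrib_right mult.assoc)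

lemmas apply_op_basic [simp] = scal.rep_eq perm.rep_eq site_op.rep_eq

lemma scal_simps:
  "scal (z + w) = scal z + scal w" "scal (z - w) = scal z - scal w" "scal (z * w) = scal z * scal w"
  "scal (- z) = - scal z" "scal 0 = 0" "scal 1 = 1"
  by (auto intro!: tensor_op_eqI simp: algebra_simps)

lemma of_nat_tensor_op: "of_nat k = scal (of_nat k)"
  by (induction k) (simp_all add: scal_simps)

lemma of_int_tensor_op: "of_int k = scal (of_int k)"
  by (cases k) (simp_all add: of_nat_tensor_op scal_simps)

lemma central_scal: "central z \<Longrightarrow> central (scal z)"
  unfolding central_def
proof
  fix A :: "('s, 'n, 'a) tensor_op" assume z: "\<forall>x. z * x = x * z"
  then show "scal z * A = A * scal z"
    by (intro tensor_op_eqI) (simp add: apply_op_scale)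
qed

lemma scal_cancel:
  fixes A :: "('s, 'n, 'r::ring_1) tensor_op"
  assumes "\<And>w. z * w = 0 \<Longrightarrow> w = 0" "scal z * A = 0"
  shows "A = 0"
proof (rule tensor_op_eqI)
  fix f x
  have "z * apply_op A f x = apply_op (scal z * A) f x" by simp
  then show "apply_op A f x = apply_op 0 f x" using assms by simp
qed

lemma perm_comp: "perm (\<sigma> \<circ> \<tau>) = perm \<sigma> * perm \<tau>"
  by (rule tensor_op_eqI) (simp add: comp_assoc)

lemma perm_id: "perm id = 1"
  by (rule tensor_op_eqI) simp

lemma perm_transpose_square: "perm (transpose s t) * perm (transpose s t) = 1"
  by (simp add: perm_id flip: perm_comp)

lemma perm_transpose_conj:
  "s \<noteq> t \<Longrightarrow> s \<noteq> r \<Longrightarrow> t \<noteq> r \<Longrightarrow>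
    perm (transpose s t) * perm (transpose s r) = perm (transpose t r) * perm (transpose s t)"
  unfolding perm_comp[symmetric] by (rule arg_cong[where f = perm]) (auto simp: fun_eq_iff transpose_def)

lemma perm_transpose_commute:
  "s \<noteq> s' \<Longrightarrow> s \<noteq> t' \<Longrightarrow> t \<noteq> s' \<Longrightarrow> t \<noteq> t' \<Longrightarrow>
    perm (transpose s t) * perm (transpose s' t') = perm (transpose s' t') * perm (transpose s t)"
  unfolding perm_comp[symmetric] by (rule arg_cong[where f = perm]) (auto simp: fun_eq_iff transpose_def)

lemma perm_site_op:
  fixes a :: "'n::finite \<Rightarrow> 'n \<Rightarrow> 'r::ring_1" and s :: 's
  assumes "inj \<sigma>"
  shows "perm \<sigma> * site_op s a = site_op (\<sigma> s) a * perm \<sigma>"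
proof (rule tensor_op_eqI)
  fix f :: "('s \<Rightarrow> 'n) \<Rightarrow> 'r" and x :: "'s \<Rightarrow> 'n"
  have "(x \<circ> \<sigma>)(s := j) = x(\<sigma> s := j) \<circ> \<sigma>" for j
    using assms by (auto simp: fun_eq_iff inj_eq)
  then show "apply_op (perm \<sigma> * site_op s a) f x = apply_op (site_op (\<sigma> s) a * perm \<sigma>) f x"
    by simp
qed

lemma perm_transpose_site_op:
  "r \<noteq> s \<Longrightarrow> r \<noteq> t \<Longrightarrow> perm (transpose s t) * site_op r a = site_op r a * perm (transpose s t)"
  by (simp add: perm_site_op)

lemma site_op_mult:
  assumes "s \<noteq> t"
  shows "apply_op (site_op s a * site_op t b) f x
    = (\<Sum>i\<in>UNIV. \<Sum>j\<in>UNIV. a (x s) i * b (x t) j * f (x(s := i, t := j)))"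
  using assms by (simp add: sum_distrib_left mult.assoc)

text \<open>
The matrix form of the RLL relation is a relation between entries: the coefficients of
\<open>f (x(s := i, t := j))\<close> on both sides are compared. The permutation exchanges \<open>x s\<close> with
\<open>x t\<close> on the left and \<open>i\<close> with \<open>j\<close> on the right.
\<close>

lemma site_op_RLL:
  fixes a b :: "'n::finite \<Rightarrow> 'n \<Rightarrow> 'r::ring_1"
  assumes st: "s \<noteq> t"
    and rel: "\<And>i j k l. w * (a i j * b k l) - h * (a k j * b i l)
        = w * (b k l * a i j) - h * (b k j * a i l)"
    and central: "central w" "central h"
  shows "(scal w - scal h * perm (transpose s t)) * (site_op s a * site_op t b)
    = (site_op t b * site_op s a) * (scal w - scal h * perm (transpose s t))"
proof (rule tensor_op_eqI)
  fix f :: "('a \<Rightarrow> 'n) \<Rightarrow> 'r" and x :: "'a \<Rightarrow> 'n"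
  let ?P = "perm (transpose s t) :: ('a, 'n, 'r) tensor_op"
  define F where "F i j = f (x(s := i, t := j))" for i j
  have ab: "apply_op (site_op s a * site_op t b) g y
      = (\<Sum>i\<in>UNIV. \<Sum>j\<in>UNIV. a (y s) i * b (y t) j * g (y(s := i, t := j)))" for g y
    by (rule site_op_mult[OF st])
  have ba: "apply_op (site_op t b * site_op s a) g y
      = (\<Sum>i\<in>UNIV. \<Sum>j\<in>UNIV. b (y t) j * a (y s) i * g (y(s := i, t := j)))" for g y
    unfolding site_op_mult[OF st[symmetric]] fun_upd_twist[OF st[symmetric]] by (rule sum.swap)
  have trx: "(x \<circ> transpose s t)(s := i, t := j) = x(s := i, t := j)" for i j
    using st by (auto simp: fun_eq_iff transpose_def)
  have trx': "x(s := i, t := j) \<circ> transpose s t = x(s := j, t := i)" for i j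
    using st by (auto simp: fun_eq_iff transpose_def)
  have "apply_op ((scal w - scal h * ?P) * (site_op s a * site_op t b)) f x
    = (\<Sum>i\<in>UNIV. \<Sum>j\<in>UNIV. (w * (a (x s) i * b (x t) j) - h * (a (x t) i * b (x s) j)) * F i j)"
    unfolding left_diff_distrib minus_tensor_op.rep_eq mult.assoc[of "scal h"]
      times_tensor_op.rep_eq[of "scal w"] times_tensor_op.rep_eq[of "scal h"] times_tensor_op.rep_eq[of ?P]
      scal.rep_eq perm.rep_eq ab trx
    using st by (simp add: F_def sum_distrib_left sum_subtractf mult.assoc)
  also have "\<dots> = (\<Sum>i\<in>UNIV. \<Sum>j\<in>UNIV. (w * (b (x t) j * a (x s) i)) * F i j)
      - (\<Sum>i\<in>UNIV. \<Sum>j\<in>UNIV. (h * (b (x t) i * a (x s) j)) * F i j)"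
    unfolding rel by (simp add: left_diff_distrib sum_subtractf)
  also have "\<dots> = apply_op ((site_op t b * site_op s a) * (scal w - scal h * ?P)) f x"
    unfolding right_diff_distrib minus_tensor_op.rep_eq mult.assoc[symmetric, of _ "scal h"]
      times_tensor_op.rep_eq[of _ ?P] centralD[OF central_scal[OF central(1)], symmetric] centralD[OF
          central_scal[OF central(2)], symmetric]
      times_tensor_op.rep_eq[of "scal w"] times_tensor_op.rep_eq[of "scal h"]
      scal.rep_eq ba perm.rep_eq trx'
    by (subst (4) sum.swap) (simp add: F_def sum_distrib_left mult.assoc)
  finally show "apply_op ((scal w - scal h * ?P) * (site_op s a * site_op t b)) f x
    = apply_op ((site_op t b * site_op s a) * (scal w - scal h * ?P)) f x" .
qed

section \<open>The trace\<close>

definition delta :: "'x \<Rightarrow> 'x \<Rightarrow> 'r::ring_1" where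
  "delta y x = of_bool (x = y)"

text \<open>
The trace over the span of the basis configurations in \<open>X\<close>: the diagonal entries are read off
from the images of the basis vectors.
\<close>

definition op_trace :: "('s \<Rightarrow> 'n) set \<Rightarrow> ('s, 'n, 'r::ring_1) tensor_op \<Rightarrow> 'r" where
  "op_trace X A = (\<Sum>z\<in>X. apply_op A (delta z) z)"

lemma op_trace_simps:
  "op_trace X (A + B) = op_trace X A + op_trace X B"
  "op_trace X (A - B) = op_trace X A - op_trace X B"
  "op_trace X (scal z * A) = z * op_trace X A"
  by (simp_all add: op_trace_def sum.distrib sum_subtractf sum_distrib_left)

text \<open>
Over a noncommutative ring the trace of a product is in general not invariant under cyclic
rotation. It is invariant if the rotated factor \<open>Z\<close> has central entries, and the operators with
this property form a ring.
\<close>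

definition cyclic :: "('s \<Rightarrow> 'n) set \<Rightarrow> ('s, 'n, 'r::ring_1) tensor_op \<Rightarrow> bool" where
  "cyclic X Z \<longleftrightarrow> (\<forall>A. op_trace X (Z * A) = op_trace X (A * Z))"

lemma cyclicD: "cyclic X Z \<Longrightarrow> op_trace X (Z * A) = op_trace X (A * Z)"
  by (simp add: cyclic_def)

lemma cyclic_add: "cyclic X Z \<Longrightarrow> cyclic X Z' \<Longrightarrow> cyclic X (Z + Z')"
  by (simp add: cyclic_def distrib_left distrib_right op_trace_simps)

lemma cyclic_diff: "cyclic X Z \<Longrightarrow> cyclic X Z' \<Longrightarrow> cyclic X (Z - Z')"
  by (simp add: cyclic_def left_diff_distrib right_diff_distrib op_trace_simps)

lemma cyclic_mult:
  assumes "cyclic X Z" "cyclic X Z'" shows "cyclic X (Z * Z')"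
  unfolding cyclic_def
proof
  fix A
  show "op_trace X (Z * Z' * A) = op_trace X (A * (Z * Z'))"
    using cyclicD[OF assms(1), of "Z' * A"] cyclicD[OF assms(2), of "A * Z"] by (simp add: mult.assoc)
qed

lemma cyclic_central: "central Z \<Longrightarrow> cyclic X Z"
  by (simp add: cyclic_def central_def)

lemma cyclic_sum: "(\<And>i. i \<in> I \<Longrightarrow> cyclic X (Z i)) \<Longrightarrow> cyclic X (\<Sum>i\<in>I. Z i)"
  by (induction I rule: infinite_finite_induct) (simp_all add: cyclic_add cyclic_central central_ops)

lemma cyclic_prod_list: "(\<And>k. k \<in> set ks \<Longrightarrow> cyclic X (Z k)) \<Longrightarrow> cyclic X (prod_list (map Z ks))"
  by (induction ks) (simp_all add: cyclic_mult cyclic_central central_ops)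

text \<open>
Rotating a permutation operator amounts to reindexing the basis configurations.
\<close>

lemma cyclic_perm:
  fixes X :: "('s \<Rightarrow> 'n) set"
  assumes "bij \<sigma>" and X: "bij_betw (\<lambda>z. z \<circ> \<sigma>) X X"
  shows "cyclic X (perm \<sigma> :: ('s, 'n, 'r::ring_1) tensor_op)"
  unfolding cyclic_def
proof
  fix A :: "('s, 'n, 'r) tensor_op"
  have *: "apply_op (perm \<sigma> :: ('s, 'n, 'r) tensor_op) (delta (z \<circ> \<sigma>)) = delta z" for z
  proof -
    have "x \<circ> \<sigma> = z \<circ> \<sigma> \<longleftrightarrow> x = z" for x :: "'s \<Rightarrow> 'n"
      using bij_is_surj[OF \<open>bij \<sigma>\<close>] by (metis fun.map_cong0 surj_fun_eq)
    then show ?thesis by (intro ext) (simp add: delta_def)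
  qed
  have "op_trace X (A * perm \<sigma>) = (\<Sum>z\<in>X. apply_op (A * perm \<sigma>) (delta (z \<circ> \<sigma>)) (z \<circ> \<sigma>))"
    unfolding op_trace_def by (rule sum.reindex_bij_betw[OF X, symmetric])
  also have "\<dots> = op_trace X (perm \<sigma> * A)"
    by (simp only: op_trace_def times_tensor_op.rep_eq *) simp
  finally show "op_trace X (perm \<sigma> * A) = op_trace X (A * perm \<sigma>)" ..
qed

text \<open>
The entries of a product of matrices acting on different sites are ordered products of entries.
\<close>

lemma apply_site_op_prod:
  fixes a :: "'k \<Rightarrow> 'n::finite \<Rightarrow> 'n \<Rightarrow> 'r::ring_1" and s :: "'k \<Rightarrow> 's"
  assumes "distinct ks" "inj s"
  shows "apply_op (prod_list (map (\<lambda>k. site_op (s k) (a k)) ks)) (delta y) z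
    = (if \<forall>t. t \<notin> s ` set ks \<longrightarrow> z t = y t then prod_list (map (\<lambda>k. a k (z (s k)) (y (s k))) ks) else 0)"
  using assms(1)
proof (induction ks arbitrary: z)
  case Nil
  show ?case by (auto simp: delta_def fun_eq_iff)
next
  case (Cons k ks)
  let ?c = "\<forall>t. t \<notin> s ` set (k # ks) \<longrightarrow> z t = y t"
  have k: "s k \<notin> s ` set ks" using Cons.prems \<open>inj s\<close> by (auto dest: injD)
  have eq: "map (\<lambda>l. a l ((z(s k := j)) (s l)) (y (s l))) ks = map (\<lambda>l. a l (z (s l)) (y (s l))) ks" for j
    using Cons.prems \<open>inj s\<close> by (auto dest: injD)
  have c: "(\<forall>t. t \<notin> s ` set ks \<longrightarrow> (z(s k := j)) t = y t) \<longleftrightarrow> j = y (s k) \<and> ?c" for j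
    using k by auto
  have IH: "apply_op (prod_list (map (\<lambda>k. site_op (s k) (a k)) ks)) (delta y) (z(s k := j))
     = (if j = y (s k) \<and> ?c then prod_list (map (\<lambda>l. a l (z (s l)) (y (s l))) ks) else 0)" for j
    using Cons.prems by (simp only: Cons.IH distinct.simps c eq)
  have "apply_op (prod_list (map (\<lambda>k. site_op (s k) (a k)) (k # ks))) (delta y) z
     = (\<Sum>j\<in>UNIV. a k (z (s k)) j * (if j = y (s k)
         \<and> ?c then prod_list (map (\<lambda>l. a l (z (s l)) (y (s l))) ks) else 0))"
    by (simp only: list.map prod_list.Cons times_tensor_op.rep_eq site_op.rep_eq IH)
  also have "\<dots> = (\<Sum>j\<in>UNIV. if j = y (s k) then (if ?c then a k (z (s k)) (y (s k)) * prod_list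
      (map (\<lambda>l. a l (z (s l)) (y (s l))) ks) else 0) else 0)"
    by (intro sum.cong) auto
  finally show ?case by auto
qed


section \<open>The Yang--Baxter equation\<close>

text \<open>
The Yang--Baxter equation for \<open>w - \<kappa> q\<close> and \<open>w' - \<kappa> r\<close> at the point \<open>w' = w + e \<kappa>\<close>, where the
third factor becomes a multiple of \<open>1 + e p\<close>. The hypotheses on \<open>p\<close>, \<open>q\<close>, \<open>r\<close> are the relations
between the three transpositions of three letters. Negative \<open>\<kappa>\<close> serves for the inverse matrices.
\<close>

lemma fused_Yang_Baxter:
  fixes p q r w \<kappa> :: "'a::ring_1" and e :: int
  assumes e: "e * e = 1" and pp: "p * p = 1"
    and pq: "p * q = r * p" "q * r = p * q" and pr: "p * r = q * p" "r * q = q * p"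
    and central: "central w" "central \<kappa>"
  shows "(1 + of_int e * p) * ((w - \<kappa> * q) * (w + of_int e * \<kappa> - \<kappa> * r))
    = ((w + of_int e * \<kappa> - \<kappa> * r) * (w - \<kappa> * q)) * (1 + of_int e * p)"
proof -
  define \<epsilon> :: 'a where "\<epsilon> = of_int e"
  have \<epsilon>: "central \<epsilon>" "\<epsilon> * \<epsilon> = 1"
    using e by (simp_all add: \<epsilon>_def flip: of_int_mult)
  have w: "x * w = w * x" "x * (w * y) = w * (x * y)" for x y
    using centralD[OF central(1)] central_left_commute[OF central(1)] by auto
  have \<kappa>: "x * \<kappa> = \<kappa> * x" "x * (\<kappa> * y) = \<kappa> * (x * y)" for x y
    using centralD[OF central(2)] central_left_commute[OF central(2)] by auto
  have \<epsilon>': "x * \<epsilon> = \<epsilon> * x" "x * (\<epsilon> * y) = \<epsilon> * (x * y)" for x y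
    using centralD[OF \<epsilon>(1)] central_left_commute[OF \<epsilon>(1)] by auto
  note scalars = w[of p] w[of q] w[of r] w[of \<kappa>] w[of \<epsilon>] \<kappa>[of p] \<kappa>[of q] \<kappa>[of r]
    \<epsilon>'[of p] \<epsilon>'[of q] \<epsilon>'[of r] \<epsilon>'[of \<kappa>]
  have words: "q * p = p * r" "r * p = p * q" "q * r = p * q" "r * q = p * r"
    using pq pr by simp_all
  have words': "p * (p * y) = y" "q * (p * y) = p * (r * y)" "r * (p * y) = p * (q * y)"
    "q * (r * y) = p * (q * y)" "r * (q * y) = p * (r * y)" "\<epsilon> * (\<epsilon> * y) = y" for y
    using pp words \<epsilon>(2) by (simp_all flip: mult.assoc)
  show ?thesis
    unfolding \<epsilon>_def[symmetric]
    by (simp add: algebra_simps scalars words words' pp \<epsilon>(2))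
qed

lemma commute_scaled_diff:
  assumes "central w" "central \<kappa>" "z * p = p * z"
  shows "z * (w - \<kappa> * p) = (w - \<kappa> * p) * z"
  using assms(3) centralD[OF assms(1), of z] central_left_commute[OF assms(2), of z p]
  by (simp add: left_diff_distrib right_diff_distrib mult.assoc)

lemma central_prod_list: "(\<And>k. k \<in> set ks \<Longrightarrow> central (f k)) \<Longrightarrow> central (prod_list (map f ks))"
  by (induction ks) (simp_all add: central_ops)

lemma prod_list_rev_central:
  assumes "\<And>k. central (f k)"
  shows "prod_list (map f (rev ks)) = prod_list (map f ks)"
  by (induction ks) (simp_all add: centralD[OF assms])

lemma prod_list_cancel:
  fixes f :: "'k \<Rightarrow> 'a::ring_1"
  assumes "\<And>k z. f k * z = 0 \<Longrightarrow> z = 0" "prod_list (map f ks) * z = 0"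
  shows "z = 0"
  using assms(2) by (induction ks) (auto simp: mult.assoc dest: assms(1))

lemma scal_prod_list: "scal (prod_list (map f ks)) = prod_list (map (\<lambda>k. scal (f k)) ks)"
  by (induction ks) (simp_all add: scal_simps)

text \<open>
The fused relation for two rows of the array of factors of \<open>R\<close>. The factors are regrouped into
pairs over the same site \<open>z l\<close>, and the fused Yang--Baxter equation applies to every pair.
\<close>

lemma fused_row:
  fixes z :: "'l \<Rightarrow> 's" and u :: "'l \<Rightarrow> 'r::ring_1"
  defines "P \<equiv> \<lambda>s t. perm (transpose s t) :: ('s, 'n, 'r) tensor_op"
  assumes e: "e * e = (1::int)" and st: "s \<noteq> t" and ls: "distinct ls" "inj z"
    and z: "\<And>l. z l \<noteq> s" "\<And>l. z l \<noteq> t"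
    and central: "\<And>l. central (u l)" "central \<kappa>"
    and v: "\<And>l. v l = u l + of_int e * \<kappa>"
  shows "(1 + of_int e * P s t) *
      (prod_list (map (\<lambda>l. scal (u l) - scal \<kappa> * P s (z l)) ls) *
       prod_list (map (\<lambda>l. scal (v l) - scal \<kappa> * P t (z l)) ls))
    = (prod_list (map (\<lambda>l. scal (v l) - scal \<kappa> * P t (z l)) ls) *
       prod_list (map (\<lambda>l. scal (u l) - scal \<kappa> * P s (z l)) ls)) * (1 + of_int e * P s t)"
proof -
  let ?S = "\<lambda>l. scal (u l) - scal \<kappa> * P s (z l)" and ?T = "\<lambda>l. scal (v l) - scal \<kappa> * P t (z l)"
  have cv: "central (v l)" for l using central by (simp add: v central_ops)
  note C = central_scal[OF central(1)] central_scal[OF central(2)] central_scal[OF cv]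
  have ST: "?S l * ?T l' = ?T l' * ?S l" if "l \<noteq> l'" for l l'
  proof -
    have "P s (z l) * P t (z l') = P t (z l') * P s (z l)"
      unfolding P_def using that st z[of l] z[of l'] ls by (intro perm_transpose_commute) (auto dest: injD)
    then have "P s (z l) * ?T l' = ?T l' * P s (z l)"
      by (rule commute_scaled_diff[OF C(3,2)])
    then show ?thesis by (rule commute_scaled_diff[OF C(1,2), symmetric, OF sym])
  qed
  have YB: "(1 + of_int e * P s t) * (?S l * ?T l) = (?T l * ?S l) * (1 + of_int e * P s t)" for l
  proof -
    have v': "scal (v l) = scal (u l) + of_int e * scal \<kappa>"
      by (simp add: v scal_simps of_int_tensor_op)
    have zs: "s \<noteq> z l" "t \<noteq> z l" using z[of l] by auto
    have conj: "P s t * P s (z l) = P t (z l) * P s t" "P t s * P t (z l) = P s (z l) * P t s"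
      "P s (z l) * P t (z l) = P s t * P s (z l)"  "P t (z l) * P s (z l) = P t s * P t (z l)"
      using perm_transpose_conj[of s t "z l"] perm_transpose_conj[of t s "z l"]
        perm_transpose_conj[of "z l" s t] perm_transpose_conj[of "z l" t s] 
        perm_transpose_conj[of s "z l" t] perm_transpose_conj[of t "z l" s] st zs zs[symmetric]
      unfolding P_def by (simp_all add: transpose_commute)
    show ?thesis
      unfolding v'
      by (rule fused_Yang_Baxter[OF e _ _ _ _ _ C(1,2)])
        (use conj in \<open>simp_all add: P_def perm_transpose_square transpose_commute\<close>)
  qed
  have "prod_list (map (\<lambda>l. ?T l * ?S l) ls) * (1 + of_int e * P s t)
      = (1 + of_int e * P s t) * prod_list (map (\<lambda>l. ?S l * ?T l) ls)"
    by (rule prod_list_intertwine) (rule YB[symmetric])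
  moreover have "prod_list (map ?S ls) * prod_list (map ?T ls) = prod_list (map (\<lambda>l. ?S l * ?T l) ls)"
    by (rule prod_list_mult_distrib[OF ls(1)]) (use ST in metis)
  moreover have "prod_list (map ?T ls) * prod_list (map ?S ls) = prod_list (map (\<lambda>l. ?T l * ?S l) ls)"
    by (rule prod_list_mult_distrib[OF ls(1)]) (use ST in metis)
  ultimately show ?thesis by simp
qed

section \<open>Commuting traces from RLL relations\<close>

text \<open>
This is \<open>n!\<close> times the trace of the (anti)symmetrizer times the product of the matrices
\<open>a 0, a 1, \<dots>\<close> on the factors \<open>1, 2, \<dots>\<close>, written out in entries.
\<close>

definition perm_trace :: "int \<Rightarrow> (nat \<Rightarrow> 'n::finite \<Rightarrow> 'n \<Rightarrow> 'r::ring_1) \<Rightarrow> nat \<Rightarrow> 'r" where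
  "perm_trace e a n = (\<Sum>x\<in>tidx n. \<Sum>\<sigma> | \<sigma> permutes {1..n}.
     of_int (perm_char e \<sigma>) * prod_list (map (\<lambda>k. a k (x (\<sigma> (Suc k))) (x (Suc k))) [0..<n]))"

text \<open>
The sites are \<open>Inl k\<close> and \<open>Inr l\<close> for the two groups of tensor factors.
\<close>

lemma perm_left: "perm_representation (\<lambda>\<sigma>. perm (map_sum \<sigma> id)) n"
  by unfold_locales (simp_all add: perm_id map_sum.id map_sum.comp flip: perm_comp)

lemma perm_right: "perm_representation (\<lambda>\<tau>. perm (map_sum id \<tau>)) n"
  by unfold_locales (simp_all add: perm_id map_sum.id map_sum.comp flip: perm_comp)

text \<open>
The abstract setting of the argument: \<open>a k\<close> and \<open>b l\<close> are the matrices \<open>\<L>(u + e k h)\<close> and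
\<open>\<L>(v + f l h)\<close> with entries in some ring containing \<open>u\<close> and \<open>v\<close>, and \<open>x k\<close>, \<open>y l\<close> are the
arguments. Fusion is assumed without a factor \<open>h\<close>, since \<open>h\<close> is not assumed to be cancellable. The
conditions \<open>cancel\<close> make the scalar \<open>R R'\<close> cancellable.
\<close>

locale evaluated_RLL =
  fixes a b :: "nat \<Rightarrow> 'n::finite \<Rightarrow> 'n \<Rightarrow> 'r::ring_1" and x y :: "nat \<Rightarrow> 'r" and h :: 'r and e f :: int
  assumes central: "\<And>k. central (x k)" "\<And>l. central (y l)" "central h"
    and signs: "e = 1 \<or> e = - 1" "f = 1 \<or> f = - 1"
    and shift: "\<And>k. x (Suc k) = x k + of_int e * h" "\<And>l. y (Suc l) = y l + of_int f * h"
    and RLL: "\<And>k l i j i' j'. (x k - y l) * (a k i j * b l i' j' - b l i' j' * a k i j)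
      = h * (a k i' j * b l i j' - b l i' j * a k i j')"
    and fusion_a: "\<And>k i j i' j'. a k i j * a (Suc k) i' j' + of_int e * (a k i' j * a (Suc k) i j')
      = a (Suc k) i' j' * a k i j + of_int e * (a (Suc k) i' j * a k i j')"
    and fusion_b: "\<And>k i j i' j'. b k i j * b (Suc k) i' j' + of_int f * (b k i' j * b (Suc k) i j')
      = b (Suc k) i' j' * b k i j + of_int f * (b (Suc k) i' j * b k i j')"
    and cancel_nat: "\<And>k z. k > 0 \<Longrightarrow> of_nat k * z = (0::'r) \<Longrightarrow> z = 0"
    and cancel: "\<And>k l z. (x k - y l + h) * z = 0 \<Longrightarrow> z = 0" "\<And>k l z. (x k - y l - h) * z = 0 \<Longrightarrow> z = 0"
begin

lemma e_square: "e * e = 1" and f_square: "f * f = 1"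
  using signs by auto

lemma two_cancel: "2 * (A :: ('s, 'm, 'r) tensor_op) = 0 \<Longrightarrow> A = 0"
proof (rule scal_cancel)
  assume "2 * A = 0"
  moreover have "(2 :: ('s, 'm, 'r) tensor_op) = scal 2"
    using of_nat_tensor_op[of 2] by simp
  ultimately show "scal 2 * A = 0" by simp
qed (use cancel_nat[of 2] in simp)

definition LA :: "nat \<Rightarrow> (nat + nat, 'n, 'r) tensor_op" where "LA k = site_op (Inl (Suc k)) (a k)"
definition LB :: "nat \<Rightarrow> (nat + nat, 'n, 'r) tensor_op" where "LB l = site_op (Inr (Suc l)) (b l)"
definition P :: "nat + nat \<Rightarrow> nat + nat \<Rightarrow> (nat + nat, 'n, 'r) tensor_op" where
  "P s t = perm (transpose s t)"

text \<open>
For \<open>\<kappa> = h\<close> this is the R-matrix of the sites \<open>k\<close> and \<open>l\<close>, and for \<open>\<kappa> = -h\<close> its inverse up to a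
scalar.
\<close>

definition Q :: "'r \<Rightarrow> nat \<Rightarrow> nat \<Rightarrow> (nat + nat, 'n, 'r) tensor_op" where
  "Q \<kappa> k l = scal (x k - y l) - scal \<kappa> * P (Inl (Suc k)) (Inr (Suc l))"

lemma central_scals: "central (scal (x k - y l))" "central (scal h)" "central (scal (- h))"
  using central by (auto intro!: central_scal central_ops)

lemma Q_commute:
  assumes "Z * P (Inl (Suc k)) (Inr (Suc l)) = P (Inl (Suc k)) (Inr (Suc l)) * Z" "\<kappa> \<in> {h, - h}"
  shows "Z * Q \<kappa> k l = Q \<kappa> k l * Z"
proof -
  have "central (scal \<kappa>)" using assms(2) central_scals by auto
  then show ?thesis
    unfolding Q_def by (rule commute_scaled_diff[OF central_scals(1) _ assms(1)])
qed

lemma Q_inverse: "Q h k l * Q (- h) k l = scal ((x k - y l + h) * (x k - y l - h))"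
  "Q (- h) k l * Q h k l = scal ((x k - y l + h) * (x k - y l - h))"
proof -
  define w p where "w = x k - y l" and "p = P (Inl (Suc k)) (Inr (Suc l))"
  have P1: "p * p = 1" by (simp add: p_def P_def perm_transpose_square)
  have PP: "p * (p * Z) = Z" for Z using P1 by (simp flip: mult.assoc)
  have w: "Z * scal w = scal w * Z" "Z * (scal w * Z') = scal w * (Z * Z')" for Z Z'
    using central_scals(1)[of k l] unfolding w_def by (metis centralD central_left_commute)+
  have h: "Z * scal h = scal h * Z" "Z * (scal h * Z') = scal h * (Z * Z')" for Z Z'
    using central_scals(2) by (metis centralD central_left_commute)+
  have "w * h = h * w" using centralD[OF central(3), of w] by simp
  then have *: "(x k - y l + h) * (x k - y l - h) = w * w - h * h"
    unfolding w_def[symmetric] by (simp add: algebra_simps)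
  show "Q h k l * Q (- h) k l = scal ((x k - y l + h) * (x k - y l - h))"
    "Q (- h) k l * Q h k l = scal ((x k - y l + h) * (x k - y l - h))"
    unfolding * by (simp_all add: Q_def w_def[symmetric] p_def[symmetric]
        scal_simps left_diff_distrib right_diff_distrib
        distrib_left distrib_right mult.assoc P1 PP w(1)[of p] h(1)[of "scal w"] h(2)[of p]
            h(2)[of "scal w"] w(2)[of p])
qed

lemma Q_P_commute:
  "\<kappa> \<in> {h, - h} \<Longrightarrow> s \<notin> {Inl (Suc k), Inr (Suc l)} \<Longrightarrow> t \<notin> {Inl (Suc k), Inr (Suc l)} \<Longrightarrow>
    P s t * Q \<kappa> k l = Q \<kappa> k l * P s t"
  unfolding P_def[of s t] by (intro Q_commute) (auto simp: P_def intro!: perm_transpose_commute)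

lemma Q_LA_commute: "\<kappa> \<in> {h, - h} \<Longrightarrow> k' \<noteq> k \<Longrightarrow> LA k' * Q \<kappa> k l = Q \<kappa> k l * LA k'"
  by (rule Q_commute) (simp_all add: P_def LA_def perm_transpose_site_op)

lemma Q_LB_commute: "\<kappa> \<in> {h, - h} \<Longrightarrow> l' \<noteq> l \<Longrightarrow> LB l' * Q \<kappa> k l = Q \<kappa> k l * LB l'"
  by (rule Q_commute) (simp_all add: P_def LB_def perm_transpose_site_op)

lemma Q_Q_commute: "\<kappa> \<in> {h, - h} \<Longrightarrow> k \<noteq> k' \<Longrightarrow> l \<noteq> l' \<Longrightarrow> Q \<kappa> k l * Q \<kappa> k' l' = Q \<kappa> k' l' * Q \<kappa> k l"
  by (rule Q_commute) (simp_all add: Q_P_commute)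

lemma RLL_op: "Q h k l * (LA k * LB l) = (LB l * LA k) * Q h k l"
  unfolding Q_def LA_def LB_def P_def
proof (rule site_op_RLL)
  fix i j i' j'
  show "(x k - y l) * (a k i j * b l i' j') - h * (a k i' j * b l i j') =
       (x k - y l) * (b l i' j' * a k i j) - h * (b l i' j * a k i j')"
    using RLL[of k l i j i' j'] by (simp add: algebra_simps)
qed (use central in \<open>auto intro: central_ops\<close>)


definition A :: "nat \<Rightarrow> (nat + nat, 'n, 'r) tensor_op" where "A n = prod_list (map LA [0..<n])"
definition B :: "nat \<Rightarrow> (nat + nat, 'n, 'r) tensor_op" where "B m = prod_list (map LB [0..<m])"

text \<open>
In \<open>R\<close> the factors run upwards in \<open>k\<close> and downwards in \<open>l\<close>: the first R-matrix to meet \<open>A B\<close> from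
the left must be the one of the adjacent factors, the last of \<open>A\<close> and the first of \<open>B\<close>.
\<close>

definition R :: "nat \<Rightarrow> nat \<Rightarrow> (nat + nat, 'n, 'r) tensor_op" where
  "R n m = prod_list (map (\<lambda>k. prod_list (map (Q h k) (rev [0..<m]))) [0..<n])"
definition R' :: "nat \<Rightarrow> nat \<Rightarrow> (nat + nat, 'n, 'r) tensor_op" where
  "R' n m = prod_list (map (\<lambda>k. prod_list (map (Q (- h) k) [0..<m])) (rev [0..<n]))"

definition unitarity_factor :: "nat \<Rightarrow> nat \<Rightarrow> 'r" where
  "unitarity_factor n m = prod_list (map (\<lambda>k. prod_list
      (map (\<lambda>l. (x k - y l + h) * (x k - y l - h)) [0..<m])) [0..<n])"

lemma central_unitarity_factor: "central (unitarity_factor n m)"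
  unfolding unitarity_factor_def using central by (intro central_prod_list) (auto intro!: central_ops)

lemma unitarity_factor_cancel: "unitarity_factor n m * z = 0 \<Longrightarrow> z = 0"
  unfolding unitarity_factor_def
proof (rule prod_list_cancel)
  show "z = 0" if "prod_list (map (\<lambda>l. (x k - y l + h) * (x k - y l - h)) [0..<m]) * z = 0" for k z
    using that by (rule prod_list_cancel[rotated]) (simp add: mult.assoc, blast dest: cancel)
qed

text \<open>
\<open>R'\<close> has the same factors as \<open>R\<close> with \<open>h\<close> replaced by \<open>-h\<close>, in the opposite order.
\<close>

lemma R_inverse: "R n m * R' n m = scal (unitarity_factor n m)" "R' n m * R n m
    = scal (unitarity_factor n m)"
proof -
  let ?c = "\<lambda>k l. (x k - y l + h) * (x k - y l - h)"
  let ?C = "\<lambda>k. prod_list (map (?c k) [0..<m])"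
  have c: "central (?c k l)" for k l using central by (intro central_ops)
  have C: "central (?C k)" for k by (rule central_prod_list) (rule c)
  have row: "prod_list (map (Q h k) (rev [0..<m])) * prod_list (map (Q (- h) k) [0..<m]) = scal (?C k)"
    "prod_list (map (Q (- h) k) [0..<m]) * prod_list (map (Q h k) (rev [0..<m])) = scal (?C k)" for k
    using prod_list_rev_inverse[of "rev [0..<m]" "Q h k" "Q (- h) k" "\<lambda>l. scal (?c k l)"]
      prod_list_rev_inverse[of "[0..<m]" "Q (- h) k" "Q h k" "\<lambda>l. scal (?c k l)"]
    by (simp_all add: Q_inverse central_scal c scal_prod_list prod_list_rev_central)
  have "R n m * R' n m = prod_list (map (\<lambda>k. scal (?C k)) [0..<n])"
    unfolding R_def R'_def by (rule prod_list_rev_inverse) (rule row, rule central_scal[OF C])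
  then show "R n m * R' n m = scal (unitarity_factor n m)" unfolding unitarity_factor_def
      by (simp only: scal_prod_list)
  have "R' n m * prod_list (map (\<lambda>k. prod_list (map (Q h k) (rev [0..<m]))) (rev (rev [0..<n])))
      = prod_list (map (\<lambda>k. scal (?C k)) (rev [0..<n]))"
    unfolding R'_def by (rule prod_list_rev_inverse) (rule row, rule central_scal[OF C])
  then show "R' n m * R n m = scal (unitarity_factor n m)"
    unfolding unitarity_factor_def R_def prod_list_rev_central[of "\<lambda>k. scal
        (?C k)", OF central_scal[OF C]] rev_rev_ident
    by (simp only: scal_prod_list)
qed

text \<open>
One factor of \<open>A\<close> passes through all of \<open>B\<close>.
\<close>

lemma row_RLL:
  assumes "distinct ls"
  shows "prod_list (map (Q h k) (rev ls)) * (LA k * prod_list (map LB ls))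
    = prod_list (map LB ls) * (LA k * prod_list (map (Q h k) (rev ls)))"
  using assms
proof (induction ls)
  case (Cons l ls)
  let ?M = "prod_list (map (Q h k) (rev ls))" and ?B = "prod_list (map LB ls)"
  have QB: "Q h k l * ?B = ?B * Q h k l"
    by (rule prod_list_commute, rule Q_LB_commute[symmetric]) (use Cons.prems in auto)
  have MB: "LB l * ?M = ?M * LB l"
    by (rule prod_list_commute, rule Q_LB_commute) (use Cons.prems in auto)
  have "?M * Q h k l * (LA k * (LB l * ?B)) = ?M * (Q h k l * (LA k * LB l)) * ?B"
    by (simp add: mult.assoc)
  also have "\<dots> = (?M * LB l) * (LA k * (Q h k l * ?B))" by (simp add: RLL_op mult.assoc)
  also have "\<dots> = LB l * (?M * (LA k * ?B)) * Q h k l" by (simp only: MB[symmetric] QB mult.assoc)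
  also have "\<dots> = LB l * ?B * (LA k * (?M * Q h k l))" using Cons by (simp add: mult.assoc)
  finally show ?case by simp
qed simp

lemma LA_row_commute: "k \<noteq> k' \<Longrightarrow> \<kappa> \<in> {h, - h} \<Longrightarrow>
    LA k * prod_list (map (Q \<kappa> k') ls) = prod_list (map (Q \<kappa> k') ls) * LA k"
  by (rule prod_list_commute) (rule Q_LA_commute)

lemma R_exchange: "R n m * (A n * B m) = B m * (A n * R n m)"
proof -
  let ?M = "\<lambda>k. prod_list (map (Q h k) (rev [0..<m]))"
  have "R n m * A n = prod_list (map (\<lambda>k. ?M k * LA k) [0..<n])"
    unfolding R_def A_def by (rule prod_list_mult_distrib) (auto intro: LA_row_commute[symmetric])
  moreover have "A n * R n m = prod_list (map (\<lambda>k. LA k * ?M k) [0..<n])"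
    unfolding R_def A_def by (rule prod_list_mult_distrib) (auto intro: LA_row_commute)
  moreover have "prod_list (map (\<lambda>k. ?M k * LA k) [0..<n]) * B m
      = B m * prod_list (map (\<lambda>k. LA k * ?M k) [0..<n])"
    by (rule prod_list_intertwine) (use row_RLL[of "[0..<m]"] in \<open>simp add: B_def mult.assoc\<close>)
  ultimately show ?thesis by (simp add: mult.assoc[symmetric])
qed


text \<open>
\<open>n! m!\<close> times the projection \<open>E\<close> belonging to both groups of factors.
\<close>

definition W :: "nat \<Rightarrow> nat \<Rightarrow> (nat + nat, 'n, 'r) tensor_op" where
  "W n m = perm_representation.total (\<lambda>\<sigma>. perm (map_sum \<sigma> id)) n e
         * perm_representation.total (\<lambda>\<tau>. perm (map_sum id \<tau>)) m f"

lemma perm_left_right_commute: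
  "perm (map_sum \<sigma> id) * perm (map_sum id \<tau>) = perm (map_sum id \<tau>) * perm (map_sum \<sigma> id)"
  unfolding perm_comp[symmetric] by (rule arg_cong[where f = perm])
      (auto simp: fun_eq_iff map_sum_def split: sum.splits)

lemma total_right_commute:
  "perm_representation.total (\<lambda>\<tau>. perm (map_sum id \<tau>)) m f * perm (map_sum \<sigma> id)
    = perm (map_sum \<sigma> id) * perm_representation.total (\<lambda>\<tau>. perm (map_sum id \<tau>)) m f"
  unfolding perm_representation.total_def[OF perm_right] sum_distrib_left sum_distrib_right
  by (intro sum.cong refl) (simp add: mult.assoc perm_left_right_commute
      central_left_commute[OF central_of_int])

lemma W_absorb:
  "\<sigma> permutes {1..n} \<Longrightarrow> W n m * perm (map_sum \<sigma> id) = of_int (perm_char e \<sigma>) * W n m"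
  "\<tau> permutes {1..m} \<Longrightarrow> W n m * perm (map_sum id \<tau>) = of_int (perm_char f \<tau>) * W n m"
proof -
  assume "\<sigma> permutes {1..n}"
  then have "perm_representation.total (\<lambda>\<sigma>. perm (map_sum \<sigma> id)) n e * perm (map_sum \<sigma> id)
    = of_int (perm_char e \<sigma>) * (perm_representation.total (\<lambda>\<sigma>. perm (map_sum \<sigma> id)) n e
      :: (nat + nat, 'n, 'r) tensor_op)"
    by (rule perm_representation.total_absorb[OF perm_left])
  then show "W n m * perm (map_sum \<sigma> id) = of_int (perm_char e \<sigma>) * W n m"
    unfolding W_def mult.assoc total_right_commute by (simp flip: mult.assoc)
next
  assume "\<tau> permutes {1..m}"
  then have "perm_representation.total (\<lambda>\<tau>. perm (map_sum id \<tau>)) m f * perm (map_sum id \<tau>)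
    = of_int (perm_char f \<tau>) * (perm_representation.total (\<lambda>\<tau>. perm (map_sum id \<tau>)) m f
      :: (nat + nat, 'n, 'r) tensor_op)"
    by (rule perm_representation.total_absorb[OF perm_right])
  then show "W n m * perm (map_sum id \<tau>) = of_int (perm_char f \<tau>) * W n m"
    unfolding W_def by (simp add: mult.assoc central_left_commute[OF central_of_int])
qed

definition p1 :: "nat \<Rightarrow> (nat + nat, 'n, 'r) tensor_op" where "p1 k = P (Inl (Suc k)) (Inl (Suc (Suc k)))"
definition p2 :: "nat \<Rightarrow> (nat + nat, 'n, 'r) tensor_op" where "p2 l = P (Inr (Suc l)) (Inr (Suc (Suc l)))"

lemma p1_eq: "p1 k = perm (map_sum (transpose (Suc k) (Suc (Suc k))) id)"
  and p2_eq: "p2 l = perm (map_sum id (transpose (Suc l) (Suc (Suc l))))"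
  unfolding p1_def p2_def P_def
  by (auto intro!: arg_cong[where f = perm] simp: fun_eq_iff map_sum_def transpose_def split: sum.splits)

lemma p_square: "p1 k * p1 k = 1" "p2 l * p2 l = 1"
  by (simp_all add: p1_def p2_def P_def perm_transpose_square)

lemma W_p:
  "Suc k < n \<Longrightarrow> W n m * p1 k = of_int e * W n m" "Suc l < m \<Longrightarrow> W n m * p2 l = of_int f * W n m"
proof -
  have t: "transpose (Suc k) (Suc (Suc k)) permutes {1..n}" if "Suc k < n" for k n
    using that by (intro permutes_swap_id) auto
  have c: "perm_char e (transpose (Suc k) (Suc (Suc k))) = e"
      "perm_char f (transpose (Suc k) (Suc (Suc k))) = f" for k
    using signs by (auto simp: perm_char_def sign_swap_id)
  show "Suc k < n \<Longrightarrow> W n m * p1 k = of_int e * W n m" "Suc l < m \<Longrightarrow> W n m * p2 l = of_int f * W n m"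
    using W_absorb(1)[OF t[of k n], of m] W_absorb(2)[OF t[of l m], of n] by (simp_all add: p1_eq p2_eq c)
qed

text \<open>
For such \<open>Z\<close> one has \<open>W Z W = n! m! W Z\<close>, that is, \<open>Z\<close> preserves the kernel of \<open>W\<close>.
\<close>

definition fused :: "nat \<Rightarrow> nat \<Rightarrow> (nat + nat, 'n, 'r) tensor_op \<Rightarrow> bool" where
  "fused n m Z \<longleftrightarrow> (\<forall>k. Suc k < n \<longrightarrow> W n m * Z * p1 k = of_int e * (W n m * Z))
                \<and> (\<forall>l. Suc l < m \<longrightarrow> W n m * Z * p2 l = of_int f * (W n m * Z))"

lemma fused_absorb:
  assumes "fused n m Z"
  shows "W n m * Z * W n m = of_nat (fact n * fact m) * (W n m * Z)"
proof -
  have 1: "W n m * Z * perm_representation.total (\<lambda>\<sigma>. perm (map_sum \<sigma> id)) n e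
      = of_nat (fact n) * (W n m * Z)"
  proof (rule perm_representation.absorb_total[OF perm_left _ signs(1)])
    fix k assume "Suc 0 \<le> k" "k < n"
    then show "W n m * Z * perm (map_sum (transpose k (Suc k)) id) = of_int e * (W n m * Z)"
      using assms unfolding fused_def by (cases k) (auto simp: p1_eq)
  qed
  have 2: "W n m * Z * perm_representation.total (\<lambda>\<tau>. perm (map_sum id \<tau>)) m f
      = of_nat (fact m) * (W n m * Z)"
  proof (rule perm_representation.absorb_total[OF perm_right _ signs(2)])
    fix k assume "Suc 0 \<le> k" "k < m"
    then show "W n m * Z * perm (map_sum id (transpose k (Suc k))) = of_int f * (W n m * Z)"
      using assms unfolding fused_def by (cases k) (auto simp: p2_eq)
  qed
  have "W n m * Z * W n m = W n m * Z * perm_representation.total (\<lambda>\<sigma>. perm (map_sum \<sigma> id)) n e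
      * perm_representation.total (\<lambda>\<tau>. perm (map_sum id \<tau>)) m f"
    by (simp add: W_def mult.assoc)
  also have "\<dots> = of_nat (fact n) * (of_nat (fact m) * (W n m * Z))"
    by (simp only: 1 mult.assoc[of "of_nat (fact n)"] 2)
  finally show ?thesis by (simp only: of_nat_mult mult.assoc)
qed

lemma fused_one: "fused n m 1"
  by (simp add: fused_def W_p)

lemma P_row_commute:
  assumes "\<kappa> \<in> {h, - h}"
  shows "k \<noteq> i \<Longrightarrow> k \<noteq> j \<Longrightarrow> P (Inl (Suc i)) (Inl (Suc j)) * prod_list (map (\<lambda>l. Q \<kappa> k l) ls)
      = prod_list (map (\<lambda>l. Q \<kappa> k l) ls) * P (Inl (Suc i)) (Inl (Suc j))"
    and "l \<noteq> i \<Longrightarrow> l \<noteq> j \<Longrightarrow> P (Inr (Suc i)) (Inr (Suc j)) * prod_list (map (\<lambda>k. Q \<kappa> k l) ks)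
      = prod_list (map (\<lambda>k. Q \<kappa> k l) ks) * P (Inr (Suc i)) (Inr (Suc j))"
  using assms by (auto intro!: prod_list_commute Q_P_commute)

lemma row_fusion:
  assumes "distinct ls" "\<And>l. x t - y l = x s - y l + of_int e * \<kappa>" "s \<noteq> t" "\<kappa> \<in> {h, - h}"
  shows "(1 + of_int e * P (Inl (Suc s)) (Inl (Suc t))) *
      (prod_list (map (Q \<kappa> s) ls) * prod_list (map (Q \<kappa> t) ls))
    = (prod_list (map (Q \<kappa> t) ls) * prod_list (map (Q \<kappa> s) ls)) *
      (1 + of_int e * P (Inl (Suc s)) (Inl (Suc t)))"
  unfolding Q_def P_def
  by (rule fused_row) (use assms central in \<open>auto simp: e_square inj_def intro: central_ops\<close>)

lemma column_fusion:
  assumes "distinct ks" "\<And>k. x k - y t = x k - y s + of_int f * \<kappa>" "s \<noteq> t" "\<kappa> \<in> {h, - h}"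
  shows "(1 + of_int f * P (Inr (Suc s)) (Inr (Suc t))) *
      (prod_list (map (\<lambda>k. Q \<kappa> k s) ks) * prod_list (map (\<lambda>k. Q \<kappa> k t) ks))
    = (prod_list (map (\<lambda>k. Q \<kappa> k t) ks) * prod_list (map (\<lambda>k. Q \<kappa> k s) ks)) *
      (1 + of_int f * P (Inr (Suc s)) (Inr (Suc t)))"
  unfolding Q_def P_def transpose_commute[of "Inl _" "Inr _"]
  by (rule fused_row) (use assms central in \<open>auto simp: f_square inj_def intro: central_ops\<close>)

text \<open>
For the first group of factors \<open>R\<close> is read by rows, for the second one by columns.
\<close>

lemma fused_R: "fused n m (R n m)"
  unfolding fused_def
proof (intro conjI allI impI)
  fix k assume k: "Suc k < n"
  show "W n m * R n m * p1 k = of_int e * (W n m * R n m)"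
    unfolding R_def
  proof (rule fusion_prod_list(1)[OF two_cancel e_square p_square(1) W_p(1)[OF k] _ k])
    show "(1 + of_int e * p1 k) * (prod_list (map (Q h k) (rev [0..<m])) * prod_list
        (map (Q h (Suc k)) (rev [0..<m])))
      = (prod_list (map (Q h (Suc k)) (rev [0..<m])) * prod_list (map (Q h k) (rev [0..<m]))) *
          (1 + of_int e * p1 k)"
      unfolding p1_def by (rule row_fusion) (simp_all add: shift)
  qed (simp_all add: p1_def P_row_commute(1))
next
  fix l assume l: "Suc l < m"
  have col: "R n m = prod_list (map (\<lambda>l. prod_list (map (\<lambda>k. Q h k l) [0..<n])) (rev [0..<m]))"
    unfolding R_def by (rule prod_list_swap) (auto intro!: Q_Q_commute)
  show "W n m * R n m * p2 l = of_int f * (W n m * R n m)"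
    unfolding col
  proof (rule fusion_prod_list(2)[OF two_cancel f_square p_square(2) W_p(2)[OF l] _ l])
    show "(1 + of_int f * p2 l) * (prod_list (map (\<lambda>k. Q h k (Suc l)) [0..<n]) * prod_list
        (map (\<lambda>k. Q h k l) [0..<n]))
      = (prod_list (map (\<lambda>k. Q h k l) [0..<n]) * prod_list (map (\<lambda>k. Q h k (Suc l)) [0..<n])) *
          (1 + of_int f * p2 l)"
      unfolding p2_def P_def transpose_commute[of "Inr (Suc l)"] unfolding P_def[symmetric]
      by (rule column_fusion) (simp_all add: shift)
  qed (simp_all add: p2_def P_row_commute(2))
qed

lemma fused_R': "fused n m (R' n m)"
  unfolding fused_def
proof (intro conjI allI impI)
  fix k assume k: "Suc k < n"
  show "W n m * R' n m * p1 k = of_int e * (W n m * R' n m)"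
    unfolding R'_def
  proof (rule fusion_prod_list(2)[OF two_cancel e_square p_square(1) W_p(1)[OF k] _ k])
    show "(1 + of_int e * p1 k) * (prod_list (map (Q (- h) (Suc k)) [0..<m]) * prod_list
        (map (Q (- h) k) [0..<m]))
      = (prod_list (map (Q (- h) k) [0..<m]) * prod_list (map (Q (- h) (Suc k)) [0..<m])) *
          (1 + of_int e * p1 k)"
      unfolding p1_def P_def transpose_commute[of "Inl (Suc k)"] unfolding P_def[symmetric]
      by (rule row_fusion) (simp_all add: shift)
  qed (simp_all add: p1_def P_row_commute(1))
next
  fix l assume l: "Suc l < m"
  have col: "R' n m = prod_list (map (\<lambda>l. prod_list (map (\<lambda>k. Q (- h) k l) (rev [0..<n]))) [0..<m])"
    unfolding R'_def by (rule prod_list_swap) (auto intro!: Q_Q_commute)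
  show "W n m * R' n m * p2 l = of_int f * (W n m * R' n m)"
    unfolding col
  proof (rule fusion_prod_list(1)[OF two_cancel f_square p_square(2) W_p(2)[OF l] _ l])
    show "(1 + of_int f * p2 l) * (prod_list (map (\<lambda>k. Q (- h) k l) (rev [0..<n])) * prod_list
        (map (\<lambda>k. Q (- h) k (Suc l)) (rev [0..<n])))
      = (prod_list (map (\<lambda>k. Q (- h) k (Suc l)) (rev [0..<n])) * prod_list
          (map (\<lambda>k. Q (- h) k l) (rev [0..<n]))) * (1 + of_int f * p2 l)"
      unfolding p2_def by (rule column_fusion) (simp_all add: shift)
  qed (simp_all add: p2_def P_row_commute(2))
qed

text \<open>
The fused relation for neighbouring factors of \<open>A\<close> or \<open>B\<close> is formally an RLL relation whose
R-matrix is \<open>1 + g P\<close>.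
\<close>

lemma site_fusion:
  fixes c c' :: "'n \<Rightarrow> 'n \<Rightarrow> 'r"
  assumes "s \<noteq> t" "\<And>i j i' j'. c i j * c' i' j' + of_int g * (c i' j * c' i j')
      = c' i' j' * c i j + of_int g * (c' i' j * c i j')"
  shows "(1 + of_int g * P s t) * (site_op s c * site_op t c')
      = (site_op t c' * site_op s c) * (1 + of_int g * P s t)"
proof -
  have "(scal 1 - scal (of_int (- g)) * perm (transpose s t)) * (site_op s c * site_op t c')
    = (site_op t c' * site_op s c) * (scal 1 - scal (of_int (- g)) * perm (transpose s t))"
  proof (rule site_op_RLL[OF assms(1)])
    fix i j i' j'
    show "1 * (c i j * c' i' j') - of_int (- g) * (c i' j * c' i j')
      = 1 * (c' i' j' * c i j) - of_int (- g) * (c' i' j * c i j')"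
      using assms(2)[of i j i' j'] by simp
  qed (simp_all add: central_ops)
  moreover have "scal 1 - scal (of_int (- g)) * perm (transpose s t) = 1 + of_int g * P s t"
    by (simp add: P_def scal_simps of_int_tensor_op)
  ultimately show ?thesis by simp
qed

lemma fused_BA: "fused n m (B m * A n)"
  unfolding fused_def
proof (intro conjI allI impI)
  fix k assume k: "Suc k < n"
  have pB: "p1 k * B m = B m * p1 k"
    unfolding B_def by (rule prod_list_commute) (simp add: LB_def p1_def P_def perm_transpose_site_op)
  have "W n m * B m * p1 k = W n m * p1 k * B m" by (simp add: pB mult.assoc)
  then have WB: "W n m * B m * p1 k = of_int e * (W n m * B m)"
    by (simp only: W_p(1)[OF k] mult.assoc)
  have "W n m * B m * A n * p1 k = of_int e * (W n m * B m * A n)"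
    unfolding A_def
  proof (rule fusion_prod_list(1)[OF two_cancel e_square p_square(1) WB _ k])
    show "(1 + of_int e * p1 k) * (LA k * LA (Suc k)) = (LA (Suc k) * LA k) * (1 + of_int e * p1 k)"
      unfolding LA_def p1_def by (rule site_fusion) (simp_all add: fusion_a)
  qed (simp_all add: LA_def p1_def P_def perm_transpose_site_op)
  then show "W n m * (B m * A n) * p1 k = of_int e * (W n m * (B m * A n))"
    by (simp add: mult.assoc)
next
  fix l assume l: "Suc l < m"
  have pA: "p2 l * A n = A n * p2 l"
    unfolding A_def by (rule prod_list_commute) (simp add: LA_def p2_def P_def perm_transpose_site_op)
  have "W n m * B m * p2 l = of_int f * (W n m * B m)"
    unfolding B_def
  proof (rule fusion_prod_list(1)[OF two_cancel f_square p_square(2) W_p(2)[OF l] _ l])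
    show "(1 + of_int f * p2 l) * (LB l * LB (Suc l)) = (LB (Suc l) * LB l) * (1 + of_int f * p2 l)"
      unfolding LB_def p2_def by (rule site_fusion) (simp_all add: fusion_b)
  qed (simp_all add: LB_def p2_def P_def perm_transpose_site_op)
  moreover have "W n m * (B m * A n) * p2 l = W n m * B m * p2 l * A n"
    by (simp add: pA mult.assoc)
  ultimately show "W n m * (B m * A n) * p2 l = of_int f * (W n m * (B m * A n))"
    by (simp only: mult.assoc)
qed

end

definition conf_sites :: "nat \<Rightarrow> nat \<Rightarrow> (nat + nat) set" where
  "conf_sites n m = Inl ` {1..n} \<union> Inr ` {1..m}"

lemma conf_sites_simps [simp]:
  "Inl k \<in> conf_sites n m \<longleftrightarrow> k \<in> {1..n}" "Inr l \<in> conf_sites n m \<longleftrightarrow> l \<in> {1..m}"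
  by (auto simp: conf_sites_def)

text \<open>
Basis configurations of \<open>n + m\<close> factors. Sites outside carry the value \<open>undefined\<close>, which matches
the extensional functions in \<open>tidx\<close>.
\<close>

definition confs :: "nat \<Rightarrow> nat \<Rightarrow> (nat + nat \<Rightarrow> 'n) set" where
  "confs n m = {z. \<forall>s. s \<notin> conf_sites n m \<longrightarrow> z s = undefined}"

lemma confs_permute:
  assumes "\<sigma> permutes conf_sites n m"
  shows "bij_betw (\<lambda>z. z \<circ> \<sigma>) (confs n m) (confs n m)"
proof (rule bij_betw_byWitness[where f' = "\<lambda>z. z \<circ> inv \<sigma>"])
  show "\<forall>z\<in>confs n m. (z \<circ> \<sigma>) \<circ> inv \<sigma> = z" "\<forall>z\<in>confs n m. (z \<circ> inv \<sigma>) \<circ> \<sigma> = z"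
    using permutes_inv_o[OF assms] by (simp_all add: comp_assoc)
  show "(\<lambda>z. z \<circ> \<sigma>) ` confs n m \<subseteq> confs n m" "(\<lambda>z. z \<circ> inv \<sigma>) ` confs n m \<subseteq> confs n m"
    using permutes_not_in[OF assms] permutes_not_in[OF permutes_inv[OF assms]]
    by (auto simp: confs_def)
qed

lemma sum_confs:
  "(\<Sum>z\<in>confs n m. g z) = (\<Sum>x\<in>tidx n. \<Sum>y\<in>tidx m. g (case_sum x y))"
proof -
  have "bij_betw (\<lambda>(x, y). case_sum x y) (tidx n \<times> tidx m) (confs n m)"
  proof (rule bij_betw_byWitness[where f' = "\<lambda>z. (z \<circ> Inl, z \<circ> Inr)"])
    show "(\<lambda>(x, y). case_sum x y) ` (tidx n \<times> tidx m) \<subseteq> confs n m"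
      by (auto simp: confs_def tidx_def PiE_def extensional_def split: sum.splits)
    show "(\<lambda>z. (z \<circ> Inl, z \<circ> Inr)) ` confs n m \<subseteq> tidx n \<times> tidx m"
      by (auto simp: confs_def tidx_def PiE_def extensional_def)
    show "\<forall>z\<in>confs n m. (case (z \<circ> Inl, z \<circ> Inr) of (x, y) \<Rightarrow> case_sum x y) = z"
      by (auto simp: fun_eq_iff split: sum.splits)
  qed (auto simp: fun_eq_iff)
  then have "(\<Sum>z\<in>confs n m. g z) = (\<Sum>p\<in>tidx n \<times> tidx m. g (case p of (x, y) \<Rightarrow> case_sum x y))"
    by (rule sum.reindex_bij_betw[symmetric])
  then show ?thesis by (simp add: sum.cartesian_product case_prod_unfold)
qed

lemma map_sum_permutes:
  assumes "\<sigma> permutes {1..n}" "\<tau> permutes {1..m}"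
  shows "map_sum \<sigma> \<tau> permutes conf_sites n m"
proof (rule bij_imp_permutes)
  have "bij_betw (map_sum \<sigma> \<tau>) (Inl ` {1..n} \<union> Inr ` {1..m}) (Inl ` {1..n} \<union> Inr ` {1..m})"
    unfolding bij_betw_def
  proof
    have "inj (map_sum \<sigma> \<tau>)"
      using permutes_inj[OF assms(1)] permutes_inj[OF assms(2)] by (rule sum.inj_map)
    then show "inj_on (map_sum \<sigma> \<tau>) (Inl ` {1..n} \<union> Inr ` {1..m})" by (rule inj_on_subset) simp
    show "map_sum \<sigma> \<tau> ` (Inl ` {1..n} \<union> Inr ` {1..m}) = Inl ` {1..n} \<union> Inr ` {1..m}"
      using permutes_image[OF assms(1)] permutes_image[OF assms(2)]
      by (metis (no_types, lifting) image_Un image_cong image_image map_sum.simps)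
  qed
  then show "bij_betw (map_sum \<sigma> \<tau>) (conf_sites n m) (conf_sites n m)"
    by (simp add: conf_sites_def)
next
  fix s assume "s \<notin> conf_sites n m"
  then show "map_sum \<sigma> \<tau> s = s"
    using permutes_not_in[OF assms(1)] permutes_not_in[OF assms(2)]
    by (cases s) auto
qed

lemma cyclic_perm_confs:
  "\<sigma> permutes conf_sites n m \<Longrightarrow> cyclic (confs n m) (perm \<sigma>)"
  by (intro cyclic_perm confs_permute permutes_bij)

context evaluated_RLL
begin

lemma W_expand:
  "W n m = (\<Sum>\<sigma> | \<sigma> permutes {1..n}. \<Sum>\<tau> | \<tau> permutes {1..m}.
     scal (of_int (perm_char e \<sigma> * perm_char f \<tau>)) * perm (map_sum \<sigma> \<tau>))"
proof -
  have "of_int i * perm (map_sum \<sigma> id) * (of_int j * perm (map_sum id \<tau>))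
      = scal (of_int (i * j)) * (perm (map_sum \<sigma> \<tau>) :: (nat + nat, 'n, 'r) tensor_op)" for i j \<sigma> \<tau>
  proof -
    have "perm (map_sum \<sigma> \<tau>) = (perm (map_sum \<sigma> id) * perm (map_sum id \<tau>) :: (nat + nat, 'n, 'r) tensor_op)"
      by (simp add: map_sum.comp flip: perm_comp)
    moreover have "scal (of_int (i * j)) = (of_int i * of_int j :: (nat + nat, 'n, 'r) tensor_op)"
      by (simp only: of_int_tensor_op of_int_mult scal_simps)
    ultimately show ?thesis
      by (simp only: mult.assoc
          central_left_commute[OF central_of_int[of j], of "perm (map_sum \<sigma> id)"])
  qed
  then show ?thesis
    unfolding W_def perm_representation.total_def[OF perm_left] perm_representation.total_def[OF perm_right]
      sum_product by simp
qed

lemma cyclic_W: "cyclic (confs n m) (W n m)"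
  unfolding W_expand
  by (intro cyclic_sum cyclic_mult cyclic_central central_scal
      central_of_int cyclic_perm_confs map_sum_permutes) auto

lemma cyclic_Q: "k < n \<Longrightarrow> l < m \<Longrightarrow> \<kappa> \<in> {h, - h} \<Longrightarrow> cyclic (confs n m) (Q \<kappa> k l)"
  unfolding Q_def P_def using central_scals
  by (intro cyclic_diff cyclic_mult cyclic_central cyclic_perm_confs permutes_swap_id)
      (auto simp: conf_sites_def)

lemma cyclic_R: "cyclic (confs n m) (R n m)" "cyclic (confs n m) (R' n m)"
  unfolding R_def R'_def by (intro cyclic_prod_list cyclic_Q; simp)+

text \<open>
The computation is the one described at the beginning with \<open>W\<close> in place of the projection \<open>E\<close>.
Every use of \<open>W Z W = M W Z\<close> costs a factor \<open>M = n! m!\<close>, and two of them are needed.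
\<close>

lemma traces_agree:
  "op_trace (confs n m) (W n m * (A n * B m)) = op_trace (confs n m) (W n m * (B m * A n))"
proof -
  let ?t = "op_trace (confs n m) :: (nat + nat, 'n, 'r) tensor_op \<Rightarrow> 'r"
  define w where "w = W n m"
  define r where "r = R n m"
  define r' where "r' = R' n m"
  define ab where "ab = A n * B m"
  define ba where "ba = B m * A n"
  define D :: "(nat + nat, 'n, 'r) tensor_op" where "D = scal (unitarity_factor n m)"
  define M :: nat where "M = fact n * fact m"
  have D: "central D" unfolding D_def by (rule central_scal[OF central_unitarity_factor])
  have M: "central (of_nat M :: (nat + nat, 'n, 'r) tensor_op)" by simp
  have Dc: "Z * (D * Z') = D * (Z * Z')" for Z Z' :: "(nat + nat, 'n, 'r) tensor_op"
      by (rule central_left_commute[OF D])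
  have Mc: "Z * (of_nat M * Z') = of_nat M * (Z * Z')" for Z Z' :: "(nat + nat, 'n, 'r) tensor_op"
      by (rule central_left_commute[OF M])
  have rr': "r * (r' * Z) = D * Z" "r' * (r * Z) = D * Z" for Z
    using R_inverse[of n m] by (simp_all add: r_def r'_def D_def flip: mult.assoc)
  have RLL: "r * ab = ba * r"
    using R_exchange[of n m] by (simp add: r_def ab_def ba_def mult.assoc)
  have wrw: "w * (r * (w * Z)) = of_nat M * (w * (r * Z))" for Z
    using arg_cong[OF fused_absorb[OF fused_R[of n m]], of "\<lambda>V. V * Z"]
    by (simp only: w_def r_def M_def mult.assoc)
  have wr'w: "w * (r' * (w * Z)) = of_nat M * (w * (r' * Z))" for Z
    using arg_cong[OF fused_absorb[OF fused_R'[of n m]], of "\<lambda>V. V * Z"]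
    by (simp only: w_def r'_def M_def mult.assoc)
  have wbaw: "w * (ba * w) = of_nat M * (w * ba)"
    using fused_absorb[OF fused_BA[of n m]] by (simp only: w_def ba_def M_def mult.assoc)
  have ww: "w * (w * Z) = of_nat M * (w * Z)" for Z
    using arg_cong[OF fused_absorb[OF fused_one[of n m]], of "\<lambda>V. V * Z"]
    by (simp only: w_def M_def mult.assoc mult_1)
  have cyc: "?t (w * Z) = ?t (Z * w)" "?t (r * Z) = ?t (Z * r)" for Z
    unfolding w_def r_def by (rule cyclicD[OF cyclic_W], rule cyclicD[OF cyclic_R(1)])
  have "?t (of_nat M * (of_nat M * (D * (w * ab)))) = ?t (of_nat M * (of_nat M * (w * (r' * (r * ab)))))"
    by (simp only: rr' Dc)
  also have "\<dots> = ?t (of_nat M * (of_nat M * (w * (r' * ba))) * r)"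
    by (simp only: RLL mult.assoc)
  also have "\<dots> = ?t (r * (of_nat M * (of_nat M * (w * (r' * ba)))))" by (rule cyc(2)[symmetric])
  also have "\<dots> = ?t (r * (w * (r' * (of_nat M * (w * ba)))))"
    by (simp only: Mc[of w] Mc[of r'] wr'w)
  also have "\<dots> = ?t (r * (w * (r' * (w * ba))) * w)"
    by (simp only: wbaw[symmetric] mult.assoc)
  also have "\<dots> = ?t (w * (r * (w * (r' * (w * ba)))))" by (rule cyc(1)[symmetric])
  also have "\<dots> = ?t (of_nat M * (of_nat M * (D * (w * ba))))"
    by (simp only: wrw rr' Dc[of w] ww Mc[of D])
  finally have "?t (of_nat M * (of_nat M * (D * (w * ab)))) = ?t (of_nat M * (of_nat M * (D * (w * ba))))" .
  then have "of_nat M * (of_nat M * (unitarity_factor n m * (?t (w * ab) - ?t (w * ba)))) = 0"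
    by (simp add: D_def of_nat_tensor_op op_trace_simps right_diff_distrib)
  moreover have "M > 0" by (simp add: M_def)
  ultimately have "?t (w * ab) - ?t (w * ba) = 0"
    using cancel_nat unitarity_factor_cancel by blast
  then show ?thesis by (simp add: w_def ab_def ba_def)
qed

lemma op_trace_W:
  "op_trace (confs n m) (W n m * Z) = (\<Sum>x\<in>tidx n. \<Sum>y\<in>tidx m. \<Sum>\<sigma> | \<sigma> permutes {1..n}. \<Sum>\<tau> | \<tau> permutes {1..m}.
     of_int (perm_char e \<sigma> * perm_char f \<tau>) * apply_op Z (delta (case_sum x y)) (case_sum (x \<circ> \<sigma>) (y \<circ> \<tau>)))"
proof -
  have *: "apply_op (\<Sum>i\<in>I. V i) g z = (\<Sum>i\<in>I. apply_op (V i) g z)"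
    for I and V :: "'i \<Rightarrow> (nat + nat, 'n, 'r) tensor_op" and g z
    by (induction I rule: infinite_finite_induct) simp_all
  have c: "case_sum x y \<circ> map_sum \<sigma> \<tau> = case_sum (x \<circ> \<sigma>) (y \<circ> \<tau>)" for x y :: "nat \<Rightarrow> 'n" and \<sigma> \<tau>
    by (auto simp: fun_eq_iff split: sum.splits)
  show ?thesis
    unfolding op_trace_def sum_confs W_expand sum_distrib_right *
    by (simp only: times_tensor_op.rep_eq scal.rep_eq perm.rep_eq c)
qed

lemma apply_prod_sites:
  fixes v w :: "nat \<Rightarrow> 'n"
  assumes "distinct ks" "set ks = Inl ` {0..<n} \<union> Inr ` {0..<m}" "\<sigma> permutes {1..n}" "\<tau> permutes {1..m}"
  shows "apply_op (prod_list (map (case_sum LA LB) ks)) (delta (case_sum v w)) (case_sum (v \<circ> \<sigma>) (w \<circ> \<tau>))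
    = prod_list (map (case_sum (\<lambda>k. a k (v (\<sigma> (Suc k))) (v (Suc k)))
        (\<lambda>l. b l (w (\<tau> (Suc l))) (w (Suc l)))) ks)"
proof -
  have ops: "case_sum LA LB = (\<lambda>k. site_op (map_sum Suc Suc k) (case_sum a b k))"
    by (auto simp: fun_eq_iff LA_def LB_def split: sum.splits)
  have "inj (map_sum Suc Suc)" by (rule sum.inj_map) simp_all
  have agree: "case_sum (v \<circ> \<sigma>) (w \<circ> \<tau>) t = case_sum v w t" if "t \<notin> map_sum Suc Suc ` set ks" for t
  proof (cases t)
    case (Inl k)
    have "k \<notin> {1..n}"
    proof
      assume "k \<in> {1..n}"
      then have "t = map_sum Suc Suc (Inl (k - 1))" "Inl (k - 1) \<in> set ks"
        using Inl assms(2) by auto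
      then show False using that by blast
    qed
    then show ?thesis using Inl permutes_not_in[OF assms(3)] by simp
  next
    case (Inr k)
    have "k \<notin> {1..m}"
    proof
      assume "k \<in> {1..m}"
      then have "t = map_sum Suc Suc (Inr (k - 1))" "Inr (k - 1) \<in> set ks"
        using Inr assms(2) by auto
      then show False using that by blast
    qed
    then show ?thesis using Inr permutes_not_in[OF assms(4)] by simp
  qed
  have mp: "map (\<lambda>k. case_sum a b k (case_sum (v \<circ> \<sigma>) (w \<circ> \<tau>) (map_sum Suc Suc k))
      (case_sum v w (map_sum Suc Suc k))) ks
     = map (case_sum (\<lambda>k. a k (v (\<sigma> (Suc k))) (v (Suc k))) (\<lambda>l. b l (w (\<tau> (Suc l))) (w (Suc l)))) ks"
    by (auto split: sum.splits)
  show ?thesis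
    unfolding ops apply_site_op_prod[OF assms(1) \<open>inj (map_sum Suc Suc)\<close>] mp
    by (rule if_P) (use agree in blast)
qed

theorem perm_traces_commute: "perm_trace e a n * perm_trace f b m = perm_trace f b m * perm_trace e a n"
proof -
  let ?a = "\<lambda>x \<sigma>. prod_list (map (\<lambda>k. a k (x (\<sigma> (Suc k))) (x (Suc k))) [0..<n])"
  let ?b = "\<lambda>y \<tau>. prod_list (map (\<lambda>l. b l (y (\<tau> (Suc l))) (y (Suc l))) [0..<m])"
  let ?K = "map Inl [0..<n]" and ?L = "map Inr [0..<m]"
  have AB: "A n * B m = prod_list (map (case_sum LA LB) (?K @ ?L))"
    and BA: "B m * A n = prod_list (map (case_sum LA LB) (?L @ ?K))"
    by (simp_all add: A_def B_def comp_def)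
  have K: "distinct (?K @ ?L)" "set (?K @ ?L) = Inl ` {0..<n} \<union> Inr ` {0..<m}"
    "distinct (?L @ ?K)" "set (?L @ ?K) = Inl ` {0..<n} \<union> Inr ` {0..<m}"
    by (auto simp: distinct_map)
  have app: "apply_op (A n * B m) (delta (case_sum x y)) (case_sum (x \<circ> \<sigma>) (y \<circ> \<tau>)) = ?a x \<sigma> * ?b y \<tau>"
    "apply_op (B m * A n) (delta (case_sum x y)) (case_sum (x \<circ> \<sigma>) (y \<circ> \<tau>)) = ?b y \<tau> * ?a x \<sigma>"
    if "\<sigma> \<in> {\<sigma>. \<sigma> permutes {1..n}}" "\<tau> \<in> {\<tau>. \<tau> permutes {1..m}}" for x y \<sigma> \<tau>
    unfolding AB BA using that
    by (subst apply_prod_sites[OF K(1,2)] apply_prod_sites[OF K(3,4)]; simp add: comp_def)+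
  have i: "of_int (i * j) * (u * v) = of_int i * u * (of_int j * v)"
    "of_int (i * j) * (v * u) = of_int j * v * (of_int i * u)" for i j and u v :: 'r
  proof -
    show "of_int (i * j) * (u * v) = of_int i * u * (of_int j * v)" for i j and u v :: 'r
      by (simp only: of_int_mult mult.assoc central_left_commute[OF central_of_int[of j], of u v])
    from this[of j i v u] show "of_int (i * j) * (v * u) = of_int j * v * (of_int i * u)"
      by (simp only: mult.commute[of i j])
  qed
  have "perm_trace e a n * perm_trace f b m = (\<Sum>x\<in>tidx n. \<Sum>y\<in>tidx m. \<Sum>\<sigma> | \<sigma> permutes {1..n}. \<Sum>\<tau> | \<tau> permutes {1..m}.
     of_int (perm_char e \<sigma> * perm_char f \<tau>) * (?a x \<sigma> * ?b y \<tau>))"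
    unfolding perm_trace_def sum_product i(1) ..
  also have "\<dots> = op_trace (confs n m) (W n m * (A n * B m))"
    unfolding op_trace_W by (intro sum.cong refl) (simp only: app)
  also have "\<dots> = op_trace (confs n m) (W n m * (B m * A n))" by (rule traces_agree)
  also have "\<dots> = (\<Sum>x\<in>tidx n. \<Sum>y\<in>tidx m. \<Sum>\<sigma> | \<sigma> permutes {1..n}. \<Sum>\<tau> | \<tau> permutes {1..m}.
     of_int (perm_char e \<sigma> * perm_char f \<tau>) * (?b y \<tau> * ?a x \<sigma>))"
    unfolding op_trace_W by (intro sum.cong refl) (simp only: app)
  also have "\<dots> = perm_trace f b m * perm_trace e a n"
    unfolding i(2) perm_trace_def sum_product
    by (subst sum.swap, rule sum.cong[OF refl], rule sum.cong[OF refl], rule sum.swap)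
  finally show ?thesis .
qed

end

section \<open>Shifts of the spectral parameter\<close>

text \<open>
The coefficients of \<open>(z + c h)\<^sup>r\<^sup>+\<^sup>1 = z (z + c h)\<^sup>r + c h (z + c h)\<^sup>r\<close>: Pascal's rule.
\<close>

lemma shifted_power_Suc:
  "shifted_power c (r + 1) m = shifted_power c r (m - 1) + fps_const c * fps_X * shifted_power c r m"
proof -
  consider "m \<le> r" | "m = r + 1" | "m > r + 1" by linarith
  then show ?thesis
  proof cases
    case 1
    define k where "k = nat (r - m)"
    have k: "nat (r + 1 - m) = Suc k" "nat (r - (m - 1)) = Suc k" "nat (r - m) = k"
      using 1 by (auto simp: k_def)
    have "(of_int r + 1 gchoose Suc k) = (of_int r gchoose k) + ((of_int r :: complex) gchoose Suc k)"
      by (rule gbinomial_Suc_Suc)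
    then have *: "(of_int (r + 1) gchoose Suc k) * c ^ Suc k
      = (of_int r gchoose Suc k) * c ^ Suc k + c * ((of_int r gchoose k) * c ^ k)"
      by (simp add: algebra_simps)
    have "shifted_power c (r + 1) m = fps_const ((of_int (r + 1) gchoose Suc k) * c ^ Suc k)
        * fps_X ^ Suc k"
      using 1 by (simp only: shifted_power_def k) simp
    also have "\<dots> = fps_const ((of_int r gchoose Suc k) * c ^ Suc k) * fps_X ^ Suc k
        + fps_const c * fps_X * (fps_const ((of_int r gchoose k) * c ^ k) * fps_X ^ k)"
      unfolding * fps_const_add[symmetric] fps_const_mult[symmetric, of c]
      by (simp only: power_Suc distrib_left distrib_right mult.assoc mult.left_commute mult.commute)
    also have "\<dots> = shifted_power c r (m - 1) + fps_const c * fps_X * shifted_power c r m"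
      using 1 by (simp only: shifted_power_def k) simp
    finally show ?thesis .
  qed (simp_all add: shifted_power_def)
qed

lemma sum_int_telescope:
  "(\<Sum>a\<in>{q..p}. f (a - 1) - f a) = (if q \<le> p then f (q - 1) - f p else 0)"
  for f :: "int \<Rightarrow> 'a::ab_group_add" and p :: int
proof (cases "q \<le> p")
  case True
  then show ?thesis
  proof (induction rule: int_ge_induct)
    case base
    then show ?case by simp
  next
    case (step p)
    then have "{q..p + 1} = insert (p + 1) {q..p}" by auto
    with step show ?case by simp
  qed
qed simp

text \<open>
The relations of \<open>Y(R)\<close> in a ring \<open>'q\<close> in which all generators of large degree vanish, as they do
modulo \<open>I_ideal p\<close>. Here \<open>l i j r\<close> is the coefficient of \<open>u\<^sup>r\<close> in \<open>\<lambda>\<^sub>i\<^sub>j(u)\<close> and \<open>\<kappa>\<close> is the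
structure map of the algebra.
\<close>

locale truncated_RLL =
  fixes l :: "'n::finite \<Rightarrow> 'n \<Rightarrow> int \<Rightarrow> 'q::ring_1" and \<kappa> :: "complex fps \<Rightarrow> 'q" and p :: int
  assumes \<kappa>_add: "\<And>z w. \<kappa> (z + w) = \<kappa> z + \<kappa> w" and \<kappa>_mult: "\<And>z w. \<kappa> (z * w) = \<kappa> z * \<kappa> w"
    and \<kappa>_one: "\<kappa> 1 = 1" and \<kappa>_central: "\<And>z. central (\<kappa> z)"
    and l_zero: "\<And>i j r. r > p \<Longrightarrow> l i j r = 0"
    and l_rel: "\<And>i j k m r s.
        (l i j (r - 1) * l k m s - l k m s * l i j (r - 1))
            - (l i j r * l k m (s - 1) - l k m (s - 1) * l i j r)
        = \<kappa> fps_X * (l k j r * l i m s - l k j s * l i m r)"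
begin

lemma \<kappa>_zero: "\<kappa> 0 = 0"
  using \<kappa>_add[of 0 0] by simp

lemma \<kappa>_diff: "\<kappa> (z - w) = \<kappa> z - \<kappa> w"
  using \<kappa>_add[of "z - w" w] by (simp add: algebra_simps)

lemma \<kappa>_minus: "\<kappa> (- z) = - \<kappa> z"
  using \<kappa>_diff[of 0 z] by (simp add: \<kappa>_zero)

lemma \<kappa>_left_commute: "x * (\<kappa> z * y) = \<kappa> z * (x * y)"
  by (rule central_left_commute[OF \<kappa>_central])

text \<open>
The coefficient of \<open>z\<^sup>a\<close> in \<open>f(z + c h)\<close> for a series \<open>f\<close> whose powers of \<open>z\<close> do not exceed \<open>p\<close>.
\<close>

definition shift_coeff :: "complex \<Rightarrow> (int \<Rightarrow> 'q) \<Rightarrow> int \<Rightarrow> 'q" where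
  "shift_coeff c f a = (\<Sum>r\<in>{a..p}. \<kappa> (shifted_power c r a) * f r)"

lemma shift_coeff_zero: "a > p \<Longrightarrow> shift_coeff c f a = 0"
  by (simp add: shift_coeff_def)

lemma shift_coeff_simps:
  "shift_coeff c (\<lambda>r. f r - g r) a = shift_coeff c f a - shift_coeff c g a"
  "shift_coeff c (\<lambda>r. \<kappa> z * f r) a = \<kappa> z * shift_coeff c f a"
  "shift_coeff c (\<lambda>r. x * f r) a = x * shift_coeff c f a"
  "shift_coeff c (\<lambda>r. f r * x) a = shift_coeff c f a * x"
proof -
  have *: "shift_coeff c (\<lambda>r. x * f r) a = x * shift_coeff c f a" for x
    unfolding shift_coeff_def sum_distrib_left by (intro sum.cong refl) (rule \<kappa>_left_commute[symmetric])
  show "shift_coeff c (\<lambda>r. \<kappa> z * f r) a = \<kappa> z * shift_coeff c f a"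
    "shift_coeff c (\<lambda>r. x * f r) a = x * shift_coeff c f a" by (rule *)+
qed (simp_all add: shift_coeff_def right_diff_distrib sum_subtractf sum_distrib_right mult.assoc)

text \<open>
Shifting \<open>z f(z)\<close> gives \<open>(z + c h) f(z + c h)\<close>. The coefficient \<open>f p\<close> has to vanish because
\<open>z f(z)\<close> must again have no powers of \<open>z\<close> beyond \<open>p\<close>.
\<close>

lemma shift_coeff_times_variable:
  assumes "\<And>r. r \<ge> p \<Longrightarrow> f r = 0"
  shows "shift_coeff c (\<lambda>r. f (r - 1)) a = shift_coeff c f (a - 1)
      + \<kappa> (fps_const c * fps_X) * shift_coeff c f a"
proof -
  have "shift_coeff c (\<lambda>r. f (r - 1)) a = (\<Sum>r\<in>{a - 1..p - 1}. \<kappa> (shifted_power c (r + 1) a) * f r)"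
    unfolding shift_coeff_def by (rule sum.reindex_bij_witness[of _ "\<lambda>r. r + 1" "\<lambda>r. r - 1"]) auto
  also have "\<dots> = (\<Sum>r\<in>{a - 1..p}. \<kappa> (shifted_power c (r + 1) a) * f r)"
    by (rule sum.mono_neutral_left) (auto simp: assms)
  also have "\<dots> = shift_coeff c f (a - 1)
      + \<kappa> (fps_const c * fps_X) * (\<Sum>r\<in>{a - 1..p}. \<kappa> (shifted_power c r a) * f r)"
    unfolding shifted_power_Suc \<kappa>_add \<kappa>_mult
    by (simp add: distrib_right sum.distrib sum_distrib_left mult.assoc shift_coeff_def)
  also have "(\<Sum>r\<in>{a - 1..p}. \<kappa> (shifted_power c r a) * f r) = shift_coeff c f a"
    unfolding shift_coeff_def by (rule sum.mono_neutral_right) (auto simp: shifted_power_def \<kappa>_zero)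
  finally show ?thesis .
qed

definition shift2 :: "complex \<Rightarrow> complex \<Rightarrow> (int \<Rightarrow> int \<Rightarrow> 'q) \<Rightarrow> int \<Rightarrow> int \<Rightarrow> 'q" where
  "shift2 c d f a b = shift_coeff c (\<lambda>r. shift_coeff d (f r) b) a"

lemma shift2_zero: "(\<And>r. r \<ge> q \<Longrightarrow> f r = (\<lambda>_. 0)) \<Longrightarrow> a \<ge> q \<Longrightarrow> shift2 c d f a b = 0"
  "(\<And>r s. s \<ge> q \<Longrightarrow> f r s = 0) \<Longrightarrow> b \<ge> q \<Longrightarrow> shift2 c d f a b = 0"
  by (auto simp: shift2_def shift_coeff_def intro!: sum.neutral)

lemma shift2_simps:
  "shift2 c d (\<lambda>r s. f r s - g r s) a b = shift2 c d f a b - shift2 c d g a b"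
  "shift2 c d (\<lambda>r s. \<kappa> z * f r s) a b = \<kappa> z * shift2 c d f a b"
  "shift2 c d (\<lambda>r s. f' r * g' s) a b = shift_coeff c f' a * shift_coeff d g' b"
  "shift2 c d (\<lambda>r s. g' s * f' r) a b = shift_coeff d g' b * shift_coeff c f' a"
  by (simp_all add: shift2_def shift_coeff_simps)

text \<open>
Shifting \<open>(u - v) f(u, v)\<close> gives \<open>(u - v + (c - d) h) f(u + c h, v + d h)\<close>.
\<close>

lemma shift2_difference:
  assumes "\<And>r s. r \<ge> p \<Longrightarrow> f r s = 0" "\<And>r s. s \<ge> p \<Longrightarrow> f r s = 0"
  shows "shift2 c d (\<lambda>r s. f (r - 1) s - f r (s - 1)) a b
    = shift2 c d f (a - 1) b - shift2 c d f a (b - 1) + \<kappa> (fps_const (c - d) * fps_X) * shift2 c d f a b"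
proof -
  have 1: "shift2 c d (\<lambda>r s. f (r - 1) s) a b = shift2 c d f (a - 1) b
      + \<kappa> (fps_const c * fps_X) * shift2 c d f a b"
    unfolding shift2_def by (rule shift_coeff_times_variable) (simp add: shift_coeff_def assms)
  have "shift_coeff d (\<lambda>s. f r (s - 1)) b
      = shift_coeff d (f r) (b - 1) + \<kappa> (fps_const d * fps_X) * shift_coeff d (f r) b" for r
    by (rule shift_coeff_times_variable) (simp add: assms)
  then have "shift2 c d (\<lambda>r s. f r (s - 1)) a b
      = shift_coeff c (\<lambda>r. shift_coeff d (f r) (b - 1)
          - \<kappa> (- (fps_const d * fps_X)) * shift_coeff d (f r) b) a"
    unfolding shift2_def by (simp add: \<kappa>_minus)
  then have 2: "shift2 c d (\<lambda>r s. f r (s - 1)) a b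
      = shift2 c d f a (b - 1) + \<kappa> (fps_const d * fps_X) * shift2 c d f a b"
    by (simp only: shift_coeff_simps shift2_def) (simp add: \<kappa>_minus)
  have cd: "fps_const (c - d) * fps_X = fps_const c * fps_X - fps_const d * fps_X"
    by (simp add: left_diff_distrib flip: fps_const_sub)
  show ?thesis
    unfolding shift2_simps(1) 1 2 cd \<kappa>_diff left_diff_distrib by simp
qed

section \<open>The RLL relation solved for the commutator\<close>

text \<open>
The coefficient of \<open>u\<^sup>av\<^sup>b\<close> in \<open>\<lambda>\<^sub>k\<^sub>j(u) \<lambda>\<^sub>i\<^sub>m(v) - \<lambda>\<^sub>k\<^sub>j(v) \<lambda>\<^sub>i\<^sub>m(u)\<close>, which is antisymmetric in
\<open>u\<close> and \<open>v\<close>.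
\<close>

definition G :: "'n \<Rightarrow> 'n \<Rightarrow> 'n \<Rightarrow> 'n \<Rightarrow> int \<Rightarrow> int \<Rightarrow> 'q" where
  "G i j k m a b = l k j a * l i m b - l k j b * l i m a"

text \<open>
The quotient of \<open>G\<close> by \<open>u - v\<close>. Formally this is the sum of \<open>G t (a + b + 1 - t)\<close> over all
\<open>t > a\<close>. Since \<open>G\<close> is antisymmetric, the terms with \<open>t \<le> b\<close> cancel in pairs, and starting the sum
at the maximum of \<open>a\<close> and \<open>b\<close> makes the quotient vanish for large \<open>b\<close> as well.
\<close>

definition Gquot :: "'n \<Rightarrow> 'n \<Rightarrow> 'n \<Rightarrow> 'n \<Rightarrow> int \<Rightarrow> int \<Rightarrow> 'q" where
  "Gquot i j k m a b = (\<Sum>t\<in>{max a b + 1..p}. G i j k m t (a + b + 1 - t))"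

lemma Gquot_zero: "a \<ge> p \<Longrightarrow> Gquot i j k m a b = 0" "b \<ge> p \<Longrightarrow> Gquot i j k m a b = 0"
  by (simp_all add: Gquot_def)

lemma Gquot_difference: "Gquot i j k m (a - 1) b - Gquot i j k m a (b - 1) = G i j k m a b"
proof -
  let ?g = "\<lambda>t. G i j k m t (a + b - t)"
  have *: "Gquot i j k m (a - 1) b - Gquot i j k m a (b - 1)
     = (\<Sum>t\<in>{max (a - 1) b + 1..p}. ?g t) - (\<Sum>t\<in>{max a (b - 1) + 1..p}. ?g t)"
    by (simp add: Gquot_def algebra_simps)
  \<comment> \<open>If q exceeds p, both sums are empty, and the value on the right vanishes as well.\<close>
  have head: "(\<Sum>t\<in>{q..p}. ?g t) - (\<Sum>t\<in>{q + 1..p}. ?g t) = ?g q" for q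
  proof (cases "q \<le> p")
    case True
    then have "{q..p} = insert q {q + 1..p}" by auto
    then show ?thesis by simp
  qed (simp add: G_def l_zero)
  consider "a > b" | "a = b" | "a < b" by linarith
  then show ?thesis
  proof cases
    case 1
    then have "max (a - 1) b + 1 = a" "max a (b - 1) + 1 = a + 1" by auto
    then show ?thesis unfolding * using head[of a] by simp
  next
    case 2
    then show ?thesis unfolding * by (simp add: G_def)
  next
    case 3
    then have "max (a - 1) b + 1 = b + 1" "max a (b - 1) + 1 = b" by auto
    then show ?thesis unfolding * using head[of b] by (simp add: G_def algebra_simps)
  qed
qed

text \<open>
Both sides have the same product with \<open>u - v\<close>, and a series \<open>f\<close> with \<open>(u - v) f = 0\<close> is constant
along the lines \<open>a + b = const\<close>. It vanishes because it does so for large \<open>a\<close>.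
\<close>

lemma commutator_Gquot: "l i j a * l k m b - l k m b * l i j a = \<kappa> fps_X * Gquot i j k m a b"
proof -
  define f where "f a b = l i j a * l k m b - l k m b * l i j a - \<kappa> fps_X * Gquot i j k m a b" for a b
  have step: "f (a - 1) b = f a (b - 1)" for a b
    using l_rel[of i j a k m b] Gquot_difference[of i j k m a b, symmetric]
    by (simp add: f_def G_def[symmetric] right_diff_distrib algebra_simps)
  have "f (p + 1 - int q) b = 0" for q b
  proof (induction q arbitrary: b)
    case 0
    show ?case by (simp add: f_def l_zero Gquot_zero)
  next
    case (Suc q)
    show ?case using step[of "p + 1 - int q" b] Suc by (simp add: algebra_simps)
  qed
  from this[of "nat (p + 1 - a)" b] have "f a b = 0"
    by (cases "a \<le> p") (simp_all add: f_def l_zero Gquot_zero)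
  then show ?thesis by (simp add: f_def)
qed

text \<open>
The coefficients of \<open>\<lambda>\<^sub>i\<^sub>j(z + c h)\<close>.
\<close>

definition t :: "complex \<Rightarrow> 'n \<Rightarrow> 'n \<Rightarrow> int \<Rightarrow> 'q" where
  "t c i j = shift_coeff c (l i j)"

abbreviation Gshift :: "complex \<Rightarrow> complex \<Rightarrow> 'n \<Rightarrow> 'n \<Rightarrow> 'n \<Rightarrow> 'n \<Rightarrow> int \<Rightarrow> int \<Rightarrow> 'q" where
  "Gshift c d i j k m \<equiv> shift2 c d (Gquot i j k m)"

lemma t_zero: "a > p \<Longrightarrow> t c i j a = 0"
  by (simp add: t_def shift_coeff_zero)

lemma Gshift_zero: "a \<ge> p \<Longrightarrow> Gshift c d i j k m a b = 0" "b \<ge> p \<Longrightarrow> Gshift c d i j k m a b = 0"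
  by (rule shift2_zero; simp add: Gquot_zero fun_eq_iff)+

lemma t_commutator:
  "t c i j a * t d k m b - t d k m b * t c i j a = \<kappa> fps_X * Gshift c d i j k m a b"
proof -
  have "shift2 c d (\<lambda>r s. l i j r * l k m s - l k m s * l i j r) a b
      = shift2 c d (\<lambda>r s. \<kappa> fps_X * Gquot i j k m r s) a b"
    by (simp only: commutator_Gquot)
  then show ?thesis by (simp only: shift2_simps t_def)
qed

text \<open>
This is \<open>G\<close> with both variables shifted; the right-hand side is \<open>u - v + (c - d) h\<close> times the
shifted quotient.
\<close>

lemma t_exchange:
  "t c k j a * t d i m b - t d k j b * t c i m a
    = Gshift c d i j k m (a - 1) b - Gshift c d i j k m a (b - 1)
      + \<kappa> (fps_const (c - d) * fps_X) * Gshift c d i j k m a b"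
proof -
  have "shift2 c d (G i j k m) a b = t c k j a * t d i m b - t d k j b * t c i m a"
    unfolding G_def by (simp only: shift2_simps t_def)
  then show ?thesis
    using shift2_difference[of "Gquot i j k m" c d a b] by (simp add: Gquot_difference Gquot_zero)
qed

lemma t_RLL:
  fixes i j k m :: 'n and c d :: complex
  defines "C \<equiv> \<lambda>a b. t c i j a * t d k m b - t d k m b * t c i j a"
  shows "C (a - 1) b - C a (b - 1) + \<kappa> (fps_const (c - d) * fps_X) * C a b
    = \<kappa> fps_X * (t c k j a * t d i m b - t d k j b * t c i m a)"
  unfolding C_def t_commutator t_exchange
  by (simp only: distrib_left right_diff_distrib \<kappa>_left_commute[of "\<kappa> (fps_const (c - d) * fps_X)"])

text \<open>
Setting \<open>u = v\<close> turns a double series into the sums of its coefficients over the lines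
\<open>a + b = n\<close>. The multiple of \<open>u - v\<close> in the exchange relation then telescopes to zero, and what
remains is \<open>-e h\<close> times the sum that occurs with factor \<open>h\<close> in the commutator.
\<close>

lemma t_fusion:
  assumes e: "e = 1 \<or> e = - 1"
  shows "(\<Sum>a\<in>{n - p..p}. t c i j a * t (c + e) k m (n - a))
      + \<kappa> (fps_const e) * (\<Sum>a\<in>{n - p..p}. t c k j a * t (c + e) i m (n - a))
    = (\<Sum>a\<in>{n - p..p}. t (c + e) k m (n - a) * t c i j a)
        + \<kappa> (fps_const e) * (\<Sum>a\<in>{n - p..p}. t (c + e) k j (n - a) * t c i m a)"
proof -
  let ?g = "Gshift c (c + e) i j k m"
  let ?S = "\<Sum>a\<in>{n - p..p}. ?g a (n - a)"
  have 1: "(\<Sum>a\<in>{n - p..p}. t c i j a * t (c + e) k m (n - a))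
      - (\<Sum>a\<in>{n - p..p}. t (c + e) k m (n - a) * t c i j a)
      = \<kappa> fps_X * ?S"
    by (simp only: sum_subtractf[symmetric] t_commutator sum_distrib_left)
  have "(\<Sum>a\<in>{n - p..p}. ?g (a - 1) (n - a) - ?g a (n - a - 1)) = 0"
    using sum_int_telescope[of "\<lambda>a. ?g a (n - a - 1)" "n - p"] by (simp add: Gshift_zero)
  then have 2: "(\<Sum>a\<in>{n - p..p}. t c k j a * t (c + e) i m (n - a))
      - (\<Sum>a\<in>{n - p..p}. t (c + e) k j (n - a) * t c i m a)
      = \<kappa> (fps_const (c - (c + e)) * fps_X) * ?S"
    by (simp only: sum_subtractf[symmetric] t_exchange sum.distrib sum_distrib_left) simp
  have ee: "fps_const e * (fps_const (c - (c + e)) * fps_X) = - fps_X"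
    using e by (auto simp: fps_eq_iff)
  have "\<kappa> (fps_const e) * (\<kappa> z * ?S) = \<kappa> (fps_const e * z) * ?S" for z
    by (simp only: \<kappa>_mult mult.assoc)
  from this[of "fps_const (c - (c + e)) * fps_X"]
  have "\<kappa> (fps_const e) * (\<kappa> (fps_const (c - (c + e)) * fps_X) * ?S) = - (\<kappa> fps_X * ?S)"
    unfolding ee \<kappa>_minus by simp
  then have "((\<Sum>a\<in>{n - p..p}. t c i j a * t (c + e) k m (n - a))
      - (\<Sum>a\<in>{n - p..p}. t (c + e) k m (n - a) * t c i j a))
     + \<kappa> (fps_const e) * ((\<Sum>a\<in>{n - p..p}. t c k j a * t (c + e) i m (n - a))
         - (\<Sum>a\<in>{n - p..p}. t (c + e) k j (n - a) * t c i m a)) = 0"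
    unfolding 1 2 by simp
  then show ?thesis by (simp add: right_diff_distrib algebra_simps)
qed

end

section \<open>Laurent series in two variables\<close>

unbundle fps_syntax

lemma perm_trace_hom:
  fixes \<phi> :: "'a::ring_1 \<Rightarrow> 'b::ring_1"
  assumes add: "\<And>x y. \<phi> (x + y) = \<phi> x + \<phi> y" and mult: "\<And>x y. \<phi> (x * y) = \<phi> x * \<phi> y" and one: "\<phi> 1 = 1"
  shows "\<phi> (perm_trace e a n) = perm_trace e (\<lambda>k i j. \<phi> (a k i j)) n"
proof -
  have zero: "\<phi> 0 = 0" using add[of 0 0] by simp
  have minus: "\<phi> (- x) = - \<phi> x" for x using add[of x "- x"] zero
      by (simp add: eq_neg_iff_add_eq_0 add.commute)
  have diff: "\<phi> (x - y) = \<phi> x - \<phi> y" for x y using add[of x "- y"] minus by simp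
  have sum: "\<phi> (sum g I) = (\<Sum>i\<in>I. \<phi> (g i))" for g :: "'i \<Rightarrow> 'a" and I
    by (induction I rule: infinite_finite_induct) (simp_all add: add zero)
  have nat: "\<phi> (of_nat k) = of_nat k" for k by (induction k) (simp_all add: add zero one)
  have int: "\<phi> (of_int k) = of_int k" for k by (cases k) (simp_all add: nat minus diff one)
  have prod: "\<phi> (prod_list (map g ks)) = prod_list (map (\<lambda>k. \<phi> (g k)) ks)" for g :: "'k \<Rightarrow> 'a" and ks
    by (induction ks) (simp_all add: one mult)
  show ?thesis by (simp only: perm_trace_def sum mult int prod)
qed

text \<open>
The variable of a Laurent series stands for \<open>z\<close> inverse, so the coefficient of \<open>z\<^sup>m\<close> has index
\<open>-m\<close>.
\<close>

lemma fls_times_nth_bounded: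
  fixes f g :: "'a::semiring_0 fls"
  assumes "\<And>k. k < - p \<Longrightarrow> f $$ k = 0" "\<And>k. k < - p \<Longrightarrow> g $$ k = 0"
  shows "(f * g) $$ (- m) = (\<Sum>a\<in>{m - p..p}. f $$ (- a) * g $$ (- (m - a)))"
proof -
  define df dg where "df = fls_subdegree f" and "dg = fls_subdegree g"
  have "(f * g) $$ (- m) = (\<Sum>i\<in>{df..- m - dg}. f $$ i * g $$ (- m - i))"
    unfolding df_def dg_def by (rule fls_times_nth(2))
  also have "\<dots> = (\<Sum>i\<in>{min df (- p)..max (- m - dg) (p - m)}. f $$ i * g $$ (- m - i))"
    by (rule sum.mono_neutral_left) (auto simp: df_def dg_def)
  also have "\<dots> = (\<Sum>i\<in>{- p..p - m}. f $$ i * g $$ (- m - i))"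
    by (rule sum.mono_neutral_right) (auto simp: assms)
  also have "\<dots> = (\<Sum>a\<in>{m - p..p}. f $$ (- a) * g $$ (- (m - a)))"
    by (rule sum.reindex_bij_witness[of _ uminus uminus]) auto
  finally show ?thesis .
qed

text \<open>
In \<open>'a fls fls\<close> the inner variable is \<open>u\<close> inverse and the outer one is \<open>v\<close> inverse. Series in \<open>u\<close>
are embedded by \<open>fls_const\<close> and series in \<open>v\<close> by \<open>outer\<close>.
\<close>

definition outer :: "'a::zero fls \<Rightarrow> 'a fls fls" where
  "outer f = Abs_fls (\<lambda>k. fls_const (f $$ k))"

lemma outer_nth [simp]: "outer f $$ k = fls_const (f $$ k)"
  unfolding outer_def
  by (rule nth_Abs_fls_ex_lower_bound) (auto intro!: exI[of _ "fls_subdegree f"])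

lemma fls_const_sum: "fls_const (\<Sum>i\<in>I. g i) = (\<Sum>i\<in>I. fls_const (g i :: 'a::comm_monoid_add))"
  by (induction I rule: infinite_finite_induct) (simp_all flip: fls_plus_const)

lemma outer_hom:
  "outer (f + g) = outer f + outer (g :: 'a::ring_1 fls)"
  "outer (f * g) = outer f * outer g" "outer (1 :: 'a fls) = 1"
proof -
  show "outer (f * g) = outer f * outer g"
  proof (rule fls_eqI)
    fix k
    define p where "p = - min (fls_subdegree f) (fls_subdegree g)"
    have z: "f $$ k = 0" "g $$ k = 0" if "k < - p" for k using that by (auto simp: p_def)
    show "outer (f * g) $$ k = (outer f * outer g) $$ k"
      using fls_times_nth_bounded[of p f g "- k"] fls_times_nth_bounded[of p "outer f" "outer g" "- k"]
      by (simp add: z fls_const_sum)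
  qed
qed (auto intro!: fls_eqI simp: fls_plus_const)

lemma fls_const_hom: "fls_const (f + g) = fls_const f + fls_const (g :: 'a::ring_1)"
  "fls_const (f * g) = fls_const f * fls_const g" "fls_const (1 :: 'a) = 1"
  by (simp_all add: fls_plus_const)

lemma central_fls_const: "central z \<Longrightarrow> central (fls_const z)"
  by (simp add: central_def fls_eq_iff)

lemma central_fls_X_inv: "central (fls_X_inv :: 'a::ring_1 fls)"
  by (simp add: central_def fls_X_inv_times_comm)

text \<open>
The variable \<open>v\<close> raises the pole order of a Laurent series in \<open>v\<close> inverse, while \<open>w\<close> does not, so
the leading coefficient of the product is that of \<open>f\<close> up to sign.
\<close>

lemma fls_linear_cancel:
  fixes f :: "'a::ring_1 fls"
  assumes "(fls_const w - fls_X_inv) * f = 0"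
  shows "f = 0"
proof (rule ccontr)
  assume "f \<noteq> 0"
  have "((fls_const w - fls_X_inv) * f) $$ (fls_subdegree f - 1) = - (f $$ fls_subdegree f)"
    by (simp add: left_diff_distrib fls_X_inv_times_conv_shift)
  with assms \<open>f \<noteq> 0\<close> show False by simp
qed

context truncated_RLL
begin

definition Lam :: "complex \<Rightarrow> 'n \<Rightarrow> 'n \<Rightarrow> 'q fls" where
  "Lam c i j = Abs_fls (\<lambda>k. t c i j (- k))"

lemma Lam_nth [simp]: "Lam c i j $$ k = t c i j (- k)"
  unfolding Lam_def by (rule nth_Abs_fls_ex_lower_bound) (auto intro!: exI[of _ "- p"] t_zero)

lemma \<kappa>_of_nat: "\<kappa> (of_nat k) = of_nat k"
  by (induction k) (simp_all add: \<kappa>_zero \<kappa>_add \<kappa>_one)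

lemma of_nat_cancel:
  assumes "k > 0" "of_nat k * (z :: 'q) = 0"
  shows "z = 0"
proof -
  have "\<kappa> (fps_const (1 / of_nat k)) * of_nat k = 1"
    using assms(1) by (simp flip: \<kappa>_of_nat \<kappa>_mult fps_of_nat add: \<kappa>_one)
  then have "z = \<kappa> (fps_const (1 / of_nat k)) * (of_nat k * z)" by (simp flip: mult.assoc)
  then show ?thesis using assms(2) by simp
qed

lemma \<kappa>_sign: "e = 1 \<or> e = - 1 \<Longrightarrow> \<kappa> (fps_const (of_int e)) = of_int e"
  using \<kappa>_minus[of 1] by (auto simp: \<kappa>_one simp flip: fps_const_neg)

lemma Lam_fusion:
  assumes e: "e = 1 \<or> e = - 1" and d: "d = c + of_int e"
  shows "Lam c i j * Lam d k m + of_int e * (Lam c k j * Lam d i m)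
    = Lam d k m * Lam c i j + of_int e * (Lam d k j * Lam c i m)"
proof (rule fls_eqI)
  fix n
  have z: "Lam c i j $$ k = 0" if "k < - p" for c i j k using that by (simp add: t_zero)
  have 1: "(Lam c i j * Lam d k m) $$ n = (\<Sum>a\<in>{- n - p..p}. t c i j a * t d k m (- n - a))" for c d i j k m
    using fls_times_nth_bounded[of p "Lam c i j" "Lam d k m" "- n", OF z z]
        by (simp add: minus_diff_commute)
  have 2: "(Lam d k m * Lam c i j) $$ n = (\<Sum>a\<in>{- n - p..p}. t d k m (- n - a) * t c i j a)" for c d i j k m
    unfolding 1 by (rule sum.reindex_bij_witness[of _ "\<lambda>a. - n - a" "\<lambda>a. - n - a"]) auto
  have ee: "(of_int e * F) $$ n = of_int e * F $$ n" for F :: "'q fls"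
    by (simp add: fls_of_int)
  have "complex_of_int e = 1 \<or> complex_of_int e = - 1" using e by auto
  from t_fusion[OF this, where n = "- n" and c = c and i = i and j = j and k = k and m = m]
  show "(Lam c i j * Lam d k m + of_int e * (Lam c k j * Lam d i m)) $$ n
    = (Lam d k m * Lam c i j + of_int e * (Lam d k j * Lam c i m)) $$ n"
    unfolding fls_plus_nth ee 1[of c _ _ d] 2[of d _ _ c] unfolding d \<kappa>_sign[OF e] .
qed

text \<open>
The elements \<open>u + c h\<close> and \<open>v + c h\<close>.
\<close>

definition spectral_u :: "complex \<Rightarrow> 'q fls fls" where
  "spectral_u c = fls_const (fls_X_inv + fls_const (\<kappa> (fps_const c * fps_X)))"

definition spectral_v :: "complex \<Rightarrow> 'q fls fls" where
  "spectral_v c = fls_X_inv + fls_const (fls_const (\<kappa> (fps_const c * fps_X)))"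

definition hbar :: "'q fls fls" where
  "hbar = fls_const (fls_const (\<kappa> fps_X))"

lemma spectral_diff:
  "spectral_u c - spectral_v d = fls_const (fls_X_inv + fls_const (\<kappa> (fps_const (c - d) * fps_X)))
      - fls_X_inv"
  by (simp add: spectral_u_def spectral_v_def \<kappa>_diff left_diff_distrib fls_plus_const[symmetric]
      fls_minus_const[symmetric]
      flip: fps_const_sub)

lemma Lam_RLL:
  "(spectral_u c - spectral_v d) *
     (fls_const (Lam c i j) * outer (Lam d k m) - outer (Lam d k m) * fls_const (Lam c i j))
   = hbar * (fls_const (Lam c k j) * outer (Lam d i m) - outer (Lam d k j) * fls_const (Lam c i m))"
proof (intro fls_eqI)
  fix b a
  show "((spectral_u c - spectral_v d) *
     (fls_const (Lam c i j) * outer (Lam d k m) - outer (Lam d k m) * fls_const (Lam c i j))) $$ b $$ a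
   = (hbar * (fls_const (Lam c k j) * outer (Lam d i m) - outer (Lam d k j) * fls_const (Lam c i m)))
       $$ b $$ a"
    using t_RLL[of c i j "- a" d k m "- b"]
    by (simp add: spectral_diff hbar_def left_diff_distrib[of _ _ "_ - _"] distrib_right[of _ _ "_ - _"]
      fls_X_inv_times_conv_shift) (simp only: diff_add_eq)
qed

lemma spectral_Suc:
  assumes "e = 1 \<or> e = - 1"
  shows "spectral_u (of_nat (Suc k) * of_int e) = spectral_u (of_nat k * of_int e) + of_int e * hbar"
    "spectral_v (of_nat (Suc k) * of_int e) = spectral_v (of_nat k * of_int e) + of_int e * hbar"
proof -
  have "fps_const (of_nat (Suc k) * of_int e) * fps_X
      = fps_const (of_nat k * of_int e) * fps_X + fps_const (complex_of_int e) * fps_X"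
    by (simp add: algebra_simps flip: fps_const_add)
  then have "\<kappa> (fps_const (of_nat (Suc k) * of_int e) * fps_X)
      = \<kappa> (fps_const (of_nat k * of_int e) * fps_X) + of_int e * \<kappa> fps_X"
    by (simp only: \<kappa>_add \<kappa>_mult \<kappa>_sign[OF assms])
  then show "spectral_u (of_nat (Suc k) * of_int e) = spectral_u (of_nat k * of_int e) + of_int e * hbar"
    "spectral_v (of_nat (Suc k) * of_int e) = spectral_v (of_nat k * of_int e) + of_int e * hbar"
    by (simp_all only: spectral_u_def spectral_v_def hbar_def fls_of_int fls_const_hom add.assoc)
qed

lemma Lam_evaluated_RLL:
  assumes "e = 1 \<or> e = - 1" "f = 1 \<or> f = - 1"
  shows "evaluated_RLL (\<lambda>k i j. fls_const (Lam (of_nat k * of_int e) i j))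
      (\<lambda>k i j. outer (Lam (of_nat k * of_int f) i j))
    (\<lambda>k. spectral_u (of_nat k * of_int e)) (\<lambda>k. spectral_v (of_nat k * of_int f)) hbar e f"
proof
  show "central (spectral_u (of_nat k * of_int e))" "central (spectral_v (of_nat k * of_int f))"
      "central hbar" for k
    unfolding spectral_u_def spectral_v_def hbar_def
    by (intro central_ops central_fls_const central_fls_X_inv \<kappa>_central)+
  fix k l :: nat and i j i' j' :: 'n
  show "(spectral_u (of_nat k * of_int e) - spectral_v (of_nat l * of_int f)) *
    (fls_const (Lam (of_nat k * of_int e) i j) * outer (Lam (of_nat l * of_int f) i' j') -
      outer (Lam (of_nat l * of_int f) i' j') * fls_const (Lam (of_nat k * of_int e) i j)) =
    hbar * (fls_const (Lam (of_nat k * of_int e) i' j) * outer (Lam (of_nat l * of_int f) i j') -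
      outer (Lam (of_nat l * of_int f) i' j) * fls_const (Lam (of_nat k * of_int e) i j'))"
    by (rule Lam_RLL)
  have S: "of_nat (Suc k) * of_int g = of_nat k * of_int g + complex_of_int g" for g
    by (simp add: algebra_simps)
  show "fls_const (Lam (of_nat k * of_int e) i j) * fls_const (Lam (of_nat (Suc k) * of_int e) i' j') +
      of_int e * (fls_const (Lam (of_nat k * of_int e) i' j) * fls_const
          (Lam (of_nat (Suc k) * of_int e) i j'))
    = fls_const (Lam (of_nat (Suc k) * of_int e) i' j') * fls_const (Lam (of_nat k * of_int e) i j) +
      of_int e * (fls_const (Lam (of_nat (Suc k) * of_int e) i' j) * fls_const
          (Lam (of_nat k * of_int e) i j'))"
    using arg_cong[OF Lam_fusion[OF assms(1) S, of i j i' j'], of fls_const]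
    by (simp only: fls_const_hom fls_of_int[where 'a = "'q fls"] fls_of_int[where 'a = 'q])
  have oi: "outer (of_int f) = of_int f"
    by (rule fls_eqI) (simp add: fls_of_int fls_of_int_nth)
  show "outer (Lam (of_nat k * of_int f) i j) * outer (Lam (of_nat (Suc k) * of_int f) i' j') +
      of_int f * (outer (Lam (of_nat k * of_int f) i' j) * outer (Lam (of_nat (Suc k) * of_int f) i j'))
    = outer (Lam (of_nat (Suc k) * of_int f) i' j') * outer (Lam (of_nat k * of_int f) i j) +
      of_int f * (outer (Lam (of_nat (Suc k) * of_int f) i' j) * outer (Lam (of_nat k * of_int f) i j'))"
    using arg_cong[OF Lam_fusion[OF assms(2) S, of i j i' j'], of outer]
    by (simp only: outer_hom oi)
  show "z = 0" if "0 < k" "of_nat k * z = 0" for k and z :: "'q fls fls"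
    using that of_nat_cancel[of k] by (auto simp: fls_of_nat fls_eq_iff)
  have "spectral_u c - spectral_v d + hbar
      = fls_const (fls_X_inv + fls_const (\<kappa> (fps_const (c - d) * fps_X)) + fls_const (\<kappa> fps_X))
          - fls_X_inv" for c d
    unfolding spectral_diff hbar_def fls_const_hom(1) by (simp add: algebra_simps)
  then show "z = 0" if "(spectral_u (of_nat k * of_int e) - spectral_v (of_nat l * of_int f) + hbar) * z
      = 0" for z
    using that by (metis fls_linear_cancel)
  have "spectral_u c - spectral_v d - hbar
      = fls_const (fls_X_inv + fls_const (\<kappa> (fps_const (c - d) * fps_X)) - fls_const (\<kappa> fps_X))
          - fls_X_inv" for c d
    unfolding spectral_diff hbar_def fls_const_hom(1) fls_minus_const[symmetric]
        by (simp add: algebra_simps)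
  then show "z = 0" if "(spectral_u (of_nat k * of_int e) - spectral_v (of_nat l * of_int f) - hbar) * z
      = 0" for z
    using that by (metis fls_linear_cancel)
qed (use assms spectral_Suc in auto)

theorem perm_trace_coefficients_commute:
  assumes "e = 1 \<or> e = - 1" "f = 1 \<or> f = - 1"
  shows "perm_trace e (\<lambda>k. Lam (of_nat k * of_int e)) n $$ a * perm_trace f
      (\<lambda>k. Lam (of_nat k * of_int f)) m $$ b
    = perm_trace f (\<lambda>k. Lam (of_nat k * of_int f)) m $$ b * perm_trace e
        (\<lambda>k. Lam (of_nat k * of_int e)) n $$ a"
proof -
  interpret evaluated_RLL "\<lambda>k i j. fls_const (Lam (of_nat k * of_int e) i j)"
      "\<lambda>k i j. outer (Lam (of_nat k * of_int f) i j)"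
    "\<lambda>k. spectral_u (of_nat k * of_int e)" "\<lambda>k. spectral_v (of_nat k * of_int f)" hbar e f
    by (rule Lam_evaluated_RLL[OF assms])
  let ?F = "perm_trace e (\<lambda>k. Lam (of_nat k * of_int e)) n" and ?G
      = "perm_trace f (\<lambda>k. Lam (of_nat k * of_int f)) m"
  have "fls_const ?F * outer ?G = outer ?G * fls_const ?F"
    using perm_traces_commute[of n m]
    by (simp only: perm_trace_hom[of fls_const, OF fls_const_hom] perm_trace_hom[of outer, OF outer_hom])
  then have "(fls_const ?F * outer ?G) $$ b $$ a = (outer ?G * fls_const ?F) $$ b $$ a" by simp
  then show ?thesis by simp
qed

end

section \<open>The defining relations entrywise\<close>

lemma fscal_add: "fscal (c + d) = fscal c + fscal d"
  by (simp add: fscal_def single_add)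

lemma fscal_one: "fscal 1 = 1"
  by (simp add: fscal_def)

lemma fscal_zero: "fscal 0 = 0"
  by (simp add: fscal_def)

lemma fscal_minus: "fscal (- c) = - fscal c"
  by (simp add: fscal_def single_uminus)

lemma fscal_central: "fscal c * f = f * fscal c"
proof (induction f rule: update_induct)
  case const
  show ?case by simp
next
  case (update f k v)
  then have "Poly_Mapping.update k v f = Poly_Mapping.single k v + f"
    by (intro poly_mapping_eqI) (auto simp: lookup_update lookup_add lookup_single in_keys_iff)
  moreover have "fscal c * Poly_Mapping.single k v = Poly_Mapping.single k v * fscal c"
    by (simp only: fscal_def mult_single add_0_left add_0_right mult.commute[of c v])
  ultimately show ?case by (simp only: distrib_left distrib_right update.IH)
qed

text \<open>
The generators numbered by the power of \<open>u\<close> that they accompany.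
\<close>

definition fl :: "'n \<Rightarrow> 'n \<Rightarrow> int \<Rightarrow> 'n falg" where
  "fl i j r = fgen i j (- r)"

lemma coeff_mult_of_bool: "poly.coeff (p * of_bool b) k
    = poly.coeff p k * (of_bool b :: 'a::comm_semiring_1)"
  by (cases b) simp_all

lemma coeff_u_minus_v:
  "poly.coeff ([:[:0, 1:]:] - [:0, 1 :: 'a::comm_ring_1 poly:]) 0 = [:0, 1:]"
  "poly.coeff ([:[:0, 1:]:] - [:0, 1 :: 'a::comm_ring_1 poly:]) (Suc 0) = - 1"
  by (simp_all only: coeff_diff coeff_pCons_0 coeff_pCons_Suc coeff_0) simp_all

lemma Ruv_eq:
  "Ruv s t x y = poly.coeff (poly.coeff ([:[:0, 1:]:] - [:0, 1:]) t) s * of_bool (x = y)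
    - poly.coeff (poly.coeff [:[:fps_X:]:] t) s * perm_mat x y"
  unfolding Ruv_def Rmat_def perm_mat_def by (simp only: coeff_diff coeff_mult_of_bool)

lemma Ruv_values:
  "Ruv 0 0 x y = - fps_X * perm_mat x y" "Ruv (Suc 0) 0 x y = of_bool (x = y)"
  "Ruv 0 (Suc 0) x y = - of_bool (x = y)" "Ruv (Suc 0) (Suc 0) x y = 0"
  unfolding Ruv_eq coeff_u_minus_v by simp_all

lemma sum_FL1_FL2: "(\<Sum>q\<in>UNIV. FL1 r p q * FL2 s q y)
    = fl (fst p) (fst y) r * fl (snd p) (snd (y :: 'n::finite \<times> 'n)) s"
proof -
  have "(\<Sum>q\<in>UNIV. FL1 r p q * FL2 s q y) = (\<Sum>q\<in>{(fst y, snd p)}. FL1 r p q * FL2 s q y)"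
    by (rule sum.mono_neutral_right) (auto simp: FL1_def FL2_def)
  then show ?thesis by (simp add: FL1_def FL2_def fl_def)
qed

lemma sum_FL2_FL1: "(\<Sum>q\<in>UNIV. FL2 s x q * FL1 r q y)
    = fl (snd x) (snd y) s * fl (fst x) (fst (y :: 'n::finite \<times> 'n)) r"
proof -
  have "(\<Sum>q\<in>UNIV. FL2 s x q * FL1 r q y) = (\<Sum>q\<in>{(fst x, snd y)}. FL2 s x q * FL1 r q y)"
    by (rule sum.mono_neutral_right) (auto simp: FL1_def FL2_def)
  then show ?thesis by (simp add: FL1_def FL2_def fl_def)
qed

lemma sum_delta_perm:
  fixes g :: "'n::finite \<times> 'n \<Rightarrow> 'n falg"
  shows "(\<Sum>p\<in>UNIV. fscal (of_bool (x = p)) * g p) = g x" "(\<Sum>p\<in>UNIV. fscal (of_bool (p = x)) * g p) = g x"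
    "(\<Sum>p\<in>UNIV. fscal (perm_mat x p) * g p) = g (snd x, fst x)" "(\<Sum>p\<in>UNIV. fscal (perm_mat p x) * g p)
        = g (snd x, fst x)"
proof -
  have *: "(\<Sum>p\<in>UNIV. fscal (c p) * g p) = g z" if "c z = 1" "\<And>p. p \<noteq> z \<Longrightarrow> c p = 0" for c z
  proof -
    have "(\<Sum>p\<in>UNIV. fscal (c p) * g p) = (\<Sum>p\<in>{z}. fscal (c p) * g p)"
      by (rule sum.mono_neutral_right) (auto simp: that fscal_zero)
    then show ?thesis by (simp add: that fscal_one)
  qed
  show "(\<Sum>p\<in>UNIV. fscal (of_bool (x = p)) * g p) = g x" "(\<Sum>p\<in>UNIV. fscal (of_bool (p = x)) * g p) = g x"
    "(\<Sum>p\<in>UNIV. fscal (perm_mat x p) * g p) = g (snd x, fst x)" "(\<Sum>p\<in>UNIV. fscal (perm_mat p x) * g p)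
        = g (snd x, fst x)"
    by (rule *; auto simp: perm_mat_def prod_eq_iff)+
qed

text \<open>
The sums over intermediate indices in the relator collapse, since all matrices involved have at
most one nonzero entry for given indices. The four terms of \<open>R(u - v)\<close> contribute \<open>-h P\<close>, \<open>-v\<close>,
\<open>u\<close> and \<open>0\<close>.
\<close>

lemma rll_expand:
  "rll a b (i, k) (j, m) = (fl i j (a - 1) * fl k m b - fl k m b * fl i j (a - 1))
     - (fl i j a * fl k m (b - 1) - fl k m (b - 1) * fl i j a)
     - fscal fps_X * (fl k j a * fl i m b - fl k j b * fl i m a)"
proof -
  let ?x = "(i, k)" and ?y = "(j, m)"
  define S where "S c r s = (\<Sum>p\<in>UNIV. \<Sum>q\<in>UNIV. fscal (c p) * FL1 r p q * FL2 s q ?y)" for c r s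
  define T where "T c r s = (\<Sum>p\<in>UNIV. \<Sum>q\<in>UNIV. FL2 s ?x p * FL1 r p q * fscal (c q))" for c r s
  have S: "S c r s = (\<Sum>p\<in>UNIV. fscal (c p) * (fl (fst p) j r * fl (snd p) m s))" for c r s
    using sum_FL1_FL2[of r _ s ?y] by (simp add: S_def mult.assoc flip: sum_distrib_left)
  have T: "T c r s = (\<Sum>q\<in>UNIV. fscal (c q) * (fl k (snd q) s * fl i (fst q) r))" for c r s
    unfolding T_def
    by (subst sum.swap) (use sum_FL2_FL1[of s ?x r] in \<open>simp add: fscal_central flip: sum_distrib_right\<close>)
  have S': "S (\<lambda>p. - of_bool (?x = p)) r s = - (fl i j r * fl k m s)" "S (\<lambda>p. of_bool (?x = p)) r s
      = fl i j r * fl k m s"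
    "S (\<lambda>p. - fps_X * perm_mat ?x p) r s = - (fscal fps_X * (fl k j r * fl i m s))" "S (\<lambda>p. 0) r s = 0"
        for r s
    unfolding S
    by (simp_all add: fscal_minus fscal_mult fscal_zero
        mult.assoc sum_negf sum_delta_perm flip: sum_distrib_left)
  have T': "T (\<lambda>p. - of_bool (p = ?y)) r s = - (fl k m s * fl i j r)" "T (\<lambda>p. of_bool (p = ?y)) r s
      = fl k m s * fl i j r"
    "T (\<lambda>p. - fps_X * perm_mat p ?y) r s = - (fscal fps_X * (fl k j s * fl i m r))" "T (\<lambda>p. 0) r s = 0"
        for r s
    unfolding T
    by (simp_all add: fscal_minus fscal_mult fscal_zero
        mult.assoc sum_negf sum_delta_perm flip: sum_distrib_left)
  have "rll a b ?x ?y = (S (Ruv 0 0 ?x) a b + S (Ruv 0 (Suc 0) ?x) a (b - 1)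
      + (S (Ruv (Suc 0) 0 ?x) (a - 1) b + S (Ruv (Suc 0) (Suc 0) ?x) (a - 1) (b - 1)))
     - (T (\<lambda>q. Ruv 0 0 q ?y) a b + T (\<lambda>q. Ruv 0 (Suc 0) q ?y) a (b - 1)
         + (T (\<lambda>q. Ruv (Suc 0) 0 q ?y) (a - 1) b + T (\<lambda>q. Ruv (Suc 0) (Suc 0) q ?y) (a - 1) (b - 1)))"
    unfolding rll_def S_def T_def by (simp add: atMost_Suc)
  then show ?thesis
    unfolding Ruv_values S' T' by (simp add: algebra_simps)
qed

lemma yangian_relation:
  "(ygen i j (1 - a) * ygen k m (- b) - ygen k m (- b) * ygen i j (1 - a))
     - (ygen i j (- a) * ygen k m (1 - b) - ygen k m (1 - b) * ygen i j (- a))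
   = yscal fps_X * (ygen k j (- a) * ygen i m (- b) - ygen k j (- b) * ygen i m (- a))"
proof (transfer, goal_cases)
  case (1 i j a k m b)
  have "rll a b (i, k) (j, m) \<in> ideal_gen relators"
    by (rule ideal_gen_base) (unfold relators_def, blast)
  then show ?case unfolding rll_expand fl_def by simp
qed

lemma yscal_central: "yscal c * x = x * yscal c"
  by transfer (simp add: fscal_central ideal_gen_zero)

lemma yscal_add: "yscal (c + d) = yscal c + yscal d"
  by transfer (simp add: fscal_add ideal_gen_zero)

lemma yscal_one: "yscal 1 = 1"
  by transfer (simp add: fscal_one ideal_gen_zero)

lemma completion_hom:
  "completion (x + y) = completion x + completion y" "completion (x - y) = completion x - completion y"
  "completion (x * y) = completion x * completion y" "completion 1 = 1"
proof -
  have "eq_onp (\<lambda>a. compatible a \<and> (\<forall>p. a p - a p \<in> I_ideal p)) (\<lambda>_. z) (\<lambda>_. z)" for z :: "'a yangian"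
    by (simp add: eq_onp_def I_ideal_def ideal_gen_zero)
  then show "completion (x + y) = completion x + completion y" "completion (x - y)
      = completion x - completion y"
    "completion (x * y) = completion x * completion y" "completion 1 = 1"
    unfolding completion_def one_cyangian_def
    by (simp_all add: plus_cyangian.abs_eq minus_cyangian.abs_eq times_cyangian.abs_eq eq_onp_def I_ideal_def ideal_gen_zero)
qed

lemma cscal_central: "cscal c * x = x * cscal c"
proof -
  obtain a where a: "x = abs_cyangian a" "compatible a"
    by (metis Quotient3_abs_rep[OF Quotient3_cyangian] Quotient3_rep_reflp[OF Quotient3_cyangian])
  then show ?thesis
    unfolding cscal_def completion_def a(1)
    by (subst (1 2) times_cyangian.abs_eq) (simp_all add: eq_onp_def I_ideal_def ideal_gen_zero yscal_central)
qed

lemma cscal_hom: "cscal (c + d) = cscal c + cscal d" "cscal (c * d) = cscal c * cscal d" "cscal 1 = 1"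
  by (simp_all add: cscal_def yscal_add yscal_mult yscal_one completion_hom)

lemma cyangian_relation:
  "(cgen i j (1 - a) * cgen k m (- b) - cgen k m (- b) * cgen i j (1 - a))
     - (cgen i j (- a) * cgen k m (1 - b) - cgen k m (1 - b) * cgen i j (- a))
   = cscal fps_X * (cgen k j (- a) * cgen i m (- b) - cgen k j (- b) * cgen i m (- a))"
  using arg_cong[OF yangian_relation[of i j a k m b], of completion]
  by (simp only: completion_hom cgen_def cscal_def)

section \<open>A residue ring of the completed algebra\<close>

text \<open>
If some of the commutators are nonzero, then they are so modulo \<open>I_ideal p\<close> for some \<open>p\<close>, and one
such \<open>p\<close> is chosen; otherwise the value is arbitrary. The residue ring at this level is a type, on
which Laurent series can be formed.
\<close>

definition obstruction_level :: "'n::finite itself \<Rightarrow> nat" where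
  "obstruction_level _ = (SOME p. \<exists>(F :: 'n series) G n m a b. F \<in> {L_plus n, L_minus n}
      \<and> G \<in> {L_plus m, L_minus m}
     \<and> \<not> ceq p (F a * G b) (G b * F a))"

quotient_type 'n residue = "'n::finite cyangian" / "ceq (obstruction_level TYPE('n))"
  by (intro equivpI reflpI sympI transpI) (auto intro: ceq_sym ceq_trans)

lemma ceq_minus: "ceq p x x' \<Longrightarrow> ceq p y y' \<Longrightarrow> ceq p (x - y) (x' - y')"
  by transfer (simp only: I_ideal_congs(4-7) simp_thms)

lemma ceq_uminus: "ceq p x x' \<Longrightarrow> ceq p (- x) (- x')"
  by transfer (simp only: I_ideal_congs(4-7) simp_thms)

lemma not_ceq_0_1: "\<not> ceq p (0 :: 'n::finite cyangian) 1"
proof transfer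
  fix p
  have "yaug ((0 :: 'n yangian) - 1) \<noteq> 0"
    by (simp add: yaug_simps del: diff_0)
  then show "(0 :: 'n yangian) - 1 \<notin> I_ideal p"
    using yaug_I_ideal by blast
qed

instantiation residue :: (finite) ring_1
begin

lift_definition zero_residue :: "'a residue" is 0 .
lift_definition one_residue :: "'a residue" is 1 .
lift_definition plus_residue :: "'a residue \<Rightarrow> 'a residue \<Rightarrow> 'a residue" is "(+)" by (rule ceq_add)
lift_definition minus_residue :: "'a residue \<Rightarrow> 'a residue \<Rightarrow> 'a residue" is "(-)" by (rule ceq_minus)
lift_definition uminus_residue :: "'a residue \<Rightarrow> 'a residue" is uminus by (rule ceq_uminus)
lift_definition times_residue :: "'a residue \<Rightarrow> 'a residue \<Rightarrow> 'a residue" is "(*)" by (rule ceq_mult)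

instance
proof
  show "(0 :: 'a residue) \<noteq> 1" by transfer (rule not_ceq_0_1)
qed (transfer, simp add: algebra_simps)+

end

abbreviation res :: "'n::finite cyangian \<Rightarrow> 'n residue" where "res \<equiv> abs_residue"

lemmas res_simps = plus_residue.abs_eq[symmetric] minus_residue.abs_eq[symmetric]
  times_residue.abs_eq[symmetric] zero_residue_def[symmetric] one_residue_def[symmetric]

lemma res_eq_iff: "res (x :: 'n::finite cyangian) = res y \<longleftrightarrow> ceq (obstruction_level TYPE('n)) x y"
  by (rule residue.abs_eq_iff)

lemma res_eq_0_iff: "res (x :: 'n::finite cyangian) = 0 \<longleftrightarrow> ceq (obstruction_level TYPE('n)) x 0"
  using res_eq_iff[of x 0] by (simp add: res_simps)

lemma res_sum: "res (sum f A) = (\<Sum>i\<in>A. res (f i))"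
  by (induction A rule: infinite_finite_induct) (simp_all add: res_simps flip: plus_residue.abs_eq)

text \<open>
Infinite sums over the completed algebra become finite in the residue ring.
\<close>

lemma res_infsum:
  fixes f :: "'i \<Rightarrow> 'n::finite cyangian"
  assumes fin: "\<And>p. finite {i \<in> UNIV. \<not> ceq p (f i) 0}" and J: "finite J" "\<And>i. i \<notin> J \<Longrightarrow> res (f i) = 0"
  shows "res (infsum f UNIV) = (\<Sum>i\<in>J. res (f i))"
proof -
  obtain s where s: "(f has_sum s) UNIV" "\<And>p. ceq p s (sum f {i \<in> UNIV. \<not> ceq p (f i) 0})"
    using summable_on_cyangian[of UNIV f, OF fin] by blast
  let ?K = "{i \<in> UNIV. \<not> ceq (obstruction_level TYPE('n)) (f i) 0}"
  have "res (infsum f UNIV) = res (sum f ?K)"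
    using s(2) by (simp add: infsumI[OF s(1)] res_eq_iff)
  also have "\<dots> = (\<Sum>i\<in>?K. res (f i))" by (rule res_sum)
  also have "\<dots> = (\<Sum>i\<in>J. res (f i))"
    by (rule sum.mono_neutral_left[OF J(1)]) (use J(2) res_eq_0_iff in \<open>auto simp: res_eq_0_iff\<close>)
  finally show ?thesis .
qed

interpretation residue: truncated_RLL "\<lambda>i j r. res (cgen i j (- r)) :: 'n::finite residue"
    "\<lambda>z. res (cscal z)"
  "int (obstruction_level TYPE('n))"
proof
  show "central (res (cscal z) :: 'n residue)" for z
    unfolding central_def
  proof
    fix x :: "'n residue"
    obtain x' where "x = res x'" by (metis Quotient3_abs_rep[OF Quotient3_residue])
    then show "res (cscal z) * x = x * res (cscal z)"
      by (simp add: cscal_central flip: times_residue.abs_eq) (simp add: times_residue.abs_eq cscal_central)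
  qed
  show "res (cgen i j (- r)) = (0 :: 'n residue)" if "r > int (obstruction_level TYPE('n))" for i j r
    unfolding res_eq_0_iff by (rule ceq_cgen[OF that])
  fix i j k m :: 'n and r s
  show "(res (cgen i j (- (r - 1))) * res (cgen k m (- s))
      - res (cgen k m (- s)) * res (cgen i j (- (r - 1))))
      - (res (cgen i j (- r)) * res (cgen k m (- (s - 1)))
          - res (cgen k m (- (s - 1))) * res (cgen i j (- r)))
    = res (cscal fps_X) * (res (cgen k j (- r)) * res (cgen i m (- s))
        - res (cgen k j (- s)) * res (cgen i m (- r)))"
    using arg_cong[OF cyangian_relation[of i j r k m s], of res]
    by (simp only: res_simps[symmetric] minus_diff_eq)
qed (simp_all only: cscal_hom res_simps)

section \<open>The series as traces over the residue ring\<close>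

text \<open>
Modulo \<open>I_ideal p\<close> a bounded series is a Laurent series in \<open>z\<close> inverse.
\<close>

definition ser_fls :: "'n::finite series \<Rightarrow> 'n residue fls" where
  "ser_fls f = Abs_fls (\<lambda>k. res (f (- k)))"

lemma bounded_series_res:
  fixes f :: "'n::finite series"
  assumes "bounded_series f"
  obtains B where "\<And>m. m > B \<Longrightarrow> res (f m) = 0"
  using assms unfolding bounded_series_def res_eq_0_iff by blast

lemma ser_fls_nth:
  assumes "bounded_series f"
  shows "ser_fls f $$ k = res (f (- k))"
proof -
  obtain B where "\<And>m. m > B \<Longrightarrow> res (f m) = 0" using bounded_series_res[OF assms] by blast
  then show ?thesis
    unfolding ser_fls_def by (intro nth_Abs_fls_ex_lower_bound exI[of _ "- B"]) auto
qed

lemma ser_fls_mult: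
  fixes f g :: "'n::finite series"
  assumes "bounded_series f" "bounded_series g"
  shows "ser_fls (ser_mult f g) = ser_fls f * ser_fls g"
proof (rule fls_eqI)
  fix k
  obtain B C where B: "\<And>m. m > B \<Longrightarrow> res (f m) = 0" and C: "\<And>m. m > C \<Longrightarrow> res (g m) = 0"
    using assms by (metis bounded_series_res)
  define p where "p = max B C"
  have "ser_fls (ser_mult f g) $$ k = res (\<Sum>\<^sub>\<infinity>a. f a * g (- k - a))"
    using bounded_series_ser_mult[OF assms] by (simp add: ser_fls_nth ser_mult_def)
  also have "\<dots> = (\<Sum>a\<in>{- k - p..p}. res (f a * g (- k - a)))"
  proof (rule res_infsum[OF ser_mult_finite[OF assms]])
    fix a assume "a \<notin> {- k - p..p}"
    then have "a > B \<or> - k - a > C" by (auto simp: p_def)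
    then show "res (f a * g (- k - a)) = 0" using B C by (auto simp: times_residue.abs_eq[symmetric])
  qed simp
  also have "\<dots> = (ser_fls f * ser_fls g) $$ k"
    using fls_times_nth_bounded[of p "ser_fls f" "ser_fls g" "- k"]
    by (simp add: ser_fls_nth assms B C p_def times_residue.abs_eq minus_diff_commute)
  finally show "ser_fls (ser_mult f g) $$ k = (ser_fls f * ser_fls g) $$ k" .
qed

lemma bounded_series_zero: "bounded_series (\<lambda>_. 0)"
  by (simp add: bounded_series_def)

lemma bounded_series_sum:
  assumes "\<And>i. i \<in> I \<Longrightarrow> bounded_series (f i)"
  shows "bounded_series (\<lambda>m. \<Sum>i\<in>I. f i m)"
  using assms
proof (induction I rule: infinite_finite_induct)
  case (insert i I)
  show ?case
    unfolding bounded_series_def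
  proof
    fix p
    obtain B C where B: "\<And>m. m > B \<Longrightarrow> ceq p (f i m) 0" and C: "\<And>m. m > C \<Longrightarrow> ceq p (\<Sum>i\<in>I. f i m) 0"
      using insert unfolding bounded_series_def by (metis insertCI)
    then have "\<forall>m > max B C. ceq p (\<Sum>i\<in>insert i I. f i m) 0"
      using insert.hyps ceq_add[of p _ 0 _ 0] by auto
    then show "\<exists>B. \<forall>m>B. ceq p (\<Sum>i\<in>insert i I. f i m) 0" ..
  qed
qed (simp_all add: bounded_series_zero)

lemma ser_fls_sum:
  assumes "\<And>i. i \<in> I \<Longrightarrow> bounded_series (f i)"
  shows "ser_fls (\<lambda>m. \<Sum>i\<in>I. f i m) = (\<Sum>i\<in>I. ser_fls (f i))"
  using assms by (intro fls_eqI) (simp add: ser_fls_nth bounded_series_sum res_sum fls_nth_sum)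

lemma ser_fls_zero: "ser_fls (\<lambda>_. 0) = 0"
  by (rule fls_eqI) (simp add: ser_fls_nth bounded_series_zero zero_residue_def)

lemma ser_fls_lam: "ser_fls (lam c i j) = residue.Lam c i j"
proof (rule fls_eqI)
  fix k
  have "res (lam c i j (- k)) = (\<Sum>r\<in>{- k..int (obstruction_level TYPE('a))}.
      res (cscal (shifted_power c r (- k)) * cgen i j (- r)))"
    unfolding lam_def
    by (rule res_infsum[OF lam_finite]) (simp, unfold res_eq_0_iff, erule lam_term)
  then show "ser_fls (lam c i j) $$ k = residue.Lam c i j $$ k"
    by (simp only: ser_fls_nth[OF bounded_series_lam] residue.Lam_nth residue.t_def
        residue.shift_coeff_def times_residue.abs_eq)
qed

lemma tidx_eqI:
  assumes "x \<in> tidx n" "y \<in> tidx n" "\<And>l. l \<in> {1..n} \<Longrightarrow> x l = y l"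
  shows "x = y"
  using assms unfolding tidx_def by (rule PiE_ext)

text \<open>
The factors \<open>k + 1, \<dots>, n\<close> are untouched by the first \<open>k\<close> matrices. In the inductive step only one
intermediate configuration contributes, the one that has already got the entry \<open>w (Suc k)\<close> on the
left but agrees with \<open>x\<close> elsewhere.
\<close>

lemma ser_fls_Lprod:
  assumes "k \<le> n" "w \<in> tidx n" "x \<in> tidx n"
  shows "bounded_series (Lprod n c k w x :: 'n::finite series) \<and>
    ser_fls (Lprod n c k w x) = (if \<forall>l\<in>{k + 1..n}. w l = x l
      then prod_list (map (\<lambda>i. residue.Lam (of_nat i * c) (w (Suc i)) (x (Suc i))) [0..<k]) else 0)"
  using assms
proof (induction k arbitrary: x)
  case 0
  have *: "(\<forall>l\<in>{Suc 0..n}. w l = x l) \<longleftrightarrow> w = x"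
    using tidx_eqI[OF 0(2,3)] by auto
  have b: "bounded_series (tmat_one w x :: 'n series)"
    unfolding bounded_series_def by (intro allI exI[of _ 0]) (simp add: tmat_one_def)
  moreover have "ser_fls (tmat_one w x :: 'n series) = (if w = x then 1 else 0)"
    by (rule fls_eqI) (auto simp: ser_fls_nth[OF b] tmat_one_def zero_residue_def one_residue_def)
  ultimately show ?case by (simp add: *)
next
  case (Suc k)
  let ?L = "\<lambda>i. residue.Lam (of_nat i * c) :: 'n \<Rightarrow> _" and ?c = "of_nat k * c"
  let ?M = "Lcopy n (Suc k) ?c :: 'n tmat"
  have bM: "bounded_series (?M v x)" for v
    unfolding Lcopy_def by (auto simp: bounded_series_lam bounded_series_zero)
  have M: "ser_fls (?M v x) = (if \<forall>l\<in>{1..n} - {Suc k}. v l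
      = x l then ?L k (v (Suc k)) (x (Suc k)) else 0)" for v
    unfolding Lcopy_def by (auto simp: ser_fls_lam ser_fls_zero)
  have IH: "bounded_series (Lprod n c k w v)"
    "ser_fls (Lprod n c k w v) = (if \<forall>l\<in>{k + 1..n}. w l
        = v l then prod_list (map (\<lambda>i. ?L i (w (Suc i)) (v (Suc i))) [0..<k]) else 0)"
    if "v \<in> tidx n" for v
    using Suc.IH[OF _ Suc.prems(2) that] Suc.prems(1) by auto
  define v0 where "v0 = x(Suc k := w (Suc k))"
  have v0: "v0 \<in> tidx n"
    using Suc.prems unfolding v0_def tidx_def by (auto simp: PiE_def extensional_def)
  have b: "bounded_series (ser_mult (Lprod n c k w v) (?M v x))" if "v \<in> tidx n" for v
    using IH(1)[OF that] bM by (rule bounded_series_ser_mult)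
  have "Lprod n c (Suc k) w x = (\<lambda>m. \<Sum>v\<in>tidx n. ser_mult (Lprod n c k w v) (?M v x) m)"
    by (simp add: tmat_mult_def fun_eq_iff)
  then have bL: "bounded_series (Lprod n c (Suc k) w x)"
    and "ser_fls (Lprod n c (Suc k) w x) = (\<Sum>v\<in>tidx n. ser_fls (ser_mult (Lprod n c k w v) (?M v x)))"
    using b by (simp_all add: bounded_series_sum ser_fls_sum del: Lprod.simps)
  note this(2)
  also have "\<dots> = (\<Sum>v\<in>tidx n. ser_fls (Lprod n c k w v) * ser_fls (?M v x))"
    using IH(1) bM by (intro sum.cong refl ser_fls_mult)
  also have "\<dots> = (\<Sum>v\<in>{v0}. ser_fls (Lprod n c k w v) * ser_fls (?M v x))"
  proof (rule sum.mono_neutral_right)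
    show "finite (tidx n :: (nat \<Rightarrow> 'n) set)" unfolding tidx_def by (intro finite_PiE) auto
    show "\<forall>v\<in>tidx n - {v0}. ser_fls (Lprod n c k w v) * ser_fls (?M v x) = 0"
    proof
      fix v assume v: "v \<in> tidx n - {v0}"
      then obtain l where l: "l \<in> {1..n}" "v l \<noteq> v0 l" using tidx_eqI[OF _ v0, of v] by auto
      show "ser_fls (Lprod n c k w v) * ser_fls (?M v x) = 0"
      proof (cases "l = Suc k")
        case True
        then have "w (Suc k) \<noteq> v (Suc k)" "Suc k \<in> {k + 1..n}" using l by (auto simp: v0_def)
        then have "\<not> (\<forall>l\<in>{k + 1..n}. w l = v l)" by blast
        then have "ser_fls (Lprod n c k w v) = 0" using IH(2)[of v] v by (simp only: if_False DiffD1)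
        then show ?thesis by simp
      next
        case False
        then have "\<not> (\<forall>l\<in>{1..n} - {Suc k}. v l = x l)" using l by (auto simp: v0_def)
        then have "ser_fls (?M v x) = 0" by (simp only: M if_False)
        then show ?thesis by simp
      qed
    qed
  qed (use v0 in simp)
  also have "\<dots> = ser_fls (Lprod n c k w v0) * ?L k (w (Suc k)) (x (Suc k))"
    by (simp add: M v0_def)
  also have "ser_fls (Lprod n c k w v0) = (if \<forall>l\<in>{Suc k + 1..n}. w l = x l
      then prod_list (map (\<lambda>i. ?L i (w (Suc i)) (x (Suc i))) [0..<k]) else 0)"
  proof -
    have "{k + 1..n} = insert (Suc k) {Suc k + 1..n}" using Suc.prems by auto
    then have "(\<forall>l\<in>{k + 1..n}. w l = v0 l) \<longleftrightarrow> (\<forall>l\<in>{Suc k + 1..n}. w l = x l)"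
      by (auto simp: v0_def)
    moreover have "map (\<lambda>i. ?L i (w (Suc i)) (v0 (Suc i))) [0..<k]
        = map (\<lambda>i. ?L i (w (Suc i)) (x (Suc i))) [0..<k]"
      by (simp add: v0_def)
    ultimately show ?thesis by (simp only: IH(2)[OF v0])
  qed
  finally show ?case using bL by auto
qed

lemma symmetrizer_perm_char:
  "symmetrizer n x y = 1 / fact n * (\<Sum>\<sigma> | \<sigma> permutes {1..n}. of_int (perm_char 1 \<sigma>) * perm_op n \<sigma> x y)"
  "antisymmetrizer n x y = 1 / fact n * (\<Sum>\<sigma> | \<sigma> permutes {1..n}. of_int (perm_char (- 1) \<sigma>)
      * perm_op n \<sigma> x y)"
  by (simp_all add: symmetrizer_def antisymmetrizer_def perm_char_def)

text \<open>
Each permutation selects a single row index \<open>w = x \<circ> \<sigma>\<close> of the product of matrices.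
\<close>

lemma res_tmat_trace:
  fixes E :: "(nat \<Rightarrow> 'n::finite) \<Rightarrow> (nat \<Rightarrow> 'n) \<Rightarrow> complex"
  assumes E: "\<And>x y. E x y = 1 / fact n * (\<Sum>\<sigma> | \<sigma> permutes {1..n}. of_int (perm_char e \<sigma>) * perm_op n \<sigma> x y)"
    and e: "e = 1 \<or> e = - 1"
  shows "res (tmat_trace n (tmat_scal_mult n E (Lprod n (of_int e) n)) m)
    = res (cscal (fps_const (1 / fact n))) * perm_trace e (\<lambda>k. residue.Lam (of_nat k * of_int e)) n $$
        (- m)"
proof -
  let ?\<kappa> = "\<lambda>z. res (cscal (fps_const z)) :: 'n residue"
  have add: "?\<kappa> (z + w) = ?\<kappa> z + ?\<kappa> w" and mult: "?\<kappa> (z * w) = ?\<kappa> z * ?\<kappa> w" for z w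
    by (simp_all flip: fps_const_add fps_const_mult add: residue.\<kappa>_add residue.\<kappa>_mult)
  have sum: "?\<kappa> (\<Sum>i\<in>I. z i) = (\<Sum>i\<in>I. ?\<kappa> (z i))" for I and z :: "'i \<Rightarrow> complex"
    by (induction I rule: infinite_finite_induct) (simp_all add: add residue.\<kappa>_zero)
  have sgn: "?\<kappa> (of_int (perm_char e \<sigma>)) = of_int (perm_char e \<sigma>)" for \<sigma>
    by (rule residue.\<kappa>_sign, cases \<sigma> rule: sign_cases) (simp_all add: perm_char_def)
  let ?P = "\<lambda>w x. prod_list (map (\<lambda>i. residue.Lam (of_nat i * of_int e) (w (Suc i)) (x (Suc i))) [0..<n])"
  have L: "res (Lprod n (of_int e) n w x m) = ?P w x $$ (- m)" if "w \<in> tidx n" "x \<in> tidx n"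
      for w x :: "nat \<Rightarrow> 'n"
    using ser_fls_Lprod[OF order_refl that, of "of_int e"] ser_fls_nth[of "Lprod n (of_int e) n w x"
        "- m"] by simp
  have inner: "(\<Sum>w\<in>tidx n. ?\<kappa> (E x w) * ?P w x $$ (- m))
    = ?\<kappa> (1 / fact n) * (\<Sum>\<sigma> | \<sigma> permutes {1..n}. of_int (perm_char e \<sigma>) * ?P (x \<circ> \<sigma>) x $$ (- m))"
    if x: "x \<in> tidx n" for x
  proof -
    have one_w: "(\<Sum>w\<in>tidx n. ?\<kappa> (perm_op n \<sigma> x w) * ?P w x $$ (- m)) = ?P (x \<circ> \<sigma>) x $$ (- m)" for \<sigma>
    proof -
      define w0 where "w0 = restrict (x \<circ> \<sigma>) {1..n}"
      have w0: "w0 \<in> tidx n" by (simp add: w0_def tidx_def)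
      have "perm_op n \<sigma> x w = of_bool (w = w0)" if "w \<in> tidx n" for w
      proof -
        have "w = w0" if "\<forall>k\<in>{1..n}. x (\<sigma> k) = w k"
          using that by (intro tidx_eqI[OF \<open>w \<in> tidx n\<close> w0]) (simp add: w0_def)
        then have "(\<forall>k\<in>{1..n}. x (\<sigma> k) = w k) \<longleftrightarrow> w = w0"
          by (auto simp: w0_def)
        then show ?thesis by (simp only: perm_op_def)
      qed
      then have "(\<Sum>w\<in>tidx n. ?\<kappa> (perm_op n \<sigma> x w) * ?P w x $$ (- m))
        = (\<Sum>w\<in>tidx n. if w = w0 then ?P w x $$ (- m) else 0)"
        by (intro sum.cong refl) (auto simp: residue.\<kappa>_zero residue.\<kappa>_one)
      also have "\<dots> = ?P w0 x $$ (- m)"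
        using w0 by (subst sum.delta) (auto simp: tidx_def intro!: finite_PiE)
      also have "?P w0 x = ?P (x \<circ> \<sigma>) x"
        by (intro arg_cong[where f = prod_list] map_cong refl) (simp add: w0_def)
      finally show ?thesis .
    qed
    have "(\<Sum>w\<in>tidx n. ?\<kappa> (E x w) * ?P w x $$ (- m))
      = (\<Sum>w\<in>tidx n. \<Sum>\<sigma> | \<sigma> permutes {1..n}. ?\<kappa> (1 / fact n) *
          (of_int (perm_char e \<sigma>) * (?\<kappa> (perm_op n \<sigma> x w) * ?P w x $$ (- m))))"
      unfolding E mult sum sgn sum_distrib_left sum_distrib_right mult.assoc ..
    also have "\<dots> = (\<Sum>\<sigma> | \<sigma> permutes {1..n}. ?\<kappa> (1 / fact n) *
        (of_int (perm_char e \<sigma>) * (\<Sum>w\<in>tidx n. ?\<kappa> (perm_op n \<sigma> x w) * ?P w x $$ (- m))))"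
      unfolding sum_distrib_left by (rule sum.swap)
    finally show ?thesis by (simp only: one_w sum_distrib_left)
  qed
  have "res (tmat_trace n (tmat_scal_mult n E (Lprod n (of_int e) n)) m)
    = (\<Sum>x\<in>tidx n. \<Sum>w\<in>tidx n. ?\<kappa> (E x w) * ?P w x $$ (- m))"
    unfolding tmat_trace_def tmat_scal_mult_def res_sum times_residue.abs_eq[symmetric]
    by (intro sum.cong refl) (simp only: L)
  also have "\<dots> = ?\<kappa> (1 / fact n) * (\<Sum>x\<in>tidx n. \<Sum>\<sigma> | \<sigma> permutes {1..n}. of_int (perm_char e \<sigma>) * ?P
      (x \<circ> \<sigma>) x $$ (- m))"
    unfolding sum_distrib_left by (intro sum.cong refl) (simp only: inner sum_distrib_left)
  also have "(\<Sum>x\<in>tidx n. \<Sum>\<sigma> | \<sigma> permutes {1..n}. of_int (perm_char e \<sigma>) * ?P (x \<circ> \<sigma>) x $$ (- m))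
    = perm_trace e (\<lambda>k. residue.Lam (of_nat k * of_int e)) n $$ (- m)"
    by (simp add: perm_trace_def fls_nth_sum fls_of_int)
  finally show ?thesis .
qed

lemma res_L_series:
  assumes "F \<in> {L_plus n, L_minus n :: 'n::finite series}"
  obtains e where "e = 1 \<or> e = - 1"
    "\<And>m. res (F m) = res (cscal (fps_const (1 / fact n))) * perm_trace e
        (\<lambda>k. residue.Lam (of_nat k * of_int e)) n $$ (- m)"
proof -
  have "res (L_plus n m :: 'n cyangian) = res (cscal (fps_const (1 / fact n))) * perm_trace 1
      (\<lambda>k. residue.Lam (of_nat k * of_int 1)) n $$ (- m)" for m
    using res_tmat_trace[OF symmetrizer_perm_char(1), of n m] by (simp add: L_plus_def)
  moreover have "res (L_minus n m :: 'n cyangian) = res (cscal (fps_const (1 / fact n))) * perm_trace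
      (- 1) (\<lambda>k. residue.Lam (of_nat k * of_int (- 1))) n $$ (- m)" for m
    using res_tmat_trace[OF symmetrizer_perm_char(2), of n m] by (simp add: L_minus_def)
  ultimately show ?thesis using assms that[of 1] that[of "- 1"] by auto
qed

section \<open>Commutativity\<close>

lemma commute_at_obstruction_level:
  fixes F G :: "'n::finite series"
  assumes "F \<in> {L_plus n, L_minus n}" "G \<in> {L_plus m, L_minus m}"
  shows "ceq (obstruction_level TYPE('n)) (F a * G b) (G b * F a)"
proof -
  obtain e where e: "e = 1 \<or> e = - 1"
    and F: "\<And>m. res (F m) = res (cscal (fps_const (1 / fact n))) * perm_trace e
        (\<lambda>k. residue.Lam (of_nat k * of_int e)) n $$ (- m)"
    using res_L_series[OF assms(1)] by blast
  obtain f where f: "f = 1 \<or> f = - 1"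
    and G: "\<And>k. res (G k) = res (cscal (fps_const (1 / fact m))) * perm_trace f
        (\<lambda>k. residue.Lam (of_nat k * of_int f)) m $$ (- k)"
    using res_L_series[OF assms(2)] by blast
  define z w where "z = (res (cscal (fps_const (1 / fact n))) :: 'n residue)" and "w
      = (res (cscal (fps_const (1 / fact m))) :: 'n residue)"
  have zw: "central z" "central w" unfolding z_def w_def by (rule residue.\<kappa>_central)+
  define x where "x = perm_trace e (\<lambda>k. residue.Lam (of_nat k * of_int e) :: 'n \<Rightarrow> _) n $$ (- a)"
  define y where "y = perm_trace f (\<lambda>k. residue.Lam (of_nat k * of_int f) :: 'n \<Rightarrow> _) m $$ (- b)"
  have xy: "x * y = y * x" unfolding x_def y_def by (rule residue.perm_trace_coefficients_commute[OF e f])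
  have "z * x * (w * y) = z * (w * (x * y))"
    by (simp only: mult.assoc central_left_commute[OF zw(2)])
  also have "\<dots> = w * (z * (y * x))"
    by (simp only: xy central_left_commute[OF zw(1), of w])
  also have "\<dots> = w * y * (z * x)"
    by (simp only: mult.assoc central_left_commute[OF zw(1), of y])
  finally have "res (F a * G b) = res (G b * F a)"
    by (simp only: times_residue.abs_eq[symmetric] F G z_def w_def x_def y_def)
  then show ?thesis by (simp only: res_eq_iff)
qed

theorem proposition7p2:
  fixes F G :: "'n::finite series"
  assumes "CARD('n) \<ge> 2"
    and "n \<in> {1..CARD('n)}" and "m \<in> {1..CARD('n)}"
    and "F \<in> {L_plus n, L_minus n}" and "G \<in> {L_plus m, L_minus m}"
  shows "F a * G b = G b * F a"
proof (rule cyangian_eqI)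
  fix p
  show "ceq p (F a * G b) (G b * F a)"
  proof (rule ccontr)
    assume "\<not> ceq p (F a * G b) (G b * F a)"
    then have "\<exists>p. \<exists>(F :: 'n series) G n m a b. F \<in> {L_plus n, L_minus n} \<and> G \<in> {L_plus m, L_minus m}
       \<and> \<not> ceq p (F a * G b) (G b * F a)"
      using assms(4,5) by blast
    then have "\<exists>(F :: 'n series) G n m a b. F \<in> {L_plus n, L_minus n} \<and> G \<in> {L_plus m, L_minus m}
       \<and> \<not> ceq (obstruction_level TYPE('n)) (F a * G b) (G b * F a)"
      unfolding obstruction_level_def by (rule someI_ex)
    then show False using commute_at_obstruction_level by blast
  qed
qed

end
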